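(* Let $F^l$ be a compact oriented submanifold of a flat Riemannian manifold $M^n$, and let $\xi$ be a vector field on $M^n$ along $F^l$. Then $\xi(F^l)$ is totally geodesic in $TM^n$ (with the Sasaki metric) if and only if $F^l$ is totally geodesic in $M^n$ and $\xi$ is parallel along $F^l$.
   Context: All manifolds and vector fields are smooth; superscripts denote dimensions. $\bar\nabla$ is the Levi-Civita connection of the metric $\bar g$ of $M^n$. Let $\pi:TM^n\to M^n$ be the projection and $K:TTM^n\to TM^n$ the connection map, given in induced coordinates $(x^a,\xi^a)$ by $K(\tilde X^a\partial_{x^a}+\tilde X^{n+a}\partial_{\xi^a})=(\tilde X^{n+a}+\bar\Gamma^a_{bc}\xi^b\tilde X^c)\partial_{x^a}$. The Sasaki metric on $TM^n$ is $g_s(\tilde X,\tilde Y)=\bar g(\pi_*\tilde X,\pi_*\tilde Y)+\bar g(K\tilde X,K\tilde Y)$. A vector field on $M^n$ along $F$ is a smooth map $\xi:F\to TM^n$ with $\pi\circ\xi=\mathrm{Id}_F$ (not necessarily tangent to $F$); $\xi(F)$ is its image; $\xi$ is parallel along $F$ if $\bar\nabla_X\xi=0$ for all $X$ tangent to $F$. *)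

theory Defs
  imports "HOL-Analysis.Analysis"
begin

text \<open>
  Smooth manifolds are given by an atlas of charts into a Euclidean space \<open>'e\<close>, so the dimension
  is \<open>DIM('e)\<close>; the tangent bundle is then a manifold of the same kind, modelled on \<open>'e \<times> 'e\<close>.
  All notions on \<open>M\<close> and on \<open>TM\<close> (submanifolds, covariant derivative, second fundamental form) are
  instances of the same generic definitions.
\<close>

subsection \<open>Smooth maps between open subsets of Euclidean spaces\<close>

primrec Ck_on :: "nat \<Rightarrow> 'a::euclidean_space set \<Rightarrow> ('a \<Rightarrow> 'b::real_normed_vector) \<Rightarrow> bool" where
  "Ck_on 0 S f \<longleftrightarrow> continuous_on S f"
| "Ck_on (Suc k) S f \<longleftrightarrow>
     (\<forall>x\<in>S. f differentiable (at x)) \<and> (\<forall>v. Ck_on k S (\<lambda>x. frechet_derivative f (at x) v))"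

text \<open>Only meant for open \<open>S\<close>.\<close>

definition smooth_on :: "'a::euclidean_space set \<Rightarrow> ('a \<Rightarrow> 'b::real_normed_vector) \<Rightarrow> bool" where
  "smooth_on S f \<longleftrightarrow> (\<forall>k. Ck_on k S f)"

subsection \<open>Manifolds\<close>

text \<open>A chart is a domain together with a map; values of the map off the domain are irrelevant.\<close>

type_synonym ('a, 'e) chart = "'a set \<times> ('a \<Rightarrow> 'e)"

abbreviation cdom :: "('a, 'e) chart \<Rightarrow> 'a set" where "cdom c \<equiv> fst c"
abbreviation cmap :: "('a, 'e) chart \<Rightarrow> 'a \<Rightarrow> 'e" where "cmap c \<equiv> snd c"
abbreviation cinv :: "('a, 'e) chart \<Rightarrow> 'e \<Rightarrow> 'a" where "cinv c \<equiv> inv_into (cdom c) (cmap c)"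
abbreviation crange :: "('a, 'e) chart \<Rightarrow> 'e set" where "crange c \<equiv> cmap c ` cdom c"

definition transition :: "('a, 'e) chart \<Rightarrow> ('a, 'e) chart \<Rightarrow> 'e \<Rightarrow> 'e" where
  "transition c d = cmap d \<circ> cinv c"

definition compatible :: "('a, 'e::euclidean_space) chart \<Rightarrow> ('a, 'e) chart \<Rightarrow> bool" where
  "compatible c d \<longleftrightarrow>
     open (cmap c ` (cdom c \<inter> cdom d)) \<and> open (cmap d ` (cdom c \<inter> cdom d)) \<and>
     smooth_on (cmap c ` (cdom c \<inter> cdom d)) (transition c d) \<and>
     smooth_on (cmap d ` (cdom c \<inter> cdom d)) (transition d c)"

definition smooth_atlas :: "('a, 'e::euclidean_space) chart set \<Rightarrow> bool" where
  "smooth_atlas A \<longleftrightarrow> (\<forall>c\<in>A. inj_on (cmap c) (cdom c)) \<and> (\<forall>c\<in>A. \<forall>d\<in>A. compatible c d)"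

definition carrier_of :: "('a, 'e) chart set \<Rightarrow> 'a set" where
  "carrier_of A = (\<Union>c\<in>A. cdom c)"

text \<open>For a smooth atlas the generating sets form a base; this is the topology that makes all
  charts homeomorphisms from open sets onto open sets.\<close>

definition mtopology :: "('a, 'e::euclidean_space) chart set \<Rightarrow> 'a topology" where
  "mtopology A = topology_generated_by {{p \<in> cdom c. cmap c p \<in> V} | c V. c \<in> A \<and> open V}"

definition smooth_manifold :: "('a, 'e::euclidean_space) chart set \<Rightarrow> bool" where
  "smooth_manifold A \<longleftrightarrow>
     smooth_atlas A \<and> Hausdorff_space (mtopology A) \<and> second_countable (mtopology A)"

definition max_atlas :: "('a, 'e::euclidean_space) chart set \<Rightarrow> ('a, 'e) chart set" where
  "max_atlas A =
     {c. cdom c \<subseteq> carrier_of A \<and> inj_on (cmap c) (cdom c) \<and> (\<forall>d\<in>A. compatible c d)}"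

definition charts_at :: "('a, 'e::euclidean_space) chart set \<Rightarrow> 'a \<Rightarrow> ('a, 'e) chart set" where
  "charts_at A p = {c \<in> max_atlas A. p \<in> cdom c}"

text \<open>Smoothness of a map from an arbitrary subset \<open>S\<close>: near each point of \<open>S\<close> the map extends to a
  smooth map of an open subset (a chart domain) of the ambient manifold. For an embedded submanifold
  \<open>S\<close> this is smoothness with respect to its own manifold structure.\<close>

definition smooth_map_on ::
  "('a, 'e::euclidean_space) chart set \<Rightarrow> ('b, 'f::euclidean_space) chart set \<Rightarrow> 'a set \<Rightarrow> ('a \<Rightarrow> 'b) \<Rightarrow> bool"
where
  "smooth_map_on A B S f \<longleftrightarrow>
     (\<forall>p\<in>S. \<exists>c\<in>charts_at A p. \<exists>d\<in>charts_at B (f p). \<exists>h.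
        h ` cdom c \<subseteq> cdom d \<and> (\<forall>q\<in>S \<inter> cdom c. h q = f q) \<and>
        smooth_on (crange c) (cmap d \<circ> h \<circ> cinv c))"

subsection \<open>Tangent vectors and the tangent bundle\<close>

text \<open>A tangent vector at \<open>p\<close> is the family of its components in all charts around \<open>p\<close>, related by the
  derivatives of the coordinate changes (and \<open>0\<close> at charts not around \<open>p\<close>, to make it unique).\<close>

type_synonym ('a, 'e) tvec = "('a, 'e) chart \<Rightarrow> 'e"

definition tspace :: "('a, 'e::euclidean_space) chart set \<Rightarrow> 'a \<Rightarrow> ('a, 'e) tvec set" where
  "tspace A p =
     {v. (\<forall>c\<in>charts_at A p. \<forall>d\<in>charts_at A p.
            v d = frechet_derivative (transition c d) (at (cmap c p)) (v c)) \<and>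
         (\<forall>c. c \<notin> charts_at A p \<longrightarrow> v c = 0)}"

text \<open>The tangent vector at \<open>p\<close> whose component in the chart \<open>c\<close> is \<open>u\<close>.\<close>

definition tvec_at ::
  "('a, 'e::euclidean_space) chart set \<Rightarrow> ('a, 'e) chart \<Rightarrow> 'a \<Rightarrow> 'e \<Rightarrow> ('a, 'e) tvec" where
  "tvec_at A c p u =
     (\<lambda>d. if d \<in> charts_at A p then frechet_derivative (transition c d) (at (cmap c p)) u else 0)"

text \<open>The differential of a map at \<open>p\<close>; the choice of the chart around \<open>p\<close> is immaterial.\<close>

definition differential ::
  "('a, 'e::euclidean_space) chart set \<Rightarrow> ('b, 'f::euclidean_space) chart set \<Rightarrow> ('a \<Rightarrow> 'b) \<Rightarrow>
   'a \<Rightarrow> ('a, 'e) tvec \<Rightarrow> ('b, 'f) tvec"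
where
  "differential A B f p v =
     (let c = (SOME c. c \<in> charts_at A p)
      in (\<lambda>d. if d \<in> charts_at B (f p)
              then frechet_derivative (cmap d \<circ> f \<circ> cinv c) (at (cmap c p)) (v c) else 0))"

text \<open>The induced coordinates \<open>(x, \<xi>)\<close> on the tangent bundle, whose points are pairs of a base point
  and a tangent vector; the bundle projection is \<open>fst\<close>.\<close>

definition tangent_chart ::
  "('a, 'e::euclidean_space) chart set \<Rightarrow> ('a, 'e) chart \<Rightarrow> ('a \<times> ('a, 'e) tvec, 'e \<times> 'e) chart" where
  "tangent_chart A c = (SIGMA p:cdom c. tspace A p, \<lambda>(p, v). (cmap c p, v c))"

definition tangent_atlas ::
  "('a, 'e::euclidean_space) chart set \<Rightarrow> ('a \<times> ('a, 'e) tvec, 'e \<times> 'e) chart set" where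
  "tangent_atlas A = tangent_chart A ` max_atlas A"

subsection \<open>Riemannian metrics, Levi-Civita connection, curvature\<close>

type_synonym ('a, 'e) metric = "'a \<Rightarrow> ('a, 'e) tvec \<Rightarrow> ('a, 'e) tvec \<Rightarrow> real"

definition coord_metric ::
  "('a, 'e::euclidean_space) chart set \<Rightarrow> ('a, 'e) metric \<Rightarrow> ('a, 'e) chart \<Rightarrow> 'e \<Rightarrow> 'e \<Rightarrow> 'e \<Rightarrow> real" where
  "coord_metric A g c x u w = g (cinv c x) (tvec_at A c (cinv c x) u) (tvec_at A c (cinv c x) w)"

definition riemannian_metric ::
  "('a, 'e::euclidean_space) chart set \<Rightarrow> ('a, 'e) metric \<Rightarrow> bool" where
  "riemannian_metric A g \<longleftrightarrow>
     (\<forall>c\<in>max_atlas A.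
        (\<forall>x\<in>crange c.
           bilinear (coord_metric A g c x) \<and>
           (\<forall>u w. coord_metric A g c x u w = coord_metric A g c x w u) \<and>
           (\<forall>u. u \<noteq> 0 \<longrightarrow> coord_metric A g c x u u > 0)) \<and>
        (\<forall>u w. smooth_on (crange c) (\<lambda>x. coord_metric A g c x u w)))"

text \<open>\<open>christoffel A g c x u v\<close> is the vector with components \<open>\<Gamma>\<^sup>a\<^bsub>bc\<^esub> u\<^sup>b v\<^sup>c\<close> at the point with
  coordinates \<open>x\<close>, i.e. the solution \<open>z\<close> of
  \<open>2 g\<^bsub>ad\<^esub> z\<^sup>a = (\<partial>\<^sub>b g\<^bsub>cd\<^esub> + \<partial>\<^sub>c g\<^bsub>bd\<^esub> - \<partial>\<^sub>d g\<^bsub>bc\<^esub>) u\<^sup>b v\<^sup>c\<close>.\<close>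

definition christoffel ::
  "('a, 'e::euclidean_space) chart set \<Rightarrow> ('a, 'e) metric \<Rightarrow> ('a, 'e) chart \<Rightarrow> 'e \<Rightarrow> 'e \<Rightarrow> 'e \<Rightarrow> 'e" where
  "christoffel A g c x u v =
     (let G = coord_metric A g c;
          D = (\<lambda>u v w. frechet_derivative (\<lambda>y. G y v w) (at x) u)
      in THE z. \<forall>w. 2 * G x z w = D u v w + D v u w - D w u v)"

text \<open>\<open>R(u, v) w\<close> in coordinates, for the vector fields with constant components \<open>u\<close>, \<open>v\<close>, \<open>w\<close>.\<close>

definition curvature ::
  "('a, 'e::euclidean_space) chart set \<Rightarrow> ('a, 'e) metric \<Rightarrow> ('a, 'e) chart \<Rightarrow> 'e \<Rightarrow> 'e \<Rightarrow> 'e \<Rightarrow> 'e \<Rightarrow> 'e" where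
  "curvature A g c x u v w =
     (let \<Gamma> = christoffel A g c
      in frechet_derivative (\<lambda>y. \<Gamma> y v w) (at x) u - frechet_derivative (\<lambda>y. \<Gamma> y u w) (at x) v
         + \<Gamma> x u (\<Gamma> x v w) - \<Gamma> x v (\<Gamma> x u w))"

definition flat_metric ::
  "('a, 'e::euclidean_space) chart set \<Rightarrow> ('a, 'e) metric \<Rightarrow> bool" where
  "flat_metric A g \<longleftrightarrow>
     (\<forall>c\<in>max_atlas A. \<forall>x\<in>crange c. \<forall>u v w. curvature A g c x u v w = 0)"

subsection \<open>The Sasaki metric\<close>

text \<open>\<open>X\<close> is a tangent vector to the tangent bundle at the point \<open>q = (p, \<xi>)\<close>.\<close>

definition connection_map ::
  "('a, 'e::euclidean_space) chart set \<Rightarrow> ('a, 'e) metric \<Rightarrow>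
   'a \<times> ('a, 'e) tvec \<Rightarrow> ('a \<times> ('a, 'e) tvec, 'e \<times> 'e) tvec \<Rightarrow> ('a, 'e) tvec"
where
  "connection_map A g q X =
     (\<lambda>c. if c \<in> charts_at A (fst q)
          then snd (X (tangent_chart A c)) +
               christoffel A g c (cmap c (fst q)) (snd q c) (fst (X (tangent_chart A c)))
          else 0)"

definition sasaki_metric ::
  "('a, 'e::euclidean_space) chart set \<Rightarrow> ('a, 'e) metric \<Rightarrow>
   ('a \<times> ('a, 'e) tvec, 'e \<times> 'e) metric"
where
  "sasaki_metric A g q X Y =
     g (fst q) (differential (tangent_atlas A) A fst q X) (differential (tangent_atlas A) A fst q Y) +
     g (fst q) (connection_map A g q X) (connection_map A g q Y)"

subsection \<open>Submanifolds\<close>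

text \<open>Embedded submanifolds (without boundary) of dimension \<open>l\<close>, by slice charts.\<close>

definition submanifold :: "('a, 'e::euclidean_space) chart set \<Rightarrow> 'a set \<Rightarrow> nat \<Rightarrow> bool" where
  "submanifold A S l \<longleftrightarrow> S \<subseteq> carrier_of A \<and>
     (\<forall>p\<in>S. \<exists>c\<in>charts_at A p. \<exists>L. subspace L \<and> dim L = l \<and>
        cmap c ` (cdom c \<inter> S) = crange c \<inter> L)"

text \<open>\<open>\<gamma>\<close> is a curve in \<open>S\<close>, defined near time \<open>0\<close>, passing through \<open>p\<close> with velocity \<open>v\<close>.\<close>

definition curve_with_velocity ::
  "('a, 'e::euclidean_space) chart set \<Rightarrow> 'a set \<Rightarrow> 'a \<Rightarrow> ('a, 'e) tvec \<Rightarrow> (real \<Rightarrow> 'a) \<Rightarrow> bool" where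
  "curve_with_velocity A S p v \<gamma> \<longleftrightarrow> \<gamma> 0 = p \<and>
     (\<forall>c\<in>charts_at A p. (\<forall>\<^sub>F t in nhds 0. \<gamma> t \<in> S \<inter> cdom c) \<and>
        ((cmap c \<circ> \<gamma>) has_vector_derivative v c) (at 0))"

definition sub_tspace ::
  "('a, 'e::euclidean_space) chart set \<Rightarrow> 'a set \<Rightarrow> 'a \<Rightarrow> ('a, 'e) tvec set" where
  "sub_tspace A S p = {v \<in> tspace A p. \<exists>\<gamma>. curve_with_velocity A S p v \<gamma>}"

definition vector_field_along ::
  "('a, 'e::euclidean_space) chart set \<Rightarrow> 'a set \<Rightarrow> ('a \<Rightarrow> 'a \<times> ('a, 'e) tvec) \<Rightarrow> bool" where
  "vector_field_along A S Y \<longleftrightarrow>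
     smooth_map_on A (tangent_atlas A) S Y \<and> (\<forall>p\<in>S. fst (Y p) = p)"

definition tangent_field_along ::
  "('a, 'e::euclidean_space) chart set \<Rightarrow> 'a set \<Rightarrow> ('a \<Rightarrow> 'a \<times> ('a, 'e) tvec) \<Rightarrow> bool" where
  "tangent_field_along A S Y \<longleftrightarrow>
     vector_field_along A S Y \<and> (\<forall>p\<in>S. snd (Y p) \<in> sub_tspace A S p)"

text \<open>\<open>\<nabla>\<^sub>v Y\<close> for \<open>v\<close> tangent to \<open>S\<close> at \<open>p\<close> and \<open>Y\<close> a vector field along \<open>S\<close>, with components
  \<open>v(Y\<^sup>a) + \<Gamma>\<^sup>a\<^bsub>bc\<^esub> v\<^sup>b Y\<^sup>c\<close>. The derivative \<open>v(Y\<^sup>a)\<close> is taken along a curve in \<open>S\<close> with velocity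
  \<open>v\<close>; it does not depend on the choice of that curve.\<close>

definition cov_deriv ::
  "('a, 'e::euclidean_space) chart set \<Rightarrow> ('a, 'e) metric \<Rightarrow> 'a set \<Rightarrow>
   ('a \<Rightarrow> 'a \<times> ('a, 'e) tvec) \<Rightarrow> 'a \<Rightarrow> ('a, 'e) tvec \<Rightarrow> ('a, 'e) tvec"
where
  "cov_deriv A g S Y p v =
     (let \<gamma> = (SOME \<gamma>. curve_with_velocity A S p v \<gamma>)
      in (\<lambda>c. if c \<in> charts_at A p
              then vector_derivative (\<lambda>t. snd (Y (\<gamma> t)) c) (at 0) +
                   christoffel A g c (cmap c p) (v c) (snd (Y p) c)
              else 0))"

definition parallel_along ::
  "('a, 'e::euclidean_space) chart set \<Rightarrow> ('a, 'e) metric \<Rightarrow> 'a set \<Rightarrow> ('a \<Rightarrow> 'a \<times> ('a, 'e) tvec) \<Rightarrow> bool" where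
  "parallel_along A g S Y \<longleftrightarrow> (\<forall>p\<in>S. \<forall>v\<in>sub_tspace A S p. cov_deriv A g S Y p v = (\<lambda>c. 0))"

definition normal_part ::
  "('a, 'e::euclidean_space) chart set \<Rightarrow> ('a, 'e) metric \<Rightarrow> 'a set \<Rightarrow> 'a \<Rightarrow> ('a, 'e) tvec \<Rightarrow> ('a, 'e) tvec"
where
  "normal_part A g S p w =
     (THE z. z \<in> tspace A p \<and> (\<forall>u\<in>sub_tspace A S p. g p z u = 0) \<and>
             (\<lambda>c. w c - z c) \<in> sub_tspace A S p)"

definition second_fundamental_form ::
  "('a, 'e::euclidean_space) chart set \<Rightarrow> ('a, 'e) metric \<Rightarrow> 'a set \<Rightarrow> 'a \<Rightarrow>
   ('a, 'e) tvec \<Rightarrow> ('a \<Rightarrow> 'a \<times> ('a, 'e) tvec) \<Rightarrow> ('a, 'e) tvec"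
where
  "second_fundamental_form A g S p v Y = normal_part A g S p (cov_deriv A g S Y p v)"

text \<open>An \<open>l\<close>-dimensional submanifold is totally geodesic if its second fundamental form vanishes on
  all tangent vectors \<open>v\<close> and all locally defined tangent vector fields \<open>Y\<close>.\<close>

definition totally_geodesic ::
  "('a, 'e::euclidean_space) chart set \<Rightarrow> ('a, 'e) metric \<Rightarrow> 'a set \<Rightarrow> nat \<Rightarrow> bool" where
  "totally_geodesic A g S l \<longleftrightarrow> submanifold A S l \<and>
     (\<forall>W Y. openin (mtopology A) W \<and> tangent_field_along A (S \<inter> W) Y \<longrightarrow>
        (\<forall>p\<in>S \<inter> W. \<forall>v\<in>sub_tspace A (S \<inter> W) p.
           second_fundamental_form A g (S \<inter> W) p v Y = (\<lambda>c. 0)))"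

subsection \<open>Orientations of submanifolds\<close>

text \<open>Ordered bases of tangent spaces are lists of tangent vectors, so that the dimension may vary;
  the library's determinant has the dimension as a type, hence the Leibniz formula below.\<close>

definition lincomb :: "(nat \<Rightarrow> real) \<Rightarrow> ('a, 'e::euclidean_space) tvec list \<Rightarrow> ('a, 'e) tvec" where
  "lincomb a bs = (\<lambda>c. \<Sum>i<length bs. a i *\<^sub>R (bs ! i) c)"

definition frame_at ::
  "('a, 'e::euclidean_space) chart set \<Rightarrow> 'a set \<Rightarrow> 'a \<Rightarrow> ('a, 'e) tvec list \<Rightarrow> bool" where
  "frame_at A S p bs \<longleftrightarrow> set bs \<subseteq> sub_tspace A S p \<and>
     (\<forall>v\<in>sub_tspace A S p. \<exists>a. v = lincomb a bs) \<and>
     (\<forall>a. lincomb a bs = (\<lambda>c. 0) \<longrightarrow> (\<forall>i<length bs. a i = 0))"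

definition leibniz_det :: "nat \<Rightarrow> (nat \<Rightarrow> nat \<Rightarrow> real) \<Rightarrow> real" where
  "leibniz_det l a = (\<Sum>\<sigma> | \<sigma> permutes {..<l}. of_int (sign \<sigma>) * (\<Prod>j<l. a (\<sigma> j) j))"

definition same_orientation ::
  "('a, 'e::euclidean_space) tvec list \<Rightarrow> ('a, 'e) tvec list \<Rightarrow> bool" where
  "same_orientation bs bs' \<longleftrightarrow> length bs = length bs' \<and>
     (\<exists>a. (\<forall>j<length bs. bs' ! j = lincomb (\<lambda>i. a i j) bs) \<and> leibniz_det (length bs) a > 0)"

text \<open>\<open>Or p\<close> is the set of positively oriented frames of the tangent space of \<open>S\<close> at \<open>p\<close>. It is an
  equivalence class of frames depending continuously on \<open>p\<close>: near each point there is a smooth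
  local frame consisting of positively oriented frames.\<close>

definition orientation ::
  "('a, 'e::euclidean_space) chart set \<Rightarrow> 'a set \<Rightarrow> ('a \<Rightarrow> ('a, 'e) tvec list set) \<Rightarrow> bool" where
  "orientation A S Or \<longleftrightarrow>
     (\<forall>p\<in>S. \<exists>bs. frame_at A S p bs \<and> Or p = {bs'. frame_at A S p bs' \<and> same_orientation bs bs'}) \<and>
     (\<forall>p\<in>S. \<exists>W Ys. openin (mtopology A) W \<and> p \<in> W \<and>
        (\<forall>Y\<in>set Ys. vector_field_along A (S \<inter> W) Y) \<and>
        (\<forall>q\<in>S \<inter> W. map (\<lambda>Y. snd (Y q)) Ys \<in> Or q))"

end

theory Submission
  imports Defs
begin

text \<open>
  Totally geodesic submanifolds are those whose slice charts, with slice \<open>L\<close>, have Christoffel symbols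
  mapping \<open>L \<times> L\<close> into \<open>L\<close> along \<open>L\<close>. For a flat metric the Sasaki connection differentiates horizontal and
  vertical parts separately. In a slice chart of \<open>F\<close> in which \<open>\<xi>\<close> has components \<open>\<eta>\<close>, subtracting \<open>\<eta>\<close> from the
  fibre coordinate gives a slice chart of \<open>\<xi>(F)\<close>, and its Christoffel symbols show that \<open>\<xi>(F)\<close> is totally
  geodesic iff \<open>F\<close> is and the second covariant derivative of \<open>\<xi>\<close> along \<open>F\<close> vanishes. If \<open>\<xi>\<close> is parallel this is
  clear. Conversely, \<open>\<nabla>\<xi>\<close> is then a solution of a linear first-order system, so the set \<open>Z\<close> where \<open>\<nabla>\<xi> \<noteq> 0\<close> is open
  and closed in \<open>F\<close>, hence compact. The Hessian of \<open>|\<xi>|\<^sup>2\<close> is \<open>2 |\<nabla>\<xi>|\<^sup>2\<close>, so \<open>\<nabla>\<xi> = 0\<close> where \<open>|\<xi>|\<^sup>2\<close> attains its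
  maximum over \<open>Z\<close>; therefore \<open>Z\<close> is empty.
\<close>

subsection \<open>Calculus of smooth maps\<close>

text \<open>Maximising |\<xi>|^2 over all of F would give \<nabla>\<xi> = 0 at one point, hence only
  on the component of that point, and F need not be connected. This is why the maximum is taken over
  \<open>Z\<close>: as \<open>Z\<close> is open in F, a maximum over \<open>Z\<close> is a local
  maximum on F, the second derivative test applies there, and its conclusion contradicts membership
  in \<open>Z\<close>. Flatness enters through the uniqueness of the Levi-Civita connection. The
  connection that differentiates horizontal and vertical parts separately is compatible with the
  Sasaki metric in any case, but its torsion is given by the curvature of g; it is the Levi-Civita
  connection once the curvature vanishes. Fields with constant components in a slice chart turn the
  second fundamental form into a pointwise condition on Christoffel symbols. All tensorial
  statements are therefore obtained from one transformation law of these symbols, used between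
  charts of M, between charts of TM, and between an induced chart and the sheared chart in which the
  image of \<xi> is flat.\<close>

lemma frechet_eqI: "(f has_derivative f') (at x) \<Longrightarrow> frechet_derivative f (at x) v = f' v"
  by (metis frechet_derivative_at)

lemma Ck_on_cong:
  assumes "open S" "\<And>x. x \<in> S \<Longrightarrow> f x = g x" "Ck_on k S f"
  shows "Ck_on k S g"
  using assms
proof (induction k arbitrary: f g)
  case 0
  then show ?case by (simp cong: continuous_on_cong)
next
  case (Suc k)
  have d: "f differentiable (at x)" if "x \<in> S" for x using Suc.prems that by simp
  have e: "frechet_derivative f (at x) = frechet_derivative g (at x)" if "x \<in> S" for x
    using frechet_derivative_transform_within_open[OF d[OF that] Suc.prems(1) that Suc.prems(2)] .
  have "g differentiable (at x)" if "x \<in> S" for x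
    using d[OF that] has_derivative_transform_within_open[OF _ Suc.prems(1) that, of f _ UNIV g] Suc.prems(2)
    unfolding differentiable_def by blast
  moreover have "Ck_on k S (\<lambda>x. frechet_derivative g (at x) v)" for v
    by (rule Suc.IH[of "\<lambda>x. frechet_derivative f (at x) v"]) (use Suc.prems e in auto)
  ultimately show ?case by simp
qed

lemma Ck_on_subset: "T \<subseteq> S \<Longrightarrow> Ck_on k S f \<Longrightarrow> Ck_on k T f"
  by (induction k arbitrary: f) (auto intro: continuous_on_subset)

lemma Ck_on_Suc_imp: "Ck_on (Suc k) S f \<Longrightarrow> Ck_on k S f"
proof (induction k arbitrary: f)
  case 0
  then show ?case
    by (auto intro!: continuous_at_imp_continuous_on differentiable_imp_continuous_within)
next
  case (Suc k)
  then show ?case by auto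
qed

lemma Ck_on_local:
  assumes "\<And>x. x \<in> S \<Longrightarrow> \<exists>T. open T \<and> x \<in> T \<and> Ck_on k T f"
  shows "Ck_on k S f"
  using assms
proof (induction k arbitrary: f)
  case 0
  have "isCont f x" if "x \<in> S" for x
    using 0[OF that] continuous_on_eq_continuous_at by auto
  then show ?case by (simp add: continuous_at_imp_continuous_on)
next
  case (Suc k)
  have "f differentiable (at x)" if "x \<in> S" for x
    using Suc.prems[OF that] by auto
  moreover have "Ck_on k S (\<lambda>x. frechet_derivative f (at x) v)" for v
    by (rule Suc.IH) (use Suc.prems in fastforce)
  ultimately show ?case by simp
qed

lemma Ck_on_const: "Ck_on k S (\<lambda>x. c)"
  by (induction k arbitrary: c) auto

lemma Ck_on_id: "Ck_on k S (\<lambda>x. x)"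
  by (cases k) (auto simp: frechet_derivative_ident Ck_on_const)

lemma Ck_on_linear_compose:
  assumes "bounded_linear L" "open S" "Ck_on k S f"
  shows "Ck_on k S (\<lambda>x. L (f x))"
  using assms(3)
proof (induction k arbitrary: f)
  case 0
  then show ?case using bounded_linear.continuous_on[OF assms(1)] by auto
next
  case (Suc k)
  have d: "((\<lambda>x. L (f x)) has_derivative (\<lambda>v. L (frechet_derivative f (at x) v))) (at x)" if "x \<in> S" for x
    using Suc.prems that by (auto intro!: bounded_linear.has_derivative[OF assms(1)] simp: frechet_derivative_works)
  have "Ck_on k S (\<lambda>x. frechet_derivative (\<lambda>x. L (f x)) (at x) v)" for v
    by (rule Ck_on_cong[OF assms(2) _ Suc.IH[of "\<lambda>x. frechet_derivative f (at x) v"]])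
      (use Suc.prems in \<open>auto simp: frechet_eqI[OF d]\<close>)
  with d show ?case by (auto intro: differentiableI)
qed

lemma Ck_on_add:
  assumes "open S" "Ck_on k S f" "Ck_on k S g"
  shows "Ck_on k S (\<lambda>x. f x + g x)"
  using assms(2,3)
proof (induction k arbitrary: f g)
  case 0
  then show ?case by (auto intro: continuous_on_add)
next
  case (Suc k)
  have d: "((\<lambda>x. f x + g x) has_derivative (\<lambda>v. frechet_derivative f (at x) v + frechet_derivative g (at x) v)) (at x)"
    if "x \<in> S" for x
    using Suc.prems that by (auto intro!: has_derivative_add simp: frechet_derivative_works)
  have "Ck_on k S (\<lambda>x. frechet_derivative (\<lambda>x. f x + g x) (at x) v)" for v
    by (rule Ck_on_cong[OF assms(1) _ Suc.IH[of "\<lambda>x. frechet_derivative f (at x) v" "\<lambda>x. frechet_derivative g (at x) v"]])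
      (use Suc.prems in \<open>auto simp: frechet_eqI[OF d]\<close>)
  with d show ?case by (auto intro: differentiableI)
qed

lemma Ck_on_sum:
  assumes "open S" "finite I" "\<And>i. i \<in> I \<Longrightarrow> Ck_on k S (f i)"
  shows "Ck_on k S (\<lambda>x. \<Sum>i\<in>I. f i x)"
  using assms(2,3) by (induction rule: finite_induct) (auto intro: Ck_on_const Ck_on_add[OF assms(1)])

lemma Ck_on_bilinear:
  assumes "bounded_bilinear B" "open S" "Ck_on k S f" "Ck_on k S g"
  shows "Ck_on k S (\<lambda>x. B (f x) (g x))"
  using assms(3,4)
proof (induction k arbitrary: f g)
  case 0
  then show ?case using bounded_bilinear.continuous_on[OF assms(1)] by auto
next
  case (Suc k)
  have d: "((\<lambda>x. B (f x) (g x)) has_derivative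
      (\<lambda>v. B (f x) (frechet_derivative g (at x) v) + B (frechet_derivative f (at x) v) (g x))) (at x)"
    if "x \<in> S" for x
    using Suc.prems that by (auto intro!: bounded_bilinear.FDERIV[OF assms(1)] simp: frechet_derivative_works)
  have s: "Ck_on k S f" "Ck_on k S g" using Suc.prems Ck_on_Suc_imp by blast+
  have "Ck_on k S (\<lambda>x. frechet_derivative (\<lambda>x. B (f x) (g x)) (at x) v)" for v
    by (rule Ck_on_cong[OF assms(2) _ Ck_on_add[OF assms(2) Suc.IH[of f "\<lambda>x. frechet_derivative g (at x) v"]
             Suc.IH[of "\<lambda>x. frechet_derivative f (at x) v" g]]])
      (use Suc.prems s in \<open>auto simp: frechet_eqI[OF d]\<close>)
  with d show ?case by (auto intro: differentiableI)
qed

text \<open>\<open>Ck_on\<close> only speaks of derivatives in a fixed direction. When the direction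
  itself varies, as in the chain rule, this expansion leaves finitely many fixed directions with
  variable scalar coefficients.\<close>

lemma frechet_derivative_basis_sum:
  fixes f :: "'a::euclidean_space \<Rightarrow> 'b::real_normed_vector"
  assumes "f differentiable (at x)"
  shows "frechet_derivative f (at x) v = (\<Sum>b\<in>Basis. (v \<bullet> b) *\<^sub>R frechet_derivative f (at x) b)"
proof -
  interpret linear "frechet_derivative f (at x)" using assms by (rule linear_frechet_derivative)
  have "frechet_derivative f (at x) (\<Sum>b\<in>Basis. (v \<bullet> b) *\<^sub>R b) = (\<Sum>b\<in>Basis. (v \<bullet> b) *\<^sub>R frechet_derivative f (at x) b)"
    by (simp add: sum scaleR)
  then show ?thesis by (simp only: euclidean_representation)
qed

text \<open>Induction on \<open>k\<close> with \<open>f\<close> replaced by its directional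
  derivatives: once the outer derivative is expanded over \<open>Basis\<close>, each summand is a
  component of the derivative of \<open>g\<close> times a derivative of \<open>f\<close> composed
  with \<open>g\<close>, and both factors are covered at order \<open>k\<close>.\<close>

lemma Ck_on_compose:
  fixes g :: "'a::euclidean_space \<Rightarrow> 'b::euclidean_space" and f :: "'b \<Rightarrow> 'c::real_normed_vector"
  assumes "open S" "open T" "g ` S \<subseteq> T" "Ck_on k T f" "Ck_on k S g"
  shows "Ck_on k S (\<lambda>x. f (g x))"
  using assms(4,5)
proof (induction k arbitrary: f)
  case 0
  then show ?case using continuous_on_compose2 assms(3) by auto
next
  case (Suc k)
  have dg: "(g has_derivative frechet_derivative g (at x)) (at x)" if "x \<in> S" for x
    using Suc.prems that by (auto simp: frechet_derivative_works)
  have df: "(f has_derivative frechet_derivative f (at (g x))) (at (g x))" if "x \<in> S" for x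
    using Suc.prems that assms(3) by (auto simp: frechet_derivative_works)
  have d: "((\<lambda>x. f (g x)) has_derivative (\<lambda>v. frechet_derivative f (at (g x)) (frechet_derivative g (at x) v))) (at x)"
    if "x \<in> S" for x
    using has_derivative_compose[OF dg[OF that] df[OF that]] by simp
  have s: "Ck_on k S g" using Suc.prems Ck_on_Suc_imp by blast
  have "Ck_on k S (\<lambda>x. \<Sum>b\<in>Basis. (frechet_derivative g (at x) v \<bullet> b) *\<^sub>R frechet_derivative f (at (g x)) b)" for v
    by (intro Ck_on_sum Ck_on_bilinear[OF bounded_bilinear_scaleR] assms(1) finite_Basis
          Ck_on_linear_compose[OF bounded_linear_inner_left] Suc.IH[of "\<lambda>y. frechet_derivative f (at y) _"])
      (use Suc.prems s in auto)
  moreover have "frechet_derivative (\<lambda>x. f (g x)) (at x) v =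
      (\<Sum>b\<in>Basis. (frechet_derivative g (at x) v \<bullet> b) *\<^sub>R frechet_derivative f (at (g x)) b)" if "x \<in> S" for x v
    using frechet_derivative_basis_sum[of f "g x" "frechet_derivative g (at x) v"] df[OF that]
    by (simp add: frechet_eqI[OF d[OF that]] differentiableI)
  ultimately have "Ck_on k S (\<lambda>x. frechet_derivative (\<lambda>x. f (g x)) (at x) v)" for v
    using Ck_on_cong[OF assms(1)] by (metis (no_types, lifting))
  with d show ?case by (auto intro: differentiableI)
qed

section \<open>Rules for smooth maps, inherited from every finite order\<close>

lemma smooth_on_cong: "open S \<Longrightarrow> (\<And>x. x \<in> S \<Longrightarrow> f x = g x) \<Longrightarrow> smooth_on S f \<Longrightarrow> smooth_on S g"
  unfolding smooth_on_def using Ck_on_cong by blast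

lemma smooth_on_subset: "T \<subseteq> S \<Longrightarrow> smooth_on S f \<Longrightarrow> smooth_on T f"
  unfolding smooth_on_def using Ck_on_subset by blast

lemma smooth_on_local:
  "(\<And>x. x \<in> S \<Longrightarrow> \<exists>T. open T \<and> x \<in> T \<and> smooth_on T f) \<Longrightarrow> smooth_on S f"
  unfolding smooth_on_def by (meson Ck_on_local)

lemma smooth_on_const: "smooth_on S (\<lambda>x. c)"
  by (simp add: smooth_on_def Ck_on_const)

lemma smooth_on_id: "smooth_on S (\<lambda>x. x)"
  by (simp add: smooth_on_def Ck_on_id)

lemma smooth_on_linear_compose:
  "bounded_linear L \<Longrightarrow> open S \<Longrightarrow> smooth_on S f \<Longrightarrow> smooth_on S (\<lambda>x. L (f x))"
  by (simp add: smooth_on_def Ck_on_linear_compose)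

lemma smooth_on_add: "open S \<Longrightarrow> smooth_on S f \<Longrightarrow> smooth_on S g \<Longrightarrow> smooth_on S (\<lambda>x. f x + g x)"
  by (simp add: smooth_on_def Ck_on_add)

lemma smooth_on_diff:
  assumes "open S" "smooth_on S f" "smooth_on S g" shows "smooth_on S (\<lambda>x. f x - g x)"
  using smooth_on_add[OF assms(1,2) smooth_on_linear_compose[OF bounded_linear_minus[OF bounded_linear_ident] assms(1,3)]]
  by simp

lemma smooth_on_sum:
  "open S \<Longrightarrow> finite I \<Longrightarrow> (\<And>i. i \<in> I \<Longrightarrow> smooth_on S (f i)) \<Longrightarrow> smooth_on S (\<lambda>x. \<Sum>i\<in>I. f i x)"
  by (simp add: smooth_on_def Ck_on_sum)

lemma smooth_on_bilinear:
  "bounded_bilinear B \<Longrightarrow> open S \<Longrightarrow> smooth_on S f \<Longrightarrow> smooth_on S g \<Longrightarrow> smooth_on S (\<lambda>x. B (f x) (g x))"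
  by (simp add: smooth_on_def Ck_on_bilinear)

lemma smooth_on_Pair:
  fixes f :: "'a::euclidean_space \<Rightarrow> 'b::real_normed_vector" and g :: "'a \<Rightarrow> 'c::real_normed_vector"
  assumes "open S" "smooth_on S f" "smooth_on S g" shows "smooth_on S (\<lambda>x. (f x, g x))"
proof -
  have "bounded_linear (\<lambda>x::'b. (x, 0::'c))" "bounded_linear (\<lambda>x::'c. (0::'b, x))"
    by (auto intro!: bounded_linear_Pair bounded_linear_ident bounded_linear_zero)
  from smooth_on_add[OF assms(1) smooth_on_linear_compose[OF this(1) assms(1,2)]
      smooth_on_linear_compose[OF this(2) assms(1,3)]]
  show ?thesis by simp
qed

lemma smooth_on_compose:
  fixes g :: "'a::euclidean_space \<Rightarrow> 'b::euclidean_space" and f :: "'b \<Rightarrow> 'c::real_normed_vector"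
  assumes "open S" "open T" "g ` S \<subseteq> T" "smooth_on T f" "smooth_on S g"
  shows "smooth_on S (\<lambda>x. f (g x))"
  using assms Ck_on_compose unfolding smooth_on_def by blast

lemma smooth_on_fst: "smooth_on S fst" and smooth_on_snd: "smooth_on S snd"
  using smooth_on_linear_compose[OF bounded_linear_fst open_UNIV smooth_on_id]
    smooth_on_linear_compose[OF bounded_linear_snd open_UNIV smooth_on_id]
    smooth_on_subset[OF subset_UNIV] by auto

lemma smooth_on_frechet: "smooth_on S f \<Longrightarrow> smooth_on S (\<lambda>x. frechet_derivative f (at x) v)"
  unfolding smooth_on_def using Ck_on.simps(2) by blast

lemma smooth_on_differentiable: "smooth_on S f \<Longrightarrow> x \<in> S \<Longrightarrow> f differentiable (at x)"
  unfolding smooth_on_def using Ck_on.simps(2) by blast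

lemma smooth_on_has_derivative:
  "smooth_on S f \<Longrightarrow> x \<in> S \<Longrightarrow> (f has_derivative frechet_derivative f (at x)) (at x)"
  using smooth_on_differentiable frechet_derivative_works by blast

lemma smooth_on_continuous_on: "smooth_on S f \<Longrightarrow> continuous_on S f"
  unfolding smooth_on_def using Ck_on.simps(1) by blast

lemma smooth_on_frechet_apply:
  fixes f :: "'a::euclidean_space \<Rightarrow> 'b::real_normed_vector"
    and g :: "'c::euclidean_space \<Rightarrow> 'a"
  assumes "open S" "open T" "smooth_on S f" "smooth_on T g" "g ` T \<subseteq> S" "smooth_on T h"
  shows "smooth_on T (\<lambda>x. frechet_derivative f (at (g x)) (h x))"
proof (rule smooth_on_cong)
  show "smooth_on T (\<lambda>x. \<Sum>b\<in>Basis. (h x \<bullet> b) *\<^sub>R frechet_derivative f (at (g x)) b)"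
    by (intro smooth_on_sum smooth_on_bilinear[OF bounded_bilinear_scaleR] finite_Basis assms
          smooth_on_linear_compose[OF bounded_linear_inner_left]
          smooth_on_compose[OF assms(2,1,5)] smooth_on_frechet)
  show "(\<Sum>b\<in>Basis. (h x \<bullet> b) *\<^sub>R frechet_derivative f (at (g x)) b) = frechet_derivative f (at (g x)) (h x)"
    if "x \<in> T" for x
    using frechet_derivative_basis_sum[OF smooth_on_differentiable[OF assms(3)], of "g x" "h x"] assms(5) that by auto
qed (use assms in auto)

subsection \<open>Second derivatives and families of bilinear maps\<close>

text \<open>The mean value theorem is used twice: along \<open>u\<close> for the increment of
  \<open>f\<close> in direction \<open>v\<close>, then along \<open>v\<close> for the derivative of
  \<open>f\<close> in direction \<open>u\<close>.\<close>

lemma second_difference_mvt: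
  fixes f :: "'a::real_normed_vector \<Rightarrow> real"
  assumes "h > 0"
    and D: "\<And>s t. 0 \<le> s \<Longrightarrow> s \<le> h \<Longrightarrow> 0 \<le> t \<Longrightarrow> t \<le> h \<Longrightarrow> (f has_derivative f' (x + s *\<^sub>R u + t *\<^sub>R v)) (at (x + s *\<^sub>R u + t *\<^sub>R v))"
    and D2: "\<And>s t. 0 \<le> s \<Longrightarrow> s \<le> h \<Longrightarrow> 0 \<le> t \<Longrightarrow> t \<le> h \<Longrightarrow> ((\<lambda>y. f' y u) has_derivative f'' (x + s *\<^sub>R u + t *\<^sub>R v)) (at (x + s *\<^sub>R u + t *\<^sub>R v))"
  shows "\<exists>s t. 0 < s \<and> s < h \<and> 0 < t \<and> t < h \<and>
    f (x + h *\<^sub>R u + h *\<^sub>R v) - f (x + h *\<^sub>R u) - f (x + h *\<^sub>R v) + f x = h * h * f'' (x + s *\<^sub>R u + t *\<^sub>R v) v"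
proof -
  \<comment> \<open>The increment of \<open>f\<close> in direction \<open>v\<close>. The term
    \<open>0 *\<^sub>R v\<close> is kept so that both summands are instances of the next fact, with
    \<open>t\<close> equal to \<open>h\<close> and to 0.\<close>
  define a where "a s = f (x + s *\<^sub>R u + h *\<^sub>R v) - f (x + s *\<^sub>R u + 0 *\<^sub>R v)" for s
  have 1: "((\<lambda>s. f (x + s *\<^sub>R u + t *\<^sub>R v)) has_real_derivative f' (x + s *\<^sub>R u + t *\<^sub>R v) u) (at s)"
    if "0 \<le> s" "s \<le> h" "0 \<le> t" "t \<le> h" for s t
  proof -
    have "((\<lambda>s. x + s *\<^sub>R u + t *\<^sub>R v) has_derivative (\<lambda>r. r *\<^sub>R u)) (at s)"
      by (auto intro!: derivative_eq_intros)
    from has_derivative_compose[OF this D[OF that]]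
    have "((\<lambda>s. f (x + s *\<^sub>R u + t *\<^sub>R v)) has_derivative (\<lambda>r. f' (x + s *\<^sub>R u + t *\<^sub>R v) (r *\<^sub>R u))) (at s)" .
    moreover have "f' (x + s *\<^sub>R u + t *\<^sub>R v) (r *\<^sub>R u) = f' (x + s *\<^sub>R u + t *\<^sub>R v) u * r" for r
      using linear_scale[OF has_derivative_linear[OF D[OF that]], of r u] by simp
    ultimately show ?thesis unfolding has_field_derivative_def by (simp add: fun_eq_iff[symmetric])
  qed
  have "\<exists>s>0. s < h \<and> a h - a 0 = (h - 0) * (f' (x + s *\<^sub>R u + h *\<^sub>R v) u - f' (x + s *\<^sub>R u + 0 *\<^sub>R v) u)"
    unfolding a_def using \<open>h > 0\<close> by (intro MVT2 DERIV_diff 1) auto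
  then obtain s where s: "0 < s" "s < h" "a h - a 0 = h * (f' (x + s *\<^sub>R u + h *\<^sub>R v) u - f' (x + s *\<^sub>R u + 0 *\<^sub>R v) u)"
    by auto
  have 2: "((\<lambda>t. f' (x + s *\<^sub>R u + t *\<^sub>R v) u) has_real_derivative f'' (x + s *\<^sub>R u + t *\<^sub>R v) v) (at t)"
    if "0 \<le> t" "t \<le> h" for t
  proof -
    have s': "0 \<le> s" "s \<le> h" using s by auto
    have "((\<lambda>t. x + s *\<^sub>R u + t *\<^sub>R v) has_derivative (\<lambda>r. r *\<^sub>R v)) (at t)"
      by (auto intro!: derivative_eq_intros)
    from has_derivative_compose[OF this D2[OF s' that]]
    have "((\<lambda>t. f' (x + s *\<^sub>R u + t *\<^sub>R v) u) has_derivative (\<lambda>r. f'' (x + s *\<^sub>R u + t *\<^sub>R v) (r *\<^sub>R v))) (at t)" .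
    moreover have "f'' (x + s *\<^sub>R u + t *\<^sub>R v) (r *\<^sub>R v) = f'' (x + s *\<^sub>R u + t *\<^sub>R v) v * r" for r
      using linear_scale[OF has_derivative_linear[OF D2[OF s' that]], of r v] by simp
    ultimately show ?thesis unfolding has_field_derivative_def by (simp add: fun_eq_iff[symmetric])
  qed
  have "\<exists>t>0. t < h \<and> f' (x + s *\<^sub>R u + h *\<^sub>R v) u - f' (x + s *\<^sub>R u + 0 *\<^sub>R v) u = (h - 0) * f'' (x + s *\<^sub>R u + t *\<^sub>R v) v"
    using \<open>h > 0\<close> by (intro MVT2 2) auto
  then obtain t where t: "0 < t" "t < h" "f' (x + s *\<^sub>R u + h *\<^sub>R v) u - f' (x + s *\<^sub>R u + 0 *\<^sub>R v) u = h * f'' (x + s *\<^sub>R u + t *\<^sub>R v) v"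
    by auto
  have "f (x + h *\<^sub>R u + h *\<^sub>R v) - f (x + h *\<^sub>R u) - f (x + h *\<^sub>R v) + f x = a h - a 0"
    by (simp add: a_def)
  with s t show ?thesis by (metis mult.assoc)
qed

text \<open>The second difference over the parallelogram with sides \<open>h u\<close> and
  \<open>h v\<close> is symmetric in \<open>u\<close> and \<open>v\<close>. It equals
  \<open>h * h\<close> times either mixed derivative at some point of the parallelogram, and by
  continuity these values are within \<open>e\<close>, half the supposed gap, of those at
  \<open>x\<close>.\<close>

lemma second_derivative_symmetric_real:
  fixes f :: "'a::euclidean_space \<Rightarrow> real"
  assumes "open S" "smooth_on S f" "x \<in> S"
  shows "frechet_derivative (\<lambda>y. frechet_derivative f (at y) u) (at x) v =
    frechet_derivative (\<lambda>y. frechet_derivative f (at y) v) (at x) u" (is "?a u v x = ?a v u x")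
proof (rule ccontr)
  assume "?a u v x \<noteq> ?a v u x"
  define e where "e = \<bar>?a u v x - ?a v u x\<bar> / 2"
  have e: "e > 0" using \<open>?a u v x \<noteq> ?a v u x\<close> by (simp add: e_def)
  have sm: "smooth_on S (\<lambda>y. ?a u v y)" for u v using assms by (intro smooth_on_frechet)
  have c: "\<exists>d>0. \<forall>y. dist y x < d \<longrightarrow> y \<in> S \<and> \<bar>?a u v y - ?a u v x\<bar> < e" for u v
  proof -
    have "isCont (\<lambda>y. ?a u v y) x"
      using smooth_on_continuous_on[OF sm] assms continuous_on_eq_continuous_at by blast
    then have "\<forall>\<^sub>F y in nhds x. dist (?a u v y) (?a u v x) < e"
      using e by (simp add: continuous_at_eps_delta eventually_nhds_metric)
    moreover have "\<forall>\<^sub>F y in nhds x. y \<in> S" using assms by (simp add: eventually_nhds_in_open)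
    ultimately have "\<forall>\<^sub>F y in nhds x. y \<in> S \<and> \<bar>?a u v y - ?a u v x\<bar> < e"
      by eventually_elim (simp add: dist_real_def)
    then show ?thesis unfolding eventually_nhds_metric by blast
  qed
  obtain d1 d2 where d: "d1 > 0" "\<And>y. dist y x < d1 \<Longrightarrow> y \<in> S \<and> \<bar>?a u v y - ?a u v x\<bar> < e"
    "d2 > 0" "\<And>y. dist y x < d2 \<Longrightarrow> y \<in> S \<and> \<bar>?a v u y - ?a v u x\<bar> < e"
    using c[of u v] c[of v u] by blast
  \<comment> \<open>Small enough for the whole parallelogram to lie in both neighbourhoods; the
    summand 1 keeps the denominator positive if \<open>u\<close> and \<open>v\<close> are 0.\<close>
  define h where "h = min d1 d2 / (norm u + norm v + 1) / 2"
  have h: "h > 0" using d by (simp add: h_def add_nonneg_pos)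
  have hd: "h * (norm u + norm v + 1) < min d1 d2"
  proof -
    have "norm u + norm v + 1 > 0" by (simp add: add_nonneg_pos)
    then have "h * (norm u + norm v + 1) = min d1 d2 / 2" unfolding h_def by (auto simp: divide_simps)
    with d show ?thesis by linarith
  qed
  have near: "dist (x + s *\<^sub>R u + t *\<^sub>R v) x < min d1 d2" "dist (x + t *\<^sub>R v + s *\<^sub>R u) x < min d1 d2"
    if "0 \<le> s" "s \<le> h" "0 \<le> t" "t \<le> h" for s t
  proof -
    have "norm (s *\<^sub>R u + t *\<^sub>R v) \<le> h * norm u + h * norm v"
      by (rule order.trans[OF norm_triangle_ineq]) (use that in \<open>auto intro!: add_mono mult_right_mono\<close>)
    also have "\<dots> \<le> h * (norm u + norm v + 1)" using h by (simp add: algebra_simps)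
    finally show "dist (x + s *\<^sub>R u + t *\<^sub>R v) x < min d1 d2" "dist (x + t *\<^sub>R v + s *\<^sub>R u) x < min d1 d2"
      using hd by (auto simp: dist_norm algebra_simps)
  qed
  have D: "(f has_derivative frechet_derivative f (at y)) (at y)" if "y \<in> S" for y
    using smooth_on_has_derivative assms that by blast
  have D2: "((\<lambda>y. frechet_derivative f (at y) u) has_derivative (\<lambda>v. ?a u v y)) (at y)" if "y \<in> S" for y u
    using smooth_on_has_derivative[OF smooth_on_frechet] assms that by blast
  have "\<exists>s t. 0 < s \<and> s < h \<and> 0 < t \<and> t < h \<and>
      f (x + h *\<^sub>R u + h *\<^sub>R v) - f (x + h *\<^sub>R u) - f (x + h *\<^sub>R v) + f x = h * h * ?a u v (x + s *\<^sub>R u + t *\<^sub>R v)"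
  proof (rule second_difference_mvt[OF h, where f' = "\<lambda>y. frechet_derivative f (at y)" and f'' = "\<lambda>y v. ?a u v y"])
    fix s t assume "0 \<le> s" "s \<le> h" "0 \<le> t" "t \<le> h"
    then have "x + s *\<^sub>R u + t *\<^sub>R v \<in> S" using near(1) d(2) by simp
    then show "(f has_derivative frechet_derivative f (at (x + s *\<^sub>R u + t *\<^sub>R v))) (at (x + s *\<^sub>R u + t *\<^sub>R v))"
      "((\<lambda>y. frechet_derivative f (at y) u) has_derivative (\<lambda>v'. ?a u v' (x + s *\<^sub>R u + t *\<^sub>R v))) (at (x + s *\<^sub>R u + t *\<^sub>R v))"
      using D D2 by blast+
  qed
  then obtain s t where st: "0 < s" "s < h" "0 < t" "t < h"
    "f (x + h *\<^sub>R u + h *\<^sub>R v) - f (x + h *\<^sub>R u) - f (x + h *\<^sub>R v) + f x = h * h * ?a u v (x + s *\<^sub>R u + t *\<^sub>R v)"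
    by blast
  have "\<exists>s t. 0 < s \<and> s < h \<and> 0 < t \<and> t < h \<and>
      f (x + h *\<^sub>R v + h *\<^sub>R u) - f (x + h *\<^sub>R v) - f (x + h *\<^sub>R u) + f x = h * h * ?a v u (x + s *\<^sub>R v + t *\<^sub>R u)"
  proof (rule second_difference_mvt[OF h, where f' = "\<lambda>y. frechet_derivative f (at y)" and f'' = "\<lambda>y u. ?a v u y"])
    fix s t assume "0 \<le> s" "s \<le> h" "0 \<le> t" "t \<le> h"
    then have "x + s *\<^sub>R v + t *\<^sub>R u \<in> S" using near(2) d(2) by simp
    then show "(f has_derivative frechet_derivative f (at (x + s *\<^sub>R v + t *\<^sub>R u))) (at (x + s *\<^sub>R v + t *\<^sub>R u))"
      "((\<lambda>y. frechet_derivative f (at y) v) has_derivative (\<lambda>u'. ?a v u' (x + s *\<^sub>R v + t *\<^sub>R u))) (at (x + s *\<^sub>R v + t *\<^sub>R u))"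
      using D D2 by blast+
  qed
  then obtain s' t' where st': "0 < s'" "s' < h" "0 < t'" "t' < h"
    "f (x + h *\<^sub>R v + h *\<^sub>R u) - f (x + h *\<^sub>R v) - f (x + h *\<^sub>R u) + f x = h * h * ?a v u (x + s' *\<^sub>R v + t' *\<^sub>R u)"
    by blast
  have "h * h * ?a u v (x + s *\<^sub>R u + t *\<^sub>R v) = h * h * ?a v u (x + s' *\<^sub>R v + t' *\<^sub>R u)"
    using st(5) st'(5) by (simp add: algebra_simps)
  then have "?a u v (x + s *\<^sub>R u + t *\<^sub>R v) = ?a v u (x + s' *\<^sub>R v + t' *\<^sub>R u)"
    using h by simp
  moreover have "\<bar>?a u v (x + s *\<^sub>R u + t *\<^sub>R v) - ?a u v x\<bar> < e"
    using d(2) near(1)[of s t] st by auto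
  moreover have "\<bar>?a v u (x + s' *\<^sub>R v + t' *\<^sub>R u) - ?a v u x\<bar> < e"
    using d(4) near(2)[of t' s'] st' by auto
  ultimately show False unfolding e_def by (simp add: abs_if field_simps split: if_splits)
qed

lemma second_derivative_symmetric:
  fixes f :: "'a::euclidean_space \<Rightarrow> 'b::euclidean_space"
  assumes "open S" "smooth_on S f" "x \<in> S"
  shows "frechet_derivative (\<lambda>y. frechet_derivative f (at y) u) (at x) v =
    frechet_derivative (\<lambda>y. frechet_derivative f (at y) v) (at x) u"
proof (rule euclidean_eqI)
  fix b :: 'b assume "b \<in> Basis"
  have *: "frechet_derivative (\<lambda>y. frechet_derivative (\<lambda>x. f x \<bullet> b) (at y) u) (at x) v =
      frechet_derivative (\<lambda>y. frechet_derivative f (at y) u) (at x) v \<bullet> b" for u v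
  proof -
    have 1: "frechet_derivative (\<lambda>x. f x \<bullet> b) (at y) u = frechet_derivative f (at y) u \<bullet> b" if "y \<in> S" for y
      by (rule frechet_eqI) (use smooth_on_has_derivative[OF assms(2) that] in \<open>auto intro!: derivative_eq_intros\<close>)
    have "((\<lambda>y. frechet_derivative f (at y) u \<bullet> b) has_derivative
        (\<lambda>v. frechet_derivative (\<lambda>y. frechet_derivative f (at y) u) (at x) v \<bullet> b)) (at x)"
      using smooth_on_has_derivative[OF smooth_on_frechet[OF assms(2)] assms(3)] by (auto intro!: derivative_eq_intros)
    then show ?thesis
      by (intro frechet_eqI, rule has_derivative_transform_within_open[OF _ assms(1,3)]) (simp_all add: 1)
  qed
  show "frechet_derivative (\<lambda>y. frechet_derivative f (at y) u) (at x) v \<bullet> b =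
      frechet_derivative (\<lambda>y. frechet_derivative f (at y) v) (at x) u \<bullet> b"
    using second_derivative_symmetric_real[OF assms(1) smooth_on_linear_compose[OF bounded_linear_inner_left assms(1,2)] assms(3), of b u v]
    unfolding * .
qed

section \<open>Product rules for families of bilinear and linear maps\<close>

lemma bilinear_basis_sum:
  fixes B :: "'a::euclidean_space \<Rightarrow> 'b::euclidean_space \<Rightarrow> 'c::real_normed_vector"
  assumes "bilinear B"
  shows "B u w = (\<Sum>i\<in>Basis. \<Sum>j\<in>Basis. ((u \<bullet> i) * (w \<bullet> j)) *\<^sub>R B i j)"
proof -
  have "B u w = B (\<Sum>i\<in>Basis. (u \<bullet> i) *\<^sub>R i) (\<Sum>j\<in>Basis. (w \<bullet> j) *\<^sub>R j)"
    by (simp only: euclidean_representation)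
  also have "\<dots> = (\<Sum>(i,j)\<in>Basis \<times> Basis. B ((u \<bullet> i) *\<^sub>R i) ((w \<bullet> j) *\<^sub>R j))"
    using bilinear_sum[OF assms] by simp
  also have "\<dots> = (\<Sum>i\<in>Basis. \<Sum>j\<in>Basis. ((u \<bullet> i) * (w \<bullet> j)) *\<^sub>R B i j)"
    by (subst sum.cartesian_product[symmetric])
      (simp add: bilinear_lmul[OF assms] bilinear_rmul[OF assms] mult.commute)
  finally show ?thesis .
qed

text \<open>A product rule for a bilinear map that depends on the point. Expansion over the bases
  reduces it to real products, so only the functions \<open>B y a b\<close> with fixed
  \<open>a\<close> and \<open>b\<close> have to be differentiable. It serves metrics, Christoffel
  symbols and their combinations.\<close>

lemma bilinear_family_has_derivative:
  fixes B :: "'x::real_normed_vector \<Rightarrow> 'a::euclidean_space \<Rightarrow> 'b::euclidean_space \<Rightarrow> 'c::real_normed_vector"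
  assumes "open S" "x \<in> S" and bil: "\<And>y. y \<in> S \<Longrightarrow> bilinear (B y)"
    and dB: "\<And>a b. (\<lambda>y. B y a b) differentiable (at x)"
    and f: "(f has_derivative f') (at x)" and g: "(g has_derivative g') (at x)"
  shows "((\<lambda>y. B y (f y) (g y)) has_derivative
    (\<lambda>v. frechet_derivative (\<lambda>y. B y (f x) (g x)) (at x) v + B x (f' v) (g x) + B x (f x) (g' v))) (at x)"
proof -
  let ?D = "\<lambda>a b. frechet_derivative (\<lambda>y. B y a b) (at x)"
  note rep = bilinear_basis_sum[OF bil]
  have dBij: "((\<lambda>y. B y i j) has_derivative ?D i j) (at x)" for i j
    using dB by (simp add: frechet_derivative_works)
  have "((\<lambda>y. \<Sum>i\<in>Basis. \<Sum>j\<in>Basis. ((u y \<bullet> i) * (w y \<bullet> j)) *\<^sub>R B y i j) has_derivative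
     (\<lambda>v. \<Sum>i\<in>Basis. \<Sum>j\<in>Basis. ((u x \<bullet> i) * (w x \<bullet> j)) *\<^sub>R ?D i j v +
        ((u x \<bullet> i) * (w' v \<bullet> j) + (u' v \<bullet> i) * (w x \<bullet> j)) *\<^sub>R B x i j)) (at x)"
    if "(u has_derivative u') (at x)" "(w has_derivative w') (at x)" for u u' w w'
    by (intro has_derivative_sum has_derivative_scaleR has_derivative_mult has_derivative_inner_left that dBij)
  then have der: "((\<lambda>y. B y (u y) (w y)) has_derivative
     (\<lambda>v. \<Sum>i\<in>Basis. \<Sum>j\<in>Basis. ((u x \<bullet> i) * (w x \<bullet> j)) *\<^sub>R ?D i j v +
        ((u x \<bullet> i) * (w' v \<bullet> j) + (u' v \<bullet> i) * (w x \<bullet> j)) *\<^sub>R B x i j)) (at x)"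
    if "(u has_derivative u') (at x)" "(w has_derivative w') (at x)" for u u' w w'
    by (rule has_derivative_transform_within_open[OF _ assms(1,2)]) (use that rep in auto)
  \<comment> \<open>Applied to constant functions, the rule just proved identifies the first sum as
    the derivative of \<open>B y\<close> with frozen arguments.\<close>
  have "?D (f x) (g x) v = (\<Sum>i\<in>Basis. \<Sum>j\<in>Basis. ((f x \<bullet> i) * (g x \<bullet> j)) *\<^sub>R ?D i j v)" for v
    by (subst frechet_eqI[OF der[OF has_derivative_const has_derivative_const]]) simp
  moreover have "B x (f' v) (g x) = (\<Sum>i\<in>Basis. \<Sum>j\<in>Basis. ((f' v \<bullet> i) * (g x \<bullet> j)) *\<^sub>R B x i j)" for v
    by (rule rep[OF assms(2)])
  moreover have "B x (f x) (g' v) = (\<Sum>i\<in>Basis. \<Sum>j\<in>Basis. ((f x \<bullet> i) * (g' v \<bullet> j)) *\<^sub>R B x i j)" for v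
    by (rule rep[OF assms(2)])
  ultimately show ?thesis
    using der[OF f g] by (simp add: sum.distrib scaleR_add_left algebra_simps)
qed

lemma linear_family_has_derivative:
  fixes T :: "'x::real_normed_vector \<Rightarrow> 'a::euclidean_space \<Rightarrow> 'c::real_normed_vector"
  assumes "open S" "x \<in> S" and lin: "\<And>y. y \<in> S \<Longrightarrow> linear (T y)"
    and dT: "\<And>a. (\<lambda>y. T y a) differentiable (at x)"
    and f: "(f has_derivative f') (at x)"
  shows "((\<lambda>y. T y (f y)) has_derivative
    (\<lambda>v. frechet_derivative (\<lambda>y. T y (f x)) (at x) v + T x (f' v))) (at x)"
proof -
  \<comment> \<open>A linear family becomes bilinear through a scalar second argument, which is then
    set to 1.\<close>
  have "bilinear (\<lambda>a b. b *\<^sub>R T y a)" if "y \<in> S" for y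
    using lin[OF that] unfolding bilinear_def
    by (auto intro!: linearI simp: linear_add linear_scale scaleR_add_right scaleR_add_left)
  moreover have "(\<lambda>y. b *\<^sub>R T y a) differentiable (at x)" for a and b :: real
    using dT by auto
  ultimately show ?thesis
    using bilinear_family_has_derivative[OF assms(1,2), of "\<lambda>y a b. b *\<^sub>R T y a" f f' "\<lambda>_. 1::real" "\<lambda>_. 0"] f
    by simp
qed

subsection \<open>Charts\<close>

lemma cinv_cmap: "inj_on (cmap c) (cdom c) \<Longrightarrow> p \<in> cdom c \<Longrightarrow> cinv c (cmap c p) = p"
  by simp

lemma charts_at_iff: "c \<in> charts_at A p \<longleftrightarrow> c \<in> max_atlas A \<and> p \<in> cdom c"
  by (auto simp: charts_at_def)

lemma max_atlas_inj: "c \<in> max_atlas A \<Longrightarrow> inj_on (cmap c) (cdom c)"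
  by (simp add: max_atlas_def)

lemma max_atlas_carrier: "c \<in> max_atlas A \<Longrightarrow> cdom c \<subseteq> carrier_of A"
  by (simp add: max_atlas_def)

lemma max_atlas_cinv [simp]: "c \<in> max_atlas A \<Longrightarrow> p \<in> cdom c \<Longrightarrow> cinv c (cmap c p) = p"
  by (simp add: max_atlas_inj)

lemma transition_cmap: "c \<in> max_atlas A \<Longrightarrow> p \<in> cdom c \<Longrightarrow> transition c d (cmap c p) = cmap d p"
  by (simp add: transition_def)

lemma cmap_eq_iff: "c \<in> max_atlas A \<Longrightarrow> p \<in> cdom c \<Longrightarrow> q \<in> cdom c \<Longrightarrow> cmap c p = cmap c q \<longleftrightarrow> p = q"
  using max_atlas_inj inj_on_eq_iff by metis

abbreviation overlap :: "('a, 'e) chart \<Rightarrow> ('a, 'e) chart \<Rightarrow> 'e set" where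
  "overlap c d \<equiv> cmap c ` (cdom c \<inter> cdom d)"

locale atlas =
  fixes A :: "('a, 'e::euclidean_space) chart set"
  assumes smooth: "smooth_atlas A"
begin

lemma atlas_subset_max: "A \<subseteq> max_atlas A"
  using smooth by (auto simp: smooth_atlas_def max_atlas_def carrier_of_def)

text \<open>Images under one chart appear as preimages under a coordinate change, so that their
  openness follows from continuity.\<close>

lemma overlap_preimage:
  assumes "c \<in> max_atlas A" "d \<in> max_atlas A" "W \<subseteq> cdom d"
  shows "overlap c d \<inter> transition c d -` (cmap d ` W) = cmap c ` (cdom c \<inter> W)"
proof -
  have "p \<in> W" if "p \<in> cdom d" "cmap d p \<in> cmap d ` W" for p
    using that assms cmap_eq_iff[OF assms(2)] by blast
  then show ?thesis using assms by (auto simp: transition_cmap[OF assms(1)])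
qed

text \<open>Membership in \<open>max_atlas A\<close> only gives compatibility with charts of
  \<open>A\<close>. Around each point of the overlap the coordinate change therefore passes through
  a chart \<open>a\<close> of \<open>A\<close>, and smoothness is local.\<close>

lemma compatible_max:
  assumes c: "c \<in> max_atlas A" and d: "d \<in> max_atlas A"
  shows "compatible c d"
proof -
  have main: "\<exists>T. open T \<and> cmap c p \<in> T \<and> T \<subseteq> overlap c d \<and> smooth_on T (transition c d)"
    if c: "c \<in> max_atlas A" and d: "d \<in> max_atlas A" and p: "p \<in> cdom c" "p \<in> cdom d" for c d p
  proof -
    obtain a where a: "a \<in> A" "p \<in> cdom a"
      using max_atlas_carrier[OF c] p by (auto simp: carrier_of_def)
    have am: "a \<in> max_atlas A" using a atlas_subset_max by blast
    have ca: "compatible c a" and da: "compatible d a" using c d a by (auto simp: max_atlas_def)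
    define T where "T = overlap c a \<inter> transition c a -` (cmap a ` (cdom a \<inter> cdom d))"
    have Teq: "T = cmap c ` (cdom c \<inter> (cdom a \<inter> cdom d))"
      unfolding T_def by (rule overlap_preimage[OF c am]) auto
    have "open T" unfolding T_def
      using ca da by (intro continuous_open_preimage smooth_on_continuous_on) (auto simp: compatible_def Int_commute)
    moreover have "smooth_on T (\<lambda>y. transition a d (transition c a y))"
      by (rule smooth_on_compose[OF \<open>open T\<close>, of "overlap a d"])
        (use ca da in \<open>auto simp: compatible_def Int_commute T_def elim: smooth_on_subset[rotated]\<close>)
    then have "smooth_on T (transition c d)"
      by (rule smooth_on_cong[OF \<open>open T\<close>, rotated]) (auto simp: Teq transition_cmap[OF c] transition_cmap[OF am])
    ultimately show ?thesis using p a by (intro exI[of _ T]) (auto simp: Teq)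
  qed
  have "open (overlap c d) \<and> smooth_on (overlap c d) (transition c d)"
    if c: "c \<in> max_atlas A" and d: "d \<in> max_atlas A" for c d
    using main[OF that] by (intro conjI smooth_on_local iffD2[OF open_subopen]) (blast, blast)
  from this[OF c d] this[OF d c] show ?thesis by (simp add: compatible_def Int_commute)
qed

lemma open_overlap: "c \<in> max_atlas A \<Longrightarrow> d \<in> max_atlas A \<Longrightarrow> open (overlap c d)"
  using compatible_max by (simp add: compatible_def)

lemma open_crange: "c \<in> max_atlas A \<Longrightarrow> open (crange c)"
  using open_overlap[of c c] by simp

lemma smooth_transition: "c \<in> max_atlas A \<Longrightarrow> d \<in> max_atlas A \<Longrightarrow> smooth_on (overlap c d) (transition c d)"
  using compatible_max by (simp add: compatible_def)

lemma open_image_change: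
  assumes "c \<in> max_atlas A" "d \<in> max_atlas A" "W \<subseteq> cdom d" "open (cmap d ` W)"
  shows "open (cmap c ` (cdom c \<inter> W))"
  unfolding overlap_preimage[OF assms(1-3), symmetric]
  by (intro continuous_open_preimage smooth_on_continuous_on smooth_transition open_overlap assms)

text \<open>Replaces the generating sets by a test in charts of the maximal atlas. Intersections of
  generators are handled by injectivity of charts; conversely, the sets
  \<open>cdom a \<inter> W\<close> with \<open>a\<close> in \<open>A\<close> are generators
  themselves.\<close>

lemma openin_mtopology_iff:
  "openin (mtopology A) W \<longleftrightarrow> W \<subseteq> carrier_of A \<and> (\<forall>c\<in>max_atlas A. open (cmap c ` (cdom c \<inter> W)))"
proof (intro iffI conjI ballI)
  let ?B = "{{p \<in> cdom c. cmap c p \<in> V} | c V. c \<in> A \<and> open V}"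
  assume "openin (mtopology A) W"
  then have gen: "generate_topology_on ?B W"
    by (simp add: mtopology_def openin_topology_generated_by_iff)
  from gen show "W \<subseteq> carrier_of A"
    by (induction rule: generate_topology_on.induct) (auto simp: carrier_of_def)
  fix c assume c: "c \<in> max_atlas A"
  from gen show "open (cmap c ` (cdom c \<inter> W))"
  proof (induction rule: generate_topology_on.induct)
    case (Int a b)
    have "cmap c ` (cdom c \<inter> (a \<inter> b)) = cmap c ` (cdom c \<inter> a) \<inter> cmap c ` (cdom c \<inter> b)"
      using inj_on_image_Int[OF max_atlas_inj[OF c], of "cdom c \<inter> a" "cdom c \<inter> b"]
      by (simp add: Int_ac)
    then show ?case using open_Int[OF Int.IH] by (simp only:)
  next
    case (UN K)
    have "cmap c ` (cdom c \<inter> \<Union>K) = (\<Union>k\<in>K. cmap c ` (cdom c \<inter> k))" by auto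
    then show ?case using UN by (auto simp only: intro!: open_UN)
  next
    case (Basis s)
    then obtain a V where a: "s = {p \<in> cdom a. cmap a p \<in> V}" "a \<in> A" "open V" by blast
    have am: "a \<in> max_atlas A" using a atlas_subset_max by blast
    have "cmap a ` s = crange a \<inter> V" using a by auto
    then show ?case using open_image_change[OF c am, of s] a open_crange[OF am] by auto
  qed simp
next
  assume *: "W \<subseteq> carrier_of A \<and> (\<forall>c\<in>max_atlas A. open (cmap c ` (cdom c \<inter> W)))"
  show "openin (mtopology A) W"
  proof (subst openin_subopen, intro ballI)
    fix p assume "p \<in> W"
    then obtain a where a: "a \<in> A" "p \<in> cdom a" using * by (auto simp: carrier_of_def)
    have am: "a \<in> max_atlas A" using a atlas_subset_max by blast
    have "{p \<in> cdom a. cmap a p \<in> cmap a ` (cdom a \<inter> W)} = cdom a \<inter> W"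
      using cmap_eq_iff[OF am] by auto
    moreover have "openin (mtopology A) {p \<in> cdom a. cmap a p \<in> cmap a ` (cdom a \<inter> W)}"
      unfolding mtopology_def openin_topology_generated_by_iff
      by (intro generate_topology_on.Basis CollectI exI[of _ a] exI[of _ "cmap a ` (cdom a \<inter> W)"])
        (use a am * in auto)
    ultimately show "\<exists>T. openin (mtopology A) T \<and> p \<in> T \<and> T \<subseteq> W"
      using a \<open>p \<in> W\<close> by auto
  qed
qed

lemma openin_chart_preimage:
  assumes "c \<in> max_atlas A" "open V"
  shows "openin (mtopology A) {p \<in> cdom c. cmap c p \<in> V}"
  unfolding openin_mtopology_iff
proof (intro conjI ballI)
  show "{p \<in> cdom c. cmap c p \<in> V} \<subseteq> carrier_of A" using max_atlas_carrier[OF assms(1)] by auto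
  fix d assume d: "d \<in> max_atlas A"
  have "cmap c ` {p \<in> cdom c. cmap c p \<in> V} = crange c \<inter> V" by auto
  then show "open (cmap d ` (cdom d \<inter> {p \<in> cdom c. cmap c p \<in> V}))"
    using open_image_change[OF d assms(1), of "{p \<in> cdom c. cmap c p \<in> V}"] open_crange[OF assms(1)] assms(2)
    by auto
qed

lemma openin_cdom: "c \<in> max_atlas A \<Longrightarrow> openin (mtopology A) (cdom c)"
  using openin_chart_preimage[of c UNIV] by simp

lemma topspace_mtopology: "topspace (mtopology A) = carrier_of A"
proof
  show "topspace (mtopology A) \<subseteq> carrier_of A"
    using openin_mtopology_iff[of "topspace (mtopology A)"] by simp
  have "cdom c \<inter> carrier_of A = cdom c" if "c \<in> max_atlas A" for c
    using max_atlas_carrier[OF that] by auto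
  then have "openin (mtopology A) (carrier_of A)"
    by (simp add: openin_mtopology_iff open_crange)
  then show "carrier_of A \<subseteq> topspace (mtopology A)" by (rule openin_subset)
qed

text \<open>The source of new charts: \<open>\<phi>\<close> and \<open>\<psi>\<close> are the
  mutually inverse coordinate changes between a known chart and the new one, and every other
  transition map is a composition with one of them. It is used for restrictions and for the sheared
  charts of the tangent bundle.\<close>

lemma chart_change:
  assumes c: "c \<in> max_atlas A" and sub: "cdom d \<subseteq> cdom c" and o: "open (cmap c ` cdom d)" "open (crange d)"
    and sm: "smooth_on (cmap c ` cdom d) \<phi>" "smooth_on (crange d) \<psi>"
    and eq: "\<And>p. p \<in> cdom d \<Longrightarrow> \<phi> (cmap c p) = cmap d p" "\<And>p. p \<in> cdom d \<Longrightarrow> \<psi> (cmap d p) = cmap c p"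
  shows "d \<in> max_atlas A"
proof -
  have inj: "inj_on (cmap d) (cdom d)"
    by (rule inj_onI) (metis c eq(2) cmap_eq_iff sub subsetD)
  have "compatible d e" if "e \<in> A" for e
  proof -
    have e: "e \<in> max_atlas A" using that atlas_subset_max by blast
    have in_e: "p \<in> cdom e" if "p \<in> cdom d" "cmap c p \<in> overlap c e" for p
      using that cmap_eq_iff[OF c] sub by blast
    have 1: "overlap d e = crange d \<inter> \<psi> -` overlap c e"
      using sub in_e by (auto simp: eq)
    have o1: "open (overlap d e)" unfolding 1
      by (intro continuous_open_preimage smooth_on_continuous_on sm o open_overlap c e)
    have 2: "overlap e d = overlap e c \<inter> transition e c -` (cmap c ` cdom d)"
      using overlap_preimage[OF e c sub] by simp
    have o2: "open (overlap e d)" using open_image_change[OF e c sub o(1)] .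
    have tr: "transition d e (cmap d p) = cmap e p" if "p \<in> cdom d" for p
      by (simp add: transition_def inj that)
    have "smooth_on (overlap d e) (\<lambda>y. transition c e (\<psi> y))"
      by (rule smooth_on_compose[OF o1 open_overlap[OF c e] _ smooth_transition[OF c e] smooth_on_subset[OF _ sm(2)]])
        (auto simp: 1)
    then have s1: "smooth_on (overlap d e) (transition d e)"
      by (rule smooth_on_cong[OF o1, rotated])
        (use sub tr in \<open>auto simp: eq transition_cmap[OF c]\<close>)
    have "smooth_on (overlap e d) (\<lambda>y. \<phi> (transition e c y))"
      by (rule smooth_on_compose[OF o2 o(1) _ sm(1) smooth_on_subset[OF _ smooth_transition[OF e c]]])
        (auto simp: 2)
    then have s2: "smooth_on (overlap e d) (transition e d)"
      by (rule smooth_on_cong[OF o2, rotated])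
        (use sub in \<open>auto simp: eq transition_cmap[OF e]\<close>)
    show ?thesis using o1 o2 s1 s2 by (simp add: compatible_def Int_commute)
  qed
  then show ?thesis using inj sub max_atlas_carrier[OF c] by (auto simp: max_atlas_def)
qed

lemma chart_restrict:
  assumes "c \<in> max_atlas A" "open V"
  shows "({p \<in> cdom c. cmap c p \<in> V}, cmap c) \<in> max_atlas A"
proof (rule chart_change[OF assms(1), where \<phi> = "\<lambda>x. x" and \<psi> = "\<lambda>x. x"])
  have "cmap c ` {p \<in> cdom c. cmap c p \<in> V} = crange c \<inter> V" by auto
  then show "open (cmap c ` cdom ({p \<in> cdom c. cmap c p \<in> V}, cmap c))"
    "open (crange ({p \<in> cdom c. cmap c p \<in> V}, cmap c))"
    using open_crange assms by auto
qed (auto intro: smooth_on_id)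

subsection \<open>Tangent vectors\<close>

abbreviation jac :: "('a, 'e) chart \<Rightarrow> ('a, 'e) chart \<Rightarrow> 'e \<Rightarrow> 'e \<Rightarrow> 'e" where
  "jac c d x \<equiv> frechet_derivative (transition c d) (at x)"

lemma jac_has_derivative:
  "c \<in> charts_at A p \<Longrightarrow> d \<in> charts_at A p \<Longrightarrow>
    (transition c d has_derivative jac c d (cmap c p)) (at (cmap c p))"
  unfolding charts_at_iff by (rule smooth_on_has_derivative[OF smooth_transition]) auto

lemma jac_linear: "c \<in> charts_at A p \<Longrightarrow> d \<in> charts_at A p \<Longrightarrow> linear (jac c d (cmap c p))"
  using jac_has_derivative has_derivative_linear by blast

lemma jac_cocycle:
  assumes c: "c \<in> charts_at A p" and d: "d \<in> charts_at A p" and e: "e \<in> charts_at A p"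
  shows "jac d e (cmap d p) (jac c d (cmap c p) u) = jac c e (cmap c p) u"
proof -
  have cm: "c \<in> max_atlas A" "d \<in> max_atlas A" "e \<in> max_atlas A" "p \<in> cdom c" "p \<in> cdom d"
    using assms by (auto simp: charts_at_iff)
  have "((\<lambda>x. transition d e (transition c d x)) has_derivative (\<lambda>u. jac d e (cmap d p) (jac c d (cmap c p) u))) (at (cmap c p))"
    using has_derivative_compose[OF jac_has_derivative[OF c d], of "transition d e" "jac d e (cmap d p)"]
      jac_has_derivative[OF d e] transition_cmap[OF cm(1,4), of d] by simp
  then have "(transition c e has_derivative (\<lambda>u. jac d e (cmap d p) (jac c d (cmap c p) u))) (at (cmap c p))"
    by (rule has_derivative_transform_within_open[OF _ open_overlap[OF cm(1,2)]])
      (use cm in \<open>auto simp: transition_cmap\<close>)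
  then show ?thesis by (simp add: frechet_eqI)
qed

text \<open>A chart includes its domain, so a restricted chart is a different index for the
  components of a tangent vector. The components nevertheless agree, because the coordinate change
  is the identity.\<close>

lemma jac_eq_id:
  assumes "c \<in> charts_at A p" "d \<in> charts_at A p" "\<And>q. q \<in> cdom c \<inter> cdom d \<Longrightarrow> cmap c q = cmap d q"
  shows "jac c d (cmap c p) u = u"
proof -
  have cm: "c \<in> max_atlas A" "d \<in> max_atlas A" "p \<in> cdom c" "p \<in> cdom d"
    using assms by (auto simp: charts_at_iff)
  have "(transition c d has_derivative (\<lambda>u. u)) (at (cmap c p))"
  proof (rule has_derivative_transform_within_open[OF has_derivative_ident open_overlap[OF cm(1,2)]])
    fix y assume "y \<in> overlap c d"
    then obtain q where "q \<in> cdom c \<inter> cdom d" "y = cmap c q" by blast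
    then show "y = transition c d y" using transition_cmap[OF cm(1)] assms(3) by (metis IntD1)
  qed (use cm in auto)
  then show ?thesis by (simp add: frechet_eqI)
qed

lemma jac_same: "c \<in> charts_at A p \<Longrightarrow> jac c c (cmap c p) u = u"
  using jac_eq_id[of c p c u] by simp

lemma jac_inverse: "c \<in> charts_at A p \<Longrightarrow> d \<in> charts_at A p \<Longrightarrow> jac d c (cmap d p) (jac c d (cmap c p) u) = u"
  by (simp add: jac_cocycle jac_same)

lemma tvec_at_apply: "d \<in> charts_at A p \<Longrightarrow> tvec_at A c p u d = jac c d (cmap c p) u"
  by (simp add: tvec_at_def)

lemma tvec_at_same [simp]: "c \<in> charts_at A p \<Longrightarrow> tvec_at A c p u c = u"
  by (simp add: tvec_at_apply jac_same)

lemma tvec_at_tspace: "c \<in> charts_at A p \<Longrightarrow> tvec_at A c p u \<in> tspace A p"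
  by (auto simp: tspace_def tvec_at_def jac_cocycle)

lemma tspace_apply: "v \<in> tspace A p \<Longrightarrow> c \<in> charts_at A p \<Longrightarrow> d \<in> charts_at A p \<Longrightarrow> v d = jac c d (cmap c p) (v c)"
  unfolding tspace_def by blast

lemma tvec_at_eq:
  assumes "v \<in> tspace A p" "c \<in> charts_at A p"
  shows "tvec_at A c p (v c) = v"
proof
  fix d show "tvec_at A c p (v c) d = v d"
  proof (cases "d \<in> charts_at A p")
    case True
    then show ?thesis by (simp only: tvec_at_apply tspace_apply[OF assms True, symmetric])
  next
    case False
    moreover have "v d = 0" using assms(1) False unfolding tspace_def by blast
    ultimately show ?thesis by (simp add: tvec_at_def)
  qed
qed

lemma tspace_ext: "v \<in> tspace A p \<Longrightarrow> w \<in> tspace A p \<Longrightarrow> c \<in> charts_at A p \<Longrightarrow> v c = w c \<Longrightarrow> v = w"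
  by (metis tvec_at_eq)

lemma tvec_at_diff:
  assumes "c \<in> charts_at A p"
  shows "(\<lambda>d. tvec_at A c p u d - tvec_at A c p w d) = tvec_at A c p (u - w)"
  by (auto simp: tvec_at_def fun_eq_iff linear_diff[OF jac_linear] assms)

lemma tvec_at_zero: "c \<in> charts_at A p \<Longrightarrow> tvec_at A c p 0 = (\<lambda>d. 0)"
  by (auto simp: tvec_at_def fun_eq_iff linear_0[OF jac_linear])

lemma tvec_at_change:
  assumes "c \<in> charts_at A p" "d \<in> charts_at A p"
  shows "tvec_at A d p (jac c d (cmap c p) u) = tvec_at A c p u"
  using tvec_at_eq[OF tvec_at_tspace[OF assms(1)] assms(2)] by (simp add: tvec_at_apply assms)

end

subsection \<open>Inner products and the Koszul formula\<close>

definition inner_form :: "('e::euclidean_space \<Rightarrow> 'e \<Rightarrow> real) \<Rightarrow> bool" where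
  "inner_form G \<longleftrightarrow> bilinear G \<and> (\<forall>u w. G u w = G w u) \<and> (\<forall>u. u \<noteq> 0 \<longrightarrow> G u u > 0)"

lemma inner_form_bilinear: "inner_form G \<Longrightarrow> bilinear G"
  and inner_form_sym: "inner_form G \<Longrightarrow> G u w = G w u"
  and inner_form_pos: "inner_form G \<Longrightarrow> u \<noteq> 0 \<Longrightarrow> G u u > 0"
  by (auto simp: inner_form_def)

lemmas inner_form_simps =
  bilinear_ladd[OF inner_form_bilinear] bilinear_radd[OF inner_form_bilinear]
  bilinear_lsub[OF inner_form_bilinear] bilinear_rsub[OF inner_form_bilinear]
  bilinear_lmul[OF inner_form_bilinear] bilinear_rmul[OF inner_form_bilinear]
  bilinear_lzero[OF inner_form_bilinear] bilinear_rzero[OF inner_form_bilinear]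

lemma inner_form_linear_left: "inner_form G \<Longrightarrow> linear (\<lambda>u. G u w)"
  and inner_form_linear_right: "inner_form G \<Longrightarrow> linear (G u)"
  using inner_form_bilinear by (auto simp: bilinear_def)

lemma inner_form_eq_0: "inner_form G \<Longrightarrow> G u u = 0 \<longleftrightarrow> u = 0"
  using inner_form_pos[of G u] inner_form_simps(7)[of G u] by fastforce

lemma inner_form_eqI:
  assumes G: "inner_form G" and eq: "\<And>w. G z w = G z' w" shows "z = z'"
proof -
  have "G (z - z') (z - z') = 0" using eq by (simp add: inner_form_simps(3)[OF G])
  then show ?thesis using inner_form_eq_0[OF G] by simp
qed

text \<open>\<open>T\<close> represents \<open>G\<close> with respect to the standard inner product.
  It is injective because \<open>G\<close> is definite, hence surjective in finite
  dimension.\<close>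

lemma inner_form_riesz:
  fixes G :: "'e::euclidean_space \<Rightarrow> 'e \<Rightarrow> real"
  assumes G: "inner_form G" and lin: "linear \<alpha>"
  shows "\<exists>z. \<forall>w. G z w = \<alpha> w"
proof -
  define T where "T z = (\<Sum>b\<in>Basis. G z b *\<^sub>R b)" for z
  have rep: "f w = (\<Sum>b\<in>Basis. f b *\<^sub>R b) \<bullet> w" if "linear f" for f :: "'e \<Rightarrow> real" and w
  proof -
    have "f w = f (\<Sum>b\<in>Basis. (w \<bullet> b) *\<^sub>R b)" by (simp add: euclidean_representation)
    also have "\<dots> = (\<Sum>b\<in>Basis. (w \<bullet> b) * f b)"
      by (simp add: linear_sum[OF that] linear_scale[OF that])
    also have "\<dots> = w \<bullet> (\<Sum>b\<in>Basis. f b *\<^sub>R b)"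
      by (simp add: inner_sum_right mult.commute)
    also have "\<dots> = (\<Sum>b\<in>Basis. f b *\<^sub>R b) \<bullet> w" by (rule inner_commute)
    finally show ?thesis .
  qed
  have T: "T z \<bullet> w = G z w" for z w
    unfolding T_def by (rule rep[OF inner_form_linear_right[OF G], symmetric])
  have "linear T" unfolding T_def
    by (intro linear_compose_sum ballI linearI)
      (simp_all add: inner_form_simps[OF G] scaleR_add_left)
  moreover have "inj T"
    by (rule injI, rule inner_form_eqI[OF G]) (simp flip: T)
  ultimately have "surj T" by (rule linear_inj_imp_surj)
  then obtain z where "T z = (\<Sum>b\<in>Basis. \<alpha> b *\<^sub>R b)" using surjD by metis
  then have "G z w = \<alpha> w" for w using T[of z w] rep[OF lin, of w] by simp
  then show ?thesis by blast
qed

text \<open>Gram-Schmidt by induction on a finite spanning set: a new vector contributes its part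
  \<open>e\<close> orthogonal to the span of the old ones.\<close>

lemma inner_form_projection:
  fixes G :: "'e::euclidean_space \<Rightarrow> 'e \<Rightarrow> real"
  assumes G: "inner_form G" and L: "subspace L"
  shows "\<exists>l\<in>L. \<forall>m\<in>L. G (w - l) m = 0"
proof -
  have "\<forall>w. \<exists>l\<in>span B. \<forall>m\<in>span B. G (w - l) m = 0" if "finite B" for B
    using that
  proof (induction rule: finite_induct)
    case empty
    then show ?case by (auto simp: inner_form_simps[OF G])
  next
    case (insert b B)
    show ?case
    proof
      fix w
      obtain lb where lb: "lb \<in> span B" "\<And>m. m \<in> span B \<Longrightarrow> G (b - lb) m = 0" using insert.IH by blast
      obtain lw where lw: "lw \<in> span B" "\<And>m. m \<in> span B \<Longrightarrow> G (w - lw) m = 0" using insert.IH by blast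
      define e where "e = b - lb"
      \<comment> \<open>The set need not be independent: if \<open>b\<close> lies in
        \<open>span B\<close>, then \<open>e\<close> is 0 and the correction
        \<open>t *\<^sub>R e\<close> vanishes.\<close>
      define t where "t = G w e / G e e"
      define l where "l = lw + t *\<^sub>R e"
      have sub: "span B \<subseteq> span (insert b B)" by (rule span_mono) auto
      have "e \<in> span (insert b B)" unfolding e_def
        by (rule span_diff) (use sub lb in \<open>auto intro: span_base\<close>)
      then have "l \<in> span (insert b B)" unfolding l_def using lw sub by (auto intro!: span_add span_mul)
      moreover have "G (w - l) m = 0" if "m \<in> span (insert b B)" for m
      proof -
        obtain k where k: "m - k *\<^sub>R b \<in> span B" using \<open>m \<in> span (insert b B)\<close> by (auto simp: span_insert)
        define n where "n = m - k *\<^sub>R b + k *\<^sub>R lb"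
        have n: "n \<in> span B" unfolding n_def using k lb by (intro span_add span_mul)
        have m: "m = n + k *\<^sub>R e" by (simp add: n_def e_def algebra_simps)
        have ge: "G e n = 0" "G lw e = 0"
          using lb(2)[OF n] lb(2)[OF lw(1)] inner_form_sym[OF G, of lw e] by (auto simp: e_def)
        have "G (w - l) n = 0" using lw(2)[OF n] ge by (simp add: l_def inner_form_simps[OF G])
        moreover have "G (w - l) e = 0"
          using ge inner_form_eq_0[OF G, of e] by (cases "e = 0") (auto simp: l_def t_def inner_form_simps[OF G])
        ultimately show ?thesis by (simp add: m inner_form_simps[OF G])
      qed
      ultimately show "\<exists>l\<in>span (insert b B). \<forall>m\<in>span (insert b B). G (w - l) m = 0" by blast
    qed
  qed
  note * = this
  obtain B where "finite B" "span B = L" using basis_subspace_exists[OF L] by metis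
  with *[of B] show ?thesis by simp
qed

text \<open>The algebraic core of the uniqueness of the Levi-Civita connection.
  \<open>D u v w\<close> stands for the derivative of \<open>G v w\<close> along \<open>u\<close>;
  the two assumptions on \<open>B\<close> are freedom from torsion and compatibility with the
  metric.\<close>

lemma koszul_unique:
  assumes G: "inner_form G" and sym: "\<And>u v. B u v = B v u"
    and compat: "\<And>u v w. D u v w = G (B u v) w + G v (B u w)"
  shows "(THE z. \<forall>w. 2 * G z w = D u v w + D v u w - D w u v) = B u v"
proof (rule the_equality)
  have *: "2 * G (B u v) w = D u v w + D v u w - D w u v" for w
    using inner_form_sym[OF G] by (simp add: compat sym[of v u] sym[of w u] sym[of w v])
  then show "\<forall>w. 2 * G (B u v) w = D u v w + D v u w - D w u v" by blast
  fix z assume "\<forall>w. 2 * G z w = D u v w + D v u w - D w u v"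
  then show "z = B u v" using * by (intro inner_form_eqI[OF G]) (metis mult_cancel_left zero_neq_numeral)
qed

text \<open>The matching existence part. The right-hand side is linear in \<open>w\<close>, so a
  solution exists by \<open>inner_form_riesz\<close>; definiteness makes it unique, and uniqueness
  transfers symmetry and linearity from \<open>D\<close> to \<open>K\<close>.\<close>

lemma koszul_solution:
  fixes G :: "'e::euclidean_space \<Rightarrow> 'e \<Rightarrow> real"
  assumes G: "inner_form G" and lin: "\<And>u v. linear (D u v)" "\<And>v w. linear (\<lambda>u. D u v w)"
    and sym: "\<And>u v w. D u v w = D u w v"
    and K_def: "\<And>u v. K u v = (THE z. \<forall>w. 2 * G z w = D u v w + D v u w - D w u v)"
  shows "2 * G (K u v) w = D u v w + D v u w - D w u v" "bilinear K" "K u v = K v u"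
    "D u v w = G (K u v) w + G v (K u w)"
proof -
  have lin2: "linear (\<lambda>v. D u v w)" for u w using lin(1)[of u w] by (simp add: sym[of u _ w])
  have K: "2 * G (K u v) w = D u v w + D v u w - D w u v" for u v w
  proof -
    have "linear (\<lambda>w. (D u v w + D v u w - D w u v) / 2)"
      unfolding divide_inverse mult.commute[of _ "inverse 2"]
      using linear_compose_scale_right[OF linear_compose_sub[OF linear_compose_add[OF lin(1)[of u v] lin(1)[of v u]] lin(2)[of u v]], of "inverse 2"]
      by simp
    from inner_form_riesz[OF G this] obtain z where z: "\<And>w. 2 * G z w = D u v w + D v u w - D w u v"
      by (auto simp: field_simps)
    have "\<forall>w. 2 * G (K u v) w = D u v w + D v u w - D w u v"
      unfolding K_def
    proof (rule theI[of _ z])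
      fix z' assume "\<forall>w. 2 * G z' w = D u v w + D v u w - D w u v"
      then show "z' = z" using z by (intro inner_form_eqI[OF G]) (metis mult_cancel_left zero_neq_numeral)
    qed (use z in blast)
    then show ?thesis by blast
  qed
  show "2 * G (K u v) w = D u v w + D v u w - D w u v" by (rule K)
  have eqI: "z = z'" if "\<And>w. 2 * G z w = 2 * G z' w" for z z'
    using that by (intro inner_form_eqI[OF G]) simp
  show sK: "K u v = K v u" for u v
    by (rule eqI) (use sym[of _ v u] in \<open>simp add: K\<close>)
  have add: "K (u + u') v = K u v + K u' v" for u u' v
  proof (rule eqI)
    fix w
    have "2 * G (K u v + K u' v) w = 2 * G (K u v) w + 2 * G (K u' v) w"
      by (simp add: inner_form_simps[OF G])
    then show "2 * G (K (u + u') v) w = 2 * G (K u v + K u' v) w"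
      by (simp add: K linear_add[OF lin(1)] linear_add[OF lin(2)] linear_add[OF lin2])
  qed
  have scale: "K (r *\<^sub>R u) v = r *\<^sub>R K u v" for r u v
  proof (rule eqI)
    fix w
    have "2 * G (r *\<^sub>R K u v) w = r * (2 * G (K u v) w)"
      by (simp add: inner_form_simps[OF G])
    then show "2 * G (K (r *\<^sub>R u) v) w = 2 * G (r *\<^sub>R K u v) w"
      by (simp add: K linear_scale[OF lin(1)] linear_scale[OF lin(2)] linear_scale[OF lin2] algebra_simps)
  qed
  have l: "linear (\<lambda>u. K u v)" for v by (rule linearI) (simp_all add: add scale)
  then have "linear (K u)" for u using sK by presburger
  then show "bilinear K" using l by (simp add: bilinear_def)
  \<comment> \<open>In the sum of the Koszul equations for \<open>(u, v, w)\<close> and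
    \<open>(u, w, v)\<close> only the derivatives along \<open>u\<close> survive.\<close>
  have "2 * D u v w = 2 * G (K u v) w + 2 * G (K u w) v" unfolding K using sym[of u v w] sym[of w v u] sym[of v w u] sym[of u w v]
    by (simp add: sym[of w u v] sym[of v u w])
  then show "D u v w = G (K u v) w + G v (K u w)" using inner_form_sym[OF G, of "K u w" v] by simp
qed

text \<open>Produces frames that depend differentiably on the point, in place of an inverse matrix.
  Orthogonality without normalisation suffices and avoids square roots. The fixed span is carried
  through the induction because it shows, with \<open>a\<close> outside \<open>span B\<close>, that
  the next frame vector is nonzero.\<close>

lemma gram_schmidt_family:
  fixes G :: "'x::real_normed_vector \<Rightarrow> 'e::euclidean_space \<Rightarrow> 'e \<Rightarrow> real"
  assumes "open S" "x \<in> S" and G: "\<And>y. y \<in> S \<Longrightarrow> inner_form (G y)"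
    and dG: "\<And>u w. (\<lambda>y. G y u w) differentiable (at x)"
    and "finite B" "independent B"
  shows "\<exists>E. (\<forall>b\<in>B. E b differentiable (at x)) \<and> (\<forall>y\<in>S. (\<forall>b\<in>B. E b y \<noteq> 0) \<and>
    (\<forall>b\<in>B. \<forall>b'\<in>B. b \<noteq> b' \<longrightarrow> G y (E b y) (E b' y) = 0) \<and> span ((\<lambda>b. E b y) ` B) = span B)"
  using assms(5,6)
proof (induction rule: finite_induct)
  case empty
  then show ?case by simp
next
  case (insert a B)
  then have ind: "independent B" "a \<notin> span B" by (auto simp: independent_insert)
  then obtain E where E: "\<And>b. b \<in> B \<Longrightarrow> E b differentiable (at x)"
    "\<And>b y. y \<in> S \<Longrightarrow> b \<in> B \<Longrightarrow> E b y \<noteq> 0"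
    "\<And>b b' y. y \<in> S \<Longrightarrow> b \<in> B \<Longrightarrow> b' \<in> B \<Longrightarrow> b \<noteq> b' \<Longrightarrow> G y (E b y) (E b' y) = 0"
    "\<And>y. y \<in> S \<Longrightarrow> span ((\<lambda>b. E b y) ` B) = span B"
    using insert.IH by metis
  define h where "h y = (\<Sum>b\<in>B. (G y a (E b y) / G y (E b y) (E b y)) *\<^sub>R E b y)" for y
  define F where "F = E(a := \<lambda>y. a - h y)"
  have F: "F a = (\<lambda>y. a - h y)" "\<And>b. b \<in> B \<Longrightarrow> F b = E b" using insert.hyps by (auto simp: F_def)
  have dGf: "(\<lambda>y. G y (f y) (g y)) differentiable (at x)"
    if "f differentiable (at x)" "g differentiable (at x)" for f g
    using bilinear_family_has_derivative[OF assms(1,2), of G f _ g] inner_form_bilinear[OF G] dG that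
    unfolding differentiable_def by blast
  have "h differentiable (at x)" unfolding h_def
    using insert.hyps(1) E(1,2) assms(2) inner_form_eq_0[OF G]
    by (intro differentiable_sum differentiable_scaleR differentiable_divide dGf ballI) auto
  then have 1: "\<forall>b\<in>insert a B. F b differentiable (at x)" using E(1) F by auto
  have 2: "h y \<in> span B" if "y \<in> S" for y
    unfolding h_def using E(4)[OF that] by (intro span_sum span_mul) (metis image_eqI span_base)
  have 3: "G y (a - h y) (E b' y) = 0" if "y \<in> S" "b' \<in> B" for y b'
  proof -
    have "G y (h y) (E b' y) = (\<Sum>b\<in>B. G y a (E b y) / G y (E b y) (E b y) * G y (E b y) (E b' y))"
      unfolding h_def using that
      by (simp add: linear_sum[OF inner_form_linear_left[OF G]] inner_form_simps[OF G])
    also have "\<dots> = (\<Sum>b\<in>B. if b = b' then G y a (E b' y) else 0)"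
      using E(2,3)[OF that(1)] that inner_form_eq_0[OF G[OF that(1)]] by (intro sum.cong) auto
    finally show ?thesis using that insert.hyps by (simp add: inner_form_simps[OF G])
  qed
  have 4: "span (insert (a - h y) ((\<lambda>b. E b y) ` B)) = span (insert a B)" if "y \<in> S" for y
  proof -
    have "x - k *\<^sub>R (a - h y) \<in> span B \<longleftrightarrow> x - k *\<^sub>R a \<in> span B" for x k
      using span_add_eq[OF span_mul[OF 2[OF that], of k], of "x - k *\<^sub>R a"]
      by (simp add: algebra_simps)
    then show ?thesis by (simp add: span_insert E(4)[OF that])
  qed
  have 5: "a - h y \<noteq> 0" if "y \<in> S" for y using 2[OF that] ind by auto
  have im: "(\<lambda>b. F b y) ` insert a B = insert (a - h y) ((\<lambda>b. E b y) ` B)" for y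
    using F by (simp cong: image_cong)
  show ?case
  proof (intro exI[of _ F] conjI ballI impI)
    fix y b b' assume *: "y \<in> S" "b \<in> insert a B" "b' \<in> insert a B" "b \<noteq> b'"
    show "G y (F b y) (F b' y) = 0"
      using * 3[OF *(1)] E(3)[OF *(1)] inner_form_sym[OF G[OF *(1)]] F by (metis insertE)
  next
    fix y assume "y \<in> S"
    then show "span ((\<lambda>b. F b y) ` insert a B) = span (insert a B)"
      unfolding im by (rule 4)
  qed (use 1 5 E(2) F in auto)
qed

text \<open>In an orthogonal frame the solution is explicit: its coefficients are the quotients of
  \<open>\<alpha> y (E b y)\<close> by \<open>G y (E b y) (E b y)\<close>, and these are
  differentiable.\<close>

lemma differentiable_linear_solution:
  fixes G :: "'x::real_normed_vector \<Rightarrow> 'e::euclidean_space \<Rightarrow> 'e \<Rightarrow> real"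
  assumes S: "open S" "x \<in> S" and G: "\<And>y. y \<in> S \<Longrightarrow> inner_form (G y)"
    and dG: "\<And>u w. (\<lambda>y. G y u w) differentiable (at x)"
    and lin: "\<And>y. y \<in> S \<Longrightarrow> linear (\<alpha> y)" and d\<alpha>: "\<And>w. (\<lambda>y. \<alpha> y w) differentiable (at x)"
    and z: "\<And>y w. y \<in> S \<Longrightarrow> G y (z y) w = \<alpha> y w"
  shows "z differentiable (at x)"
proof -
  have "\<exists>E. (\<forall>b\<in>(Basis :: 'e set). E b differentiable (at x)) \<and> (\<forall>y\<in>S. (\<forall>b\<in>Basis. E b y \<noteq> 0) \<and>
      (\<forall>b\<in>Basis. \<forall>b'\<in>Basis. b \<noteq> b' \<longrightarrow> G y (E b y) (E b' y) = 0) \<and> span ((\<lambda>b. E b y) ` Basis) = span Basis)"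
    using gram_schmidt_family[OF S G dG finite_Basis independent_Basis] by simp
  then obtain E where E0: "\<forall>b\<in>(Basis :: 'e set). E b differentiable (at x)"
    and E1: "\<forall>y\<in>S. (\<forall>b\<in>Basis. E b y \<noteq> 0) \<and>
      (\<forall>b\<in>Basis. \<forall>b'\<in>Basis. b \<noteq> b' \<longrightarrow> G y (E b y) (E b' y) = 0) \<and> span ((\<lambda>b. E b y) ` Basis) = span Basis"
    by (elim exE conjE) (rule that)
  then have E: "\<And>b::'e. b \<in> Basis \<Longrightarrow> E b differentiable (at x)"
    "\<And>(b::'e) y. y \<in> S \<Longrightarrow> b \<in> Basis \<Longrightarrow> E b y \<noteq> 0"
    "\<And>(b::'e) (b'::'e) y. y \<in> S \<Longrightarrow> b \<in> Basis \<Longrightarrow> b' \<in> Basis \<Longrightarrow> b \<noteq> b' \<Longrightarrow> G y (E b y) (E b' y) = 0"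
    "\<And>y. y \<in> S \<Longrightarrow> span ((\<lambda>b. E b y) ` Basis) = span Basis"
    by auto
  define h where "h y = (\<Sum>b\<in>Basis. (\<alpha> y (E b y) / G y (E b y) (E b y)) *\<^sub>R E b y)" for y
  have dGf: "(\<lambda>y. G y (f y) (g y)) differentiable (at x)"
    if "f differentiable (at x)" "g differentiable (at x)" for f g
    using bilinear_family_has_derivative[OF S, of G f _ g] inner_form_bilinear[OF G] dG that
    unfolding differentiable_def by blast
  have d\<alpha>f: "(\<lambda>y. \<alpha> y (f y)) differentiable (at x)" if "f differentiable (at x)" for f
    using linear_family_has_derivative[OF S, of \<alpha> f] lin d\<alpha> that
    unfolding differentiable_def by blast
  have dh: "h differentiable (at x)" unfolding h_def
    using E(1,2) S(2) inner_form_eq_0[OF G]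
    by (intro differentiable_sum finite_Basis differentiable_scaleR differentiable_divide dGf d\<alpha>f ballI) auto
  have "h y = z y" if y: "y \<in> S" for y
  proof (rule inner_form_eqI[OF G[OF y]])
    fix w
    have b: "G y (h y) (E b' y) = \<alpha> y (E b' y)" if "b' \<in> Basis" for b' :: 'e
    proof -
      have "G y (h y) (E b' y) = (\<Sum>b\<in>Basis. \<alpha> y (E b y) / G y (E b y) (E b y) * G y (E b y) (E b' y))"
        unfolding h_def using y
        by (simp add: linear_sum[OF inner_form_linear_left[OF G]] inner_form_simps[OF G])
      also have "\<dots> = (\<Sum>b\<in>Basis. if b = b' then \<alpha> y (E b' y) else 0)"
        using E(2,3)[OF y] that inner_form_eq_0[OF G[OF y]] by (intro sum.cong) auto
      finally show ?thesis using that by simp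
    qed
    have "w \<in> span ((\<lambda>b. E b y) ` Basis)" using E(4)[OF y] by simp
    then show "G y (h y) w = G y (z y) w"
      by (rule linear_eq_on_span[OF inner_form_linear_right[OF G[OF y]] inner_form_linear_right[OF G[OF y]], rotated])
        (use b z[OF y] in auto)
  qed
  then have eq: "\<And>y. y \<in> S \<Longrightarrow> h y = z y" by simp
  obtain h' where "(h has_derivative h') (at x)" using dh unfolding differentiable_def by blast
  from has_derivative_transform_within_open[OF this S] eq show ?thesis
    unfolding differentiable_def by blast
qed

subsection \<open>The Levi-Civita connection\<close>

context atlas
begin

abbreviation hess :: "('a, 'e) chart \<Rightarrow> ('a, 'e) chart \<Rightarrow> 'e \<Rightarrow> 'e \<Rightarrow> 'e \<Rightarrow> 'e" where
  "hess c d x u v \<equiv> frechet_derivative (\<lambda>y. jac c d y v) (at x) u"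

lemma smooth_jac: "c \<in> max_atlas A \<Longrightarrow> d \<in> max_atlas A \<Longrightarrow> smooth_on (overlap c d) (\<lambda>y. jac c d y v)"
  by (intro smooth_on_frechet smooth_transition)

lemma jac_apply_has_derivative:
  assumes "c \<in> charts_at A p" "d \<in> charts_at A p"
  shows "((\<lambda>y. jac c d y v) has_derivative (\<lambda>u. hess c d (cmap c p) u v)) (at (cmap c p))"
  by (rule smooth_on_has_derivative[OF smooth_jac]) (use assms in \<open>auto simp: charts_at_iff\<close>)

lemma hess_sym:
  assumes "c \<in> charts_at A p" "d \<in> charts_at A p"
  shows "hess c d (cmap c p) u v = hess c d (cmap c p) v u"
  by (rule second_derivative_symmetric[OF open_overlap smooth_transition])
    (use assms in \<open>auto simp: charts_at_iff\<close>)

lemma coord_metric_cmap: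
  "c \<in> charts_at A p \<Longrightarrow> coord_metric A g c (cmap c p) u w = g p (tvec_at A c p u) (tvec_at A c p w)"
  by (auto simp: coord_metric_def charts_at_iff)

lemma coord_metric_change:
  assumes "c \<in> charts_at A p" "d \<in> charts_at A p"
  shows "coord_metric A g c (cmap c p) u w =
    coord_metric A g d (cmap d p) (jac c d (cmap c p) u) (jac c d (cmap c p) w)"
  by (simp add: coord_metric_cmap assms tvec_at_change)

end

text \<open>Only differentiable coefficients are demanded, although g itself is smooth: the
  coefficients of the Sasaki metric contain the Christoffel symbols of g, which are shown to be
  differentiable, and one derivative is what the Koszul formula takes.\<close>

locale metric_atlas = atlas A for A :: "('a, 'e::euclidean_space) chart set" +
  fixes g :: "('a, 'e) metric"
  assumes form: "c \<in> max_atlas A \<Longrightarrow> x \<in> crange c \<Longrightarrow> inner_form (coord_metric A g c x)"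
    and metric_differentiable:
      "c \<in> max_atlas A \<Longrightarrow> x \<in> crange c \<Longrightarrow> (\<lambda>y. coord_metric A g c y u w) differentiable (at x)"
begin

abbreviation dmetric :: "('a, 'e) chart \<Rightarrow> 'e \<Rightarrow> 'e \<Rightarrow> 'e \<Rightarrow> 'e \<Rightarrow> real" where
  "dmetric c x u v w \<equiv> frechet_derivative (\<lambda>y. coord_metric A g c y v w) (at x) u"

lemma coord_metric_has_derivative:
  assumes c: "c \<in> max_atlas A" "x \<in> crange c"
    and f: "(f has_derivative f') (at x)" and h: "(h has_derivative h') (at x)"
  shows "((\<lambda>y. coord_metric A g c y (f y) (h y)) has_derivative
    (\<lambda>v. dmetric c x v (f x) (h x) + coord_metric A g c x (f' v) (h x) + coord_metric A g c x (f x) (h' v))) (at x)"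
  by (rule bilinear_family_has_derivative[OF open_crange[OF c(1)] c(2) inner_form_bilinear[OF form[OF c(1)]]
        metric_differentiable[OF c] f h])

lemma dmetric_linear:
  assumes c: "c \<in> max_atlas A" "x \<in> crange c"
  shows "linear (dmetric c x u v)" "linear (\<lambda>u. dmetric c x u v w)" "dmetric c x u v w = dmetric c x u w v"
proof -
  note d = metric_differentiable[OF c, unfolded frechet_derivative_works]
  have open_c: "open (crange c)" using open_crange c by blast
  have f: "inner_form (coord_metric A g c y)" if "y \<in> crange c" for y using form c that by blast
  show "linear (\<lambda>u. dmetric c x u v w)" using d has_derivative_linear by blast
  show "linear (dmetric c x u v)"
  proof (rule linearI)
    fix w w'
    show "dmetric c x u v (w + w') = dmetric c x u v w + dmetric c x u v w'"
      by (rule frechet_eqI, rule has_derivative_transform_within_open[OF has_derivative_add[OF d d] open_c c(2)])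
        (simp add: inner_form_simps[OF f])
  next
    fix r w
    show "dmetric c x u v (r *\<^sub>R w) = r *\<^sub>R dmetric c x u v w"
      unfolding real_scaleR_def
      by (rule frechet_eqI, rule has_derivative_transform_within_open[OF has_derivative_mult_right[OF d] open_c c(2)])
        (simp add: inner_form_simps[OF f])
  qed
  show "dmetric c x u v w = dmetric c x u w v"
    by (rule frechet_eqI, rule has_derivative_transform_within_open[OF d open_c c(2)])
      (simp add: inner_form_sym[OF f])
qed

lemma christoffel_koszul:
  "christoffel A g c x u v = (THE z. \<forall>w. 2 * coord_metric A g c x z w = dmetric c x u v w + dmetric c x v u w - dmetric c x w u v)"
  by (simp add: christoffel_def Let_def)

lemma christoffel_properties:
  assumes c: "c \<in> max_atlas A" "x \<in> crange c"
  shows christoffel_equation: "2 * coord_metric A g c x (christoffel A g c x u v) w = dmetric c x u v w + dmetric c x v u w - dmetric c x w u v"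
    and christoffel_bilinear: "bilinear (christoffel A g c x)"
    and christoffel_sym: "christoffel A g c x u v = christoffel A g c x v u"
    and christoffel_compat: "dmetric c x u v w =
      coord_metric A g c x (christoffel A g c x u v) w + coord_metric A g c x v (christoffel A g c x u w)"
proof -
  note sol = koszul_solution[where G = "coord_metric A g c x" and D = "dmetric c x" and K = "christoffel A g c x",
      OF form[OF c] dmetric_linear[OF c] christoffel_koszul]
  show "2 * coord_metric A g c x (christoffel A g c x u v) w = dmetric c x u v w + dmetric c x v u w - dmetric c x w u v"
    by (rule sol(1))
  show "bilinear (christoffel A g c x)" by (rule sol(2))
  show "christoffel A g c x u v = christoffel A g c x v u" by (rule sol(3))
  show "dmetric c x u v w =
      coord_metric A g c x (christoffel A g c x u v) w + coord_metric A g c x v (christoffel A g c x u w)"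
    by (rule sol(4))
qed

lemma christoffel_eqI:
  assumes c: "c \<in> max_atlas A" "x \<in> crange c" and "\<And>u v. B u v = B v u"
    and "\<And>u v w. dmetric c x u v w = coord_metric A g c x (B u v) w + coord_metric A g c x v (B u w)"
  shows "christoffel A g c x u v = B u v"
  unfolding christoffel_koszul by (rule koszul_unique[OF form[OF c]]) (use assms in auto)

text \<open>The transformation law of a connection. Carrying the connection of \<open>d\<close> back
  to \<open>c\<close> gives a symmetric bilinear map, since second derivatives commute, and it is
  compatible with the metric; by uniqueness it is the Christoffel symbol in
  \<open>c\<close>.\<close>

lemma christoffel_change:
  assumes c: "c \<in> charts_at A p" and d: "d \<in> charts_at A p"
  shows "jac c d (cmap c p) (christoffel A g c (cmap c p) u v) =
    christoffel A g d (cmap d p) (jac c d (cmap c p) u) (jac c d (cmap c p) v) + hess c d (cmap c p) u v"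
proof -
  have cm: "c \<in> max_atlas A" "d \<in> max_atlas A" "p \<in> cdom c" "p \<in> cdom d"
    using c d by (auto simp: charts_at_iff)
  let ?x = "cmap c p" and ?y = "cmap d p"
  let ?J = "jac c d ?x" and ?\<Gamma> = "christoffel A g d ?y"
  have x: "?x \<in> crange c" "?y \<in> crange d" "?x \<in> overlap c d" using cm by auto
  have JJ: "?J (jac d c ?y z) = z" for z using jac_inverse[OF d c] by simp
  \<comment> \<open>The formula to be proved, solved for the symbol in \<open>c\<close>.\<close>
  define B where "B u v = jac d c ?y (?\<Gamma> (?J u) (?J v) + hess c d ?x u v)" for u v
  have JB: "?J (B u v) = ?\<Gamma> (?J u) (?J v) + hess c d ?x u v" for u v by (simp add: B_def JJ)
  have change: "coord_metric A g c y v w = coord_metric A g d (transition c d y) (jac c d y v) (jac c d y w)"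
    if y: "y \<in> overlap c d" for y v w
  proof -
    obtain q where "q \<in> cdom c" "q \<in> cdom d" "y = cmap c q" using y by auto
    then show ?thesis using coord_metric_change[of c q d g v w] cm transition_cmap[of c A q d]
      by (simp add: charts_at_iff)
  qed
  have J: "(transition c d has_derivative ?J) (at ?x)" by (rule jac_has_derivative[OF c d])
  have T: "transition c d ?x = ?y" using transition_cmap cm by metis
  have G1: "((\<lambda>y. coord_metric A g d (transition c d y) a b) has_derivative (\<lambda>u. dmetric d ?y (?J u) a b)) (at ?x)" for a b
    using has_derivative_compose[OF J, of "\<lambda>y. coord_metric A g d y a b"] T
      metric_differentiable[OF cm(2) x(2), of a b] by (simp add: frechet_derivative_works)
  have bil: "bilinear (coord_metric A g d (transition c d y))" if "y \<in> overlap c d" for y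
    by (rule inner_form_bilinear[OF form[OF cm(2)]]) (use that cm in \<open>auto simp: transition_cmap[OF cm(1)]\<close>)
  have "dmetric c ?x u v w = coord_metric A g c ?x (B u v) w + coord_metric A g c ?x v (B u w)" for u v w
  proof -
    note der = bilinear_family_has_derivative[OF open_overlap[OF cm(1,2)] x(3) bil differentiableI[OF G1]
        jac_apply_has_derivative[OF c d, of v] jac_apply_has_derivative[OF c d, of w]]
    have "dmetric c ?x u v w =
      frechet_derivative (\<lambda>y. coord_metric A g d (transition c d y) (?J v) (?J w)) (at ?x) u +
      coord_metric A g d (transition c d ?x) (hess c d ?x u v) (?J w) +
      coord_metric A g d (transition c d ?x) (?J v) (hess c d ?x u w)"
      by (rule frechet_eqI, rule has_derivative_transform_within_open[OF der open_overlap[OF cm(1,2)] x(3)])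
        (assumption, erule change[symmetric])
    also have "\<dots> = dmetric d ?y (?J u) (?J v) (?J w) +
      coord_metric A g d ?y (hess c d ?x u v) (?J w) + coord_metric A g d ?y (?J v) (hess c d ?x u w)"
      by (simp add: frechet_eqI[OF G1] T)
    also have "\<dots> = coord_metric A g d ?y (?J (B u v)) (?J w) + coord_metric A g d ?y (?J v) (?J (B u w))"
      using christoffel_compat[OF cm(2) x(2), where u = "?J u" and v = "?J v" and w = "?J w"]
      by (simp add: JB inner_form_simps[OF form[OF cm(2) x(2)]])
    finally show ?thesis by (simp add: coord_metric_change[OF c d])
  qed
  moreover have "B u v = B v u" for u v
    using christoffel_sym[OF cm(2) x(2)] hess_sym[OF c d] by (simp add: B_def)
  ultimately have "christoffel A g c ?x u v = B u v" by (intro christoffel_eqI[OF cm(1) x(1)])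
  then show ?thesis by (simp add: JB)
qed

end

text \<open>Coefficients of the Sasaki metric are computed only in induced charts. This extends what
  is checked there to the maximal atlas, by the transformation rule for coefficients and the product
  rule.\<close>

lemma (in atlas) metric_atlasI:
  assumes cover: "\<And>p. p \<in> carrier_of A \<Longrightarrow> \<exists>c\<in>C. p \<in> cdom c" and C: "C \<subseteq> max_atlas A"
    and f: "\<And>c x. c \<in> C \<Longrightarrow> x \<in> crange c \<Longrightarrow> inner_form (coord_metric A g c x)"
    and diff: "\<And>c x u w. c \<in> C \<Longrightarrow> x \<in> crange c \<Longrightarrow> (\<lambda>y. coord_metric A g c y u w) differentiable (at x)"
  shows "metric_atlas A g"
proof
  fix d x assume d: "d \<in> max_atlas A" and "x \<in> crange d"
  then obtain p where p: "p \<in> cdom d" "x = cmap d p" by blast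
  obtain c where c: "c \<in> C" "p \<in> cdom c" using cover p max_atlas_carrier[OF d] by blast
  have cm: "c \<in> max_atlas A" and at: "c \<in> charts_at A p" "d \<in> charts_at A p"
    using c C d p by (auto simp: charts_at_iff)
  have x: "x \<in> overlap d c" "cmap c p \<in> crange c" using p c by auto
  note F = f[OF c(1) x(2)]
  have change: "coord_metric A g d y v w = coord_metric A g c (transition d c y) (jac d c y v) (jac d c y w)"
    if y: "y \<in> overlap d c" for y v w
  proof -
    obtain q where "q \<in> cdom d" "q \<in> cdom c" "y = cmap d q" using y by auto
    then show ?thesis using coord_metric_change[of d q c g v w] cm d transition_cmap[of d A q c]
      by (simp add: charts_at_iff)
  qed
  have T: "transition d c x = cmap c p" using transition_cmap[OF d p(1)] p by simp
  have J: "(transition d c has_derivative jac d c x) (at x)" using jac_has_derivative[OF at(2,1)] p by simp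
  have ch: "coord_metric A g d x u w = coord_metric A g c (cmap c p) (jac d c x u) (jac d c x w)" for u w
    using change[OF x(1)] T by simp
  note lin = has_derivative_linear[OF J]
  \<comment> \<open>Invertibility of the Jacobian preserves definiteness.\<close>
  have "jac d c x u \<noteq> 0" if "u \<noteq> 0" for u
    using jac_inverse[OF at(2,1), of u] linear_0[OF jac_linear[OF at]] that p by auto
  then show "inner_form (coord_metric A g d x)"
    unfolding inner_form_def bilinear_def ch
    using inner_form_pos[OF F] inner_form_sym[OF F]
    by (auto intro!: linearI simp: inner_form_simps[OF F] linear_add[OF lin] linear_scale[OF lin])
  have G1: "(\<lambda>y. coord_metric A g c (transition d c y) a b) differentiable (at x)" for a b
    using differentiable_chain_at[OF differentiableI[OF J], of "\<lambda>y. coord_metric A g c y a b"] diff[OF c(1) x(2), of a b] T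
    by (simp add: o_def)
  have bil: "bilinear (coord_metric A g c (transition d c y))" if "y \<in> overlap d c" for y
    by (rule inner_form_bilinear[OF f[OF c(1)]]) (use that in \<open>auto simp: transition_cmap[OF d]\<close>)
  fix u w
  have jd: "((\<lambda>y. jac d c y v) has_derivative (\<lambda>u. hess d c x u v)) (at x)" for v
    using jac_apply_has_derivative[OF at(2,1)] p by simp
  note der = bilinear_family_has_derivative[OF open_overlap[OF d cm] x(1) bil G1 jd[of u] jd[of w]]
  show "(\<lambda>y. coord_metric A g d y u w) differentiable (at x)"
    by (rule differentiableI, rule has_derivative_transform_within_open[OF der open_overlap[OF d cm] x(1)])
      (assumption, erule change[symmetric])
qed

locale riemannian_atlas = atlas A for A :: "('a, 'e::euclidean_space) chart set" +
  fixes g :: "('a, 'e) metric"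
  assumes riemannian: "riemannian_metric A g"

sublocale riemannian_atlas \<subseteq> metric_atlas
proof
  fix c x assume c: "c \<in> max_atlas A" "x \<in> crange c"
  then show "inner_form (coord_metric A g c x)"
    using riemannian unfolding riemannian_metric_def inner_form_def by blast
  show "(\<lambda>y. coord_metric A g c y u w) differentiable (at x)" for u w
    by (rule smooth_on_differentiable[OF _ c(2)]) (use riemannian c in \<open>unfold riemannian_metric_def, blast\<close>)
qed

text \<open>The Koszul equation is a linear system whose matrix is the metric and whose right-hand
  side consists of first derivatives of the metric, both differentiable since g is smooth.\<close>

lemma (in riemannian_atlas) christoffel_differentiable:
  assumes c: "c \<in> max_atlas A" "x \<in> crange c"
  shows "(\<lambda>y. christoffel A g c y u v) differentiable (at x)"
proof (rule differentiable_linear_solution[OF open_crange[OF c(1)] c(2) form[OF c(1)] metric_differentiable[OF c]])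
  let ?\<alpha> = "\<lambda>y w. (dmetric c y u v w + dmetric c y v u w - dmetric c y w u v) / 2"
  show "linear (?\<alpha> y)" if "y \<in> crange c" for y
    by (rule linearI)
      (simp_all add: linear_add[OF dmetric_linear(1)[OF c(1) that]] linear_add[OF dmetric_linear(2)[OF c(1) that]]
        linear_scale[OF dmetric_linear(1)[OF c(1) that]] linear_scale[OF dmetric_linear(2)[OF c(1) that]] field_simps)
  have "(\<lambda>y. dmetric c y u v w) differentiable (at x)" for u v w
    using riemannian c by (intro smooth_on_differentiable[OF smooth_on_frechet]) (auto simp: riemannian_metric_def)
  then show "(\<lambda>y. ?\<alpha> y w) differentiable (at x)" for w by (intro differentiable_add differentiable_diff differentiable_divide) auto
  show "coord_metric A g c y (christoffel A g c y u v) w = ?\<alpha> y w" if "y \<in> crange c" for y w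
    using christoffel_equation[OF c(1) that, of u v w] by simp
qed

subsection \<open>The tangent bundle\<close>

context atlas
begin

lemma mem_cdom_tangent_chart: "q \<in> cdom (tangent_chart A c) \<longleftrightarrow> fst q \<in> cdom c \<and> snd q \<in> tspace A (fst q)"
  by (cases q) (simp add: tangent_chart_def)

lemma cmap_tangent_chart: "cmap (tangent_chart A c) q = (cmap c (fst q), snd q c)"
  by (cases q) (simp add: tangent_chart_def)

lemma inj_tangent_chart:
  assumes c: "c \<in> max_atlas A"
  shows "inj_on (cmap (tangent_chart A c)) (cdom (tangent_chart A c))"
proof (rule inj_onI)
  fix q q' assume *: "q \<in> cdom (tangent_chart A c)" "q' \<in> cdom (tangent_chart A c)"
    "cmap (tangent_chart A c) q = cmap (tangent_chart A c) q'"
  then have 1: "fst q = fst q'" "snd q c = snd q' c"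
    using cmap_eq_iff[OF c] by (auto simp: mem_cdom_tangent_chart cmap_tangent_chart)
  have "snd q = snd q'"
    by (rule tspace_ext[of _ "fst q" _ c]) (use * 1 c in \<open>auto simp: mem_cdom_tangent_chart charts_at_iff\<close>)
  with 1 show "q = q'" by (simp add: prod_eq_iff)
qed

lemma tangent_point_mem:
  "c \<in> charts_at A p \<Longrightarrow> (p, tvec_at A c p u) \<in> cdom (tangent_chart A c)"
  by (simp add: mem_cdom_tangent_chart tvec_at_tspace charts_at_iff)

lemma overlap_tangent_chart:
  assumes "c \<in> max_atlas A" "d \<in> max_atlas A"
  shows "overlap (tangent_chart A c) (tangent_chart A d) = overlap c d \<times> UNIV"
proof (intro equalityI subsetI)
  fix y :: "'e \<times> 'e" assume "y \<in> overlap c d \<times> UNIV"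
  then obtain p where p: "p \<in> cdom c" "p \<in> cdom d" "fst y = cmap c p" by auto
  have c: "c \<in> charts_at A p" using p assms by (simp add: charts_at_iff)
  have "y = cmap (tangent_chart A c) (p, tvec_at A c p (snd y))"
    using p c by (simp add: cmap_tangent_chart prod_eq_iff)
  moreover have "(p, tvec_at A c p (snd y)) \<in> cdom (tangent_chart A c) \<inter> cdom (tangent_chart A d)"
    using p tvec_at_tspace[OF c] by (simp add: mem_cdom_tangent_chart)
  ultimately show "y \<in> overlap (tangent_chart A c) (tangent_chart A d)" by blast
qed (auto simp: mem_cdom_tangent_chart cmap_tangent_chart)

lemma crange_tangent_chart: "c \<in> max_atlas A \<Longrightarrow> crange (tangent_chart A c) = crange c \<times> UNIV"
  using overlap_tangent_chart[of c c] by simp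

lemma cinv_tangent_chart:
  assumes c: "c \<in> charts_at A p"
  shows "cinv (tangent_chart A c) (cmap c p, u) = (p, tvec_at A c p u)"
proof -
  have "(cmap c p, u) = cmap (tangent_chart A c) (p, tvec_at A c p u)"
    using c by (simp add: cmap_tangent_chart)
  then show ?thesis
    using cinv_cmap[OF inj_tangent_chart tangent_point_mem[OF c, of u]] c by (simp add: charts_at_iff)
qed

lemma transition_tangent_chart:
  assumes "c \<in> max_atlas A" "d \<in> max_atlas A" "x \<in> overlap c d"
  shows "transition (tangent_chart A c) (tangent_chart A d) (x, u) = (transition c d x, jac c d x u)"
proof -
  obtain p where p: "p \<in> cdom c" "p \<in> cdom d" "x = cmap c p" using assms by blast
  have "c \<in> charts_at A p" "d \<in> charts_at A p" using p assms by (auto simp: charts_at_iff)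
  then show ?thesis
    using p assms by (simp add: transition_def[of "tangent_chart A c"] cinv_tangent_chart cmap_tangent_chart tvec_at_apply
        transition_cmap)
qed

lemma smooth_transition_tangent_chart:
  assumes c: "c \<in> max_atlas A" and d: "d \<in> max_atlas A"
  shows "smooth_on (overlap c d \<times> UNIV) (transition (tangent_chart A c) (tangent_chart A d))"
proof (rule smooth_on_cong)
  have o: "open (overlap c d \<times> (UNIV :: 'e set))" by (intro open_Times open_overlap c d open_UNIV)
  then show "open (overlap c d \<times> (UNIV :: 'e set))" .
  show "smooth_on (overlap c d \<times> (UNIV :: 'e set)) (\<lambda>y. (transition c d (fst y), jac c d (fst y) (snd y)))"
  proof (rule smooth_on_Pair[OF o])
    show "smooth_on (overlap c d \<times> (UNIV :: 'e set)) (\<lambda>y. transition c d (fst y))"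
      by (rule smooth_on_compose[OF o open_overlap[OF c d] _ smooth_transition[OF c d] smooth_on_fst]) auto
    show "smooth_on (overlap c d \<times> (UNIV :: 'e set)) (\<lambda>y. jac c d (fst y) (snd y))"
      by (rule smooth_on_frechet_apply[OF open_overlap[OF c d] o smooth_transition[OF c d] smooth_on_fst _ smooth_on_snd]) auto
  qed
qed (use transition_tangent_chart[OF c d] in auto)

lemma smooth_tangent_atlas: "smooth_atlas (tangent_atlas A)"
proof -
  have "compatible (tangent_chart A c) (tangent_chart A d)" if c: "c \<in> max_atlas A" and d: "d \<in> max_atlas A" for c d
    using overlap_tangent_chart[OF c d] overlap_tangent_chart[OF d c] open_overlap[OF c d] open_overlap[OF d c]
      smooth_transition_tangent_chart[OF c d] smooth_transition_tangent_chart[OF d c]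
    by (simp add: compatible_def Int_commute open_Times)
  then show ?thesis using inj_tangent_chart by (auto simp: smooth_atlas_def tangent_atlas_def)
qed

interpretation T: atlas "tangent_atlas A"
  by (rule atlas.intro[OF smooth_tangent_atlas])

lemma tangent_chart_max: "c \<in> max_atlas A \<Longrightarrow> tangent_chart A c \<in> max_atlas (tangent_atlas A)"
  using T.atlas_subset_max by (auto simp: tangent_atlas_def)

lemma carrier_tangent_atlas: "q \<in> carrier_of (tangent_atlas A) \<longleftrightarrow> (\<exists>c\<in>charts_at A (fst q). q \<in> cdom (tangent_chart A c))"
  unfolding carrier_of_def tangent_atlas_def
  by (simp add: charts_at_iff mem_cdom_tangent_chart) force

lemma tangent_chart_charts_at:
  "c \<in> charts_at A (fst q) \<Longrightarrow> snd q \<in> tspace A (fst q) \<Longrightarrow> tangent_chart A c \<in> charts_at (tangent_atlas A) q"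
  by (simp add: charts_at_iff tangent_chart_max mem_cdom_tangent_chart)

lemma charts_at_tangent_tspace:
  assumes "d \<in> charts_at (tangent_atlas A) q"
  shows "snd q \<in> tspace A (fst q)"
proof -
  have "q \<in> carrier_of (tangent_atlas A)"
    using assms max_atlas_carrier[of d "tangent_atlas A"] by (auto simp: charts_at_iff)
  then show ?thesis by (auto simp: carrier_tangent_atlas mem_cdom_tangent_chart)
qed

text \<open>A smooth extension of \<open>Y\<close> need not be a section of the tangent bundle off \<open>S\<close>, hence only its
  vector components are kept.\<close>

lemma vector_field_along_components:
  assumes Y: "vector_field_along A S Y" and p: "p \<in> S" and c: "c \<in> charts_at A p"
  obtains \<eta> V where "open V" "cmap c p \<in> V" "V \<subseteq> crange c" "smooth_on V \<eta>"
    "\<And>q. q \<in> S \<Longrightarrow> q \<in> cdom c \<Longrightarrow> cmap c q \<in> V \<Longrightarrow> snd (Y q) c = \<eta> (cmap c q) \<and> snd (Y q) \<in> tspace A q"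
proof -
  have fstY: "fst (Y q) = q" if "q \<in> S" for q using Y that by (simp add: vector_field_along_def)
  obtain c0 d h where c0: "c0 \<in> charts_at A p" and d: "d \<in> charts_at (tangent_atlas A) (Y p)"
    and h: "h ` cdom c0 \<subseteq> cdom d" "\<And>q. q \<in> S \<Longrightarrow> q \<in> cdom c0 \<Longrightarrow> h q = Y q"
    and sm: "smooth_on (crange c0) (cmap d \<circ> h \<circ> cinv c0)"
    using Y p unfolding vector_field_along_def smooth_map_on_def by (metis IntI)
  let ?c = "tangent_chart A c"
  have cm: "c \<in> max_atlas A" "c0 \<in> max_atlas A" "d \<in> max_atlas (tangent_atlas A)" "?c \<in> max_atlas (tangent_atlas A)"
    "p \<in> cdom c" "p \<in> cdom c0" "Y p \<in> cdom d"
    using c c0 d by (auto simp: charts_at_iff tangent_chart_max)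
  have Yp: "Y p \<in> cdom ?c"
    using charts_at_tangent_tspace[OF d] fstY[OF p] cm by (simp add: mem_cdom_tangent_chart)
  define k where "k x = (cmap d \<circ> h \<circ> cinv c0) (transition c c0 x)" for x
  have k: "k (cmap c q) = cmap d (Y q)" if "q \<in> S" "q \<in> cdom c" "q \<in> cdom c0" for q
    using that cm h(2) by (simp add: k_def transition_cmap[OF cm(1)] max_atlas_cinv[OF cm(2)])
  have o: "open (overlap c c0)" using open_overlap cm by blast
  have ksm: "smooth_on (overlap c c0) k" unfolding k_def
    by (rule smooth_on_compose[OF o open_crange[OF cm(2)] _ sm smooth_transition[OF cm(1,2)]])
      (auto simp: transition_cmap[OF cm(1)])
  \<comment> \<open>The extension \<open>h\<close> may take values outside the domain of the induced
    chart; \<open>V\<close> excludes the points where it does.\<close>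
  define V where "V = overlap c c0 \<inter> k -` overlap d ?c"
  have oV: "open V" unfolding V_def
    by (intro continuous_open_preimage smooth_on_continuous_on ksm o T.open_overlap cm)
  have "smooth_on V (\<lambda>x. snd (transition d ?c (k x)))"
    by (intro smooth_on_linear_compose[OF bounded_linear_snd oV]
        smooth_on_compose[OF oV T.open_overlap[OF cm(3,4)] _ T.smooth_transition[OF cm(3,4)] smooth_on_subset[OF _ ksm]])
      (auto simp: V_def)
  moreover have "snd (Y q) c = snd (transition d ?c (k (cmap c q))) \<and> snd (Y q) \<in> tspace A q"
    if q: "q \<in> S" "q \<in> cdom c" "cmap c q \<in> V" for q
  proof -
    have q0: "q \<in> cdom c0" using q cmap_eq_iff[OF cm(1)] unfolding V_def by blast
    have kq: "k (cmap c q) = cmap d (Y q)" using k q q0 by blast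
    have Yd: "Y q \<in> cdom d" using h q q0 by (metis image_subset_iff)
    moreover have "cmap d (Y q) \<in> overlap d ?c" using q kq by (simp add: V_def)
    ultimately have "Y q \<in> cdom ?c" using cmap_eq_iff[OF cm(3)] by blast
    then show ?thesis
      using fstY[OF q(1)] Yd by (simp add: kq transition_cmap[OF cm(3)] cmap_tangent_chart mem_cdom_tangent_chart)
  qed
  moreover have "cmap c p \<in> V"
    unfolding V_def using cm Yp k[OF p] by auto
  ultimately show thesis using oV by (intro that[of V]) (auto simp: V_def)
qed

end

subsection \<open>Submanifolds and slice charts\<close>

text \<open>Difference quotients at 0 stay in \<open>L\<close>, which is closed.\<close>

lemma vector_derivative_in_subspace:
  fixes f :: "real \<Rightarrow> 'e::euclidean_space"
  assumes L: "subspace L" and f: "(f has_vector_derivative d) (at 0)" and ev: "\<forall>\<^sub>F t in nhds 0. f t \<in> L"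
  shows "d \<in> L"
proof (rule Lim_in_closed_set[OF closed_subspace[OF L]])
  have f0: "f 0 \<in> L" using ev by (rule eventually_nhds_x_imp_x)
  have "\<forall>\<^sub>F t in nhds 0. (f t - f 0) /\<^sub>R t \<in> L"
    using ev by eventually_elim (intro subspace_scale[OF L] subspace_diff[OF L] f0)
  then show "\<forall>\<^sub>F t in at 0. (f t - f 0) /\<^sub>R t \<in> L" by (simp add: eventually_at_filter eventually_mono)
  have "((\<lambda>t. norm (f t - f 0 - t *\<^sub>R d) / norm t) \<longlongrightarrow> 0) (at 0)"
    using f by (simp add: has_vector_derivative_def has_derivative_iff_norm)
  moreover have "norm (f t - f 0 - t *\<^sub>R d) / norm t = norm ((f t - f 0) /\<^sub>R t - d)" if "t \<noteq> 0" for t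
  proof -
    have "(f t - f 0) /\<^sub>R t - d = inverse t *\<^sub>R (f t - f 0 - t *\<^sub>R d)"
      using that by (simp add: scaleR_diff_right)
    then show ?thesis by (simp add: divide_inverse mult.commute)
  qed
  then have "\<forall>\<^sub>F t in at 0. norm (f t - f 0 - t *\<^sub>R d) / norm t = norm ((f t - f 0) /\<^sub>R t - d)"
    by (simp add: eventually_at_filter)
  ultimately have "((\<lambda>t. norm ((f t - f 0) /\<^sub>R t - d)) \<longlongrightarrow> 0) (at 0)"
    by (rule Lim_transform_eventually)
  then have "((\<lambda>t. (f t - f 0) /\<^sub>R t - d) \<longlongrightarrow> 0) (at 0)" by (rule tendsto_norm_zero_cancel)
  then show "((\<lambda>t. (f t - f 0) /\<^sub>R t) \<longlongrightarrow> d) (at 0)" by (rule LIM_zero_cancel)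
qed simp

text \<open>Only the line through \<open>x\<close> in direction \<open>u\<close> matters, and it
  stays in \<open>L\<close>. With \<open>M = {0}\<close> this says that a map vanishing on the slice
  has vanishing derivative along it.\<close>

lemma derivative_along_subspace:
  fixes f :: "'d::euclidean_space \<Rightarrow> 'e::euclidean_space"
  assumes L: "subspace L" and M: "subspace M" and U: "open U" "x \<in> U" "x \<in> L"
    and f: "(f has_derivative f') (at x)" and fM: "\<And>y. y \<in> U \<Longrightarrow> y \<in> L \<Longrightarrow> f y \<in> M" and u: "u \<in> L"
  shows "f' u \<in> M"
proof (rule vector_derivative_in_subspace[OF M])
  have "((\<lambda>t. x + t *\<^sub>R u) has_derivative (\<lambda>r. r *\<^sub>R u)) (at 0)"
    by (auto intro!: derivative_eq_intros)
  then have "((\<lambda>t. f (x + t *\<^sub>R u)) has_derivative (\<lambda>r. f' (r *\<^sub>R u))) (at 0)"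
    by (rule has_derivative_compose) (simp add: f)
  then show "((\<lambda>t. f (x + t *\<^sub>R u)) has_vector_derivative f' u) (at 0)"
    by (simp add: has_vector_derivative_def linear_scale[OF has_derivative_linear[OF f]])
  have "((\<lambda>t. x + t *\<^sub>R u) \<longlongrightarrow> x + 0 *\<^sub>R u) (nhds 0)"
    by (intro tendsto_intros filterlim_ident)
  from topological_tendstoD[OF this U(1)] have "\<forall>\<^sub>F t in nhds 0. x + t *\<^sub>R u \<in> U" using U by simp
  then show "\<forall>\<^sub>F t in nhds 0. f (x + t *\<^sub>R u) \<in> M"
    by eventually_elim (intro fM subspace_add[OF L] subspace_scale[OF L] U u; simp)
qed

context atlas
begin

definition slice_chart :: "'a set \<Rightarrow> ('a, 'e) chart \<Rightarrow> 'e set \<Rightarrow> bool" where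
  "slice_chart S c L \<longleftrightarrow> c \<in> max_atlas A \<and> subspace L \<and> cmap c ` (cdom c \<inter> S) = crange c \<inter> L"

lemma slice_chart_max: "slice_chart S c L \<Longrightarrow> c \<in> max_atlas A"
  and slice_chart_subspace: "slice_chart S c L \<Longrightarrow> subspace L"
  by (auto simp: slice_chart_def)

lemma slice_chart_mem:
  assumes "slice_chart S c L" "p \<in> cdom c"
  shows "p \<in> S \<longleftrightarrow> cmap c p \<in> L"
proof
  assume "cmap c p \<in> L"
  then have "cmap c p \<in> cmap c ` (cdom c \<inter> S)" using assms by (auto simp: slice_chart_def)
  then show "p \<in> S" using cmap_eq_iff[OF slice_chart_max[OF assms(1)]] assms(2) by blast
next
  assume "p \<in> S"
  then have "cmap c p \<in> cmap c ` (cdom c \<inter> S)" using assms by blast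
  then show "cmap c p \<in> L" using assms(1) by (auto simp: slice_chart_def)
qed

lemma slice_chart_iff:
  assumes "c \<in> max_atlas A" "subspace L"
  shows "slice_chart S c L \<longleftrightarrow> (\<forall>p\<in>cdom c. p \<in> S \<longleftrightarrow> cmap c p \<in> L)"
proof
  assume "\<forall>p\<in>cdom c. p \<in> S \<longleftrightarrow> cmap c p \<in> L"
  then have "cmap c ` (cdom c \<inter> S) = crange c \<inter> L" by blast
  then show "slice_chart S c L" using assms by (simp add: slice_chart_def)
qed (use slice_chart_mem in blast)

lemma submanifold_iff:
  "submanifold A S l \<longleftrightarrow> S \<subseteq> carrier_of A \<and> (\<forall>p\<in>S. \<exists>c L. slice_chart S c L \<and> p \<in> cdom c \<and> dim L = l)"
  unfolding submanifold_def slice_chart_def Bex_def charts_at_iff by blast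

text \<open>A straight line in slice coordinates realises each direction in \<open>L\<close>. The
  open set \<open>W\<close> is carried along because \<open>totally_geodesic\<close> tests fields
  defined on \<open>S \<inter> W\<close>.\<close>

lemma slice_curve:
  assumes sc: "slice_chart S c L" and W: "openin (mtopology A) W" and p: "p \<in> S \<inter> W" "p \<in> cdom c" and u: "u \<in> L"
  shows "curve_with_velocity A (S \<inter> W) p (tvec_at A c p u) (\<lambda>t. cinv c (cmap c p + t *\<^sub>R u))"
  unfolding curve_with_velocity_def
proof (intro conjI ballI)
  note c = slice_chart_max[OF sc]
  have c_at: "c \<in> charts_at A p" using c p by (simp add: charts_at_iff)
  show "cinv c (cmap c p + 0 *\<^sub>R u) = p" using max_atlas_cinv[OF c p(2)] by simp
  fix d assume d: "d \<in> charts_at A p"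
  have "openin (mtopology A) (W \<inter> cdom d)" using d by (intro openin_Int W openin_cdom) (simp add: charts_at_iff)
  then have o: "open (cmap c ` (cdom c \<inter> (W \<inter> cdom d)))" using c by (simp add: openin_mtopology_iff)
  have "cmap c p + 0 *\<^sub>R u \<in> cmap c ` (cdom c \<inter> (W \<inter> cdom d))" using p d by (auto simp: charts_at_iff)
  moreover have "((\<lambda>t. cmap c p + t *\<^sub>R u) \<longlongrightarrow> cmap c p + 0 *\<^sub>R u) (nhds 0)"
    by (intro tendsto_intros filterlim_ident)
  ultimately have "\<forall>\<^sub>F t in nhds 0. cmap c p + t *\<^sub>R u \<in> cmap c ` (cdom c \<inter> (W \<inter> cdom d))"
    using topological_tendstoD[OF _ o] by blast
  then show "\<forall>\<^sub>F t in nhds 0. cinv c (cmap c p + t *\<^sub>R u) \<in> S \<inter> W \<inter> cdom d"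
  proof eventually_elim
    case (elim t)
    then obtain q where q: "q \<in> cdom c" "q \<in> W" "q \<in> cdom d" "cmap c p + t *\<^sub>R u = cmap c q" by blast
    have "cmap c p \<in> L" using slice_chart_mem[OF sc p(2)] p(1) by simp
    then have "cmap c q \<in> L"
      using u slice_chart_subspace[OF sc] unfolding q(4)[symmetric] by (intro subspace_add subspace_scale)
    then have "q \<in> S" using slice_chart_mem[OF sc q(1)] by simp
    then show ?case using q max_atlas_cinv[OF c q(1)] by simp
  qed
  have "((\<lambda>t. cmap c p + t *\<^sub>R u) has_derivative (\<lambda>r. r *\<^sub>R u)) (at 0)"
    by (auto intro!: derivative_eq_intros)
  then have "((\<lambda>t. transition c d (cmap c p + t *\<^sub>R u)) has_derivative (\<lambda>r. jac c d (cmap c p) (r *\<^sub>R u))) (at 0)"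
    by (rule has_derivative_compose) (simp add: jac_has_derivative[OF c_at d])
  then show "(cmap d \<circ> (\<lambda>t. cinv c (cmap c p + t *\<^sub>R u)) has_vector_derivative tvec_at A c p u d) (at 0)"
    using linear_scale[OF jac_linear[OF c_at d]]
    by (simp add: has_vector_derivative_def tvec_at_apply[OF d] transition_def o_def)
qed

lemma sub_tspace_slice:
  assumes sc: "slice_chart S c L" and W: "openin (mtopology A) W" and p: "p \<in> S \<inter> W" "p \<in> cdom c"
  shows "sub_tspace A (S \<inter> W) p = tvec_at A c p ` L"
proof (intro equalityI subsetI)
  have c_at: "c \<in> charts_at A p" using slice_chart_max[OF sc] p by (simp add: charts_at_iff)
  fix v
  {
    assume "v \<in> tvec_at A c p ` L"
    then obtain u where "u \<in> L" "v = tvec_at A c p u" by blast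
    with slice_curve[OF sc W p] tvec_at_tspace[OF c_at] show "v \<in> sub_tspace A (S \<inter> W) p"
      by (auto simp: sub_tspace_def)
  next
    assume v: "v \<in> sub_tspace A (S \<inter> W) p"
    then obtain \<gamma> where \<gamma>: "v \<in> tspace A p" "curve_with_velocity A (S \<inter> W) p v \<gamma>" by (auto simp: sub_tspace_def)
    then have ev: "\<forall>\<^sub>F t in nhds 0. \<gamma> t \<in> S \<inter> W \<inter> cdom c" and der: "(cmap c \<circ> \<gamma> has_vector_derivative v c) (at 0)"
      using c_at by (auto simp: curve_with_velocity_def)
    have "\<forall>\<^sub>F t in nhds 0. (cmap c \<circ> \<gamma>) t \<in> L"
      using ev by eventually_elim (use slice_chart_mem[OF sc] in auto)
    then have "v c \<in> L" by (rule vector_derivative_in_subspace[OF slice_chart_subspace[OF sc] der])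
    then show "v \<in> tvec_at A c p ` L" using tvec_at_eq[OF \<gamma>(1) c_at] by (metis imageI)
  }
qed

end

section \<open>Covariant derivative and second fundamental form in slice charts\<close>

context metric_atlas
begin

lemma metric_tvec_at:
  assumes "c \<in> charts_at A p" "v \<in> tspace A p" "w \<in> tspace A p"
  shows "g p v w = coord_metric A g c (cmap c p) (v c) (w c)"
  by (simp add: coord_metric_cmap tvec_at_eq assms)

text \<open>\<open>cov_deriv\<close> is given by components in every chart along a chosen curve.
  Evaluating it in one chart \<open>c\<close> suffices: in another chart \<open>d\<close>,
  differentiating the Jacobian along the curve produces exactly the Hessian term of
  \<open>christoffel_change\<close>. The result also shows independence of the curve.\<close>

lemma cov_deriv_eq:
  assumes c: "c \<in> charts_at A p" and p: "p \<in> S" and v: "v \<in> sub_tspace A S p"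
    and V: "open V" "cmap c p \<in> V" and \<eta>: "(\<eta> has_derivative \<eta>') (at (cmap c p))"
    and Y: "\<And>q. q \<in> S \<Longrightarrow> q \<in> cdom c \<Longrightarrow> cmap c q \<in> V \<Longrightarrow> snd (Y q) c = \<eta> (cmap c q) \<and> snd (Y q) \<in> tspace A q"
  shows "cov_deriv A g S Y p v =
    tvec_at A c p (\<eta>' (v c) + christoffel A g c (cmap c p) (v c) (\<eta> (cmap c p)))"
proof
  fix d
  define \<gamma> where "\<gamma> = (SOME \<gamma>. curve_with_velocity A S p v \<gamma>)"
  let ?x = "cmap c p"
  have \<gamma>: "curve_with_velocity A S p v \<gamma>" and vt: "v \<in> tspace A p"
    using v someI_ex[of "curve_with_velocity A S p v"] unfolding \<gamma>_def sub_tspace_def by blast+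
  have \<gamma>0: "\<gamma> 0 = p" using \<gamma> by (simp add: curve_with_velocity_def)
  have cm: "c \<in> max_atlas A" "p \<in> cdom c" using c by (auto simp: charts_at_iff)
  have Yp: "snd (Y p) c = \<eta> ?x" "snd (Y p) \<in> tspace A p" using Y p cm V by auto
  show "cov_deriv A g S Y p v d = tvec_at A c p (\<eta>' (v c) + christoffel A g c ?x (v c) (\<eta> ?x)) d"
  proof (cases "d \<in> charts_at A p")
    case False
    then show ?thesis by (simp add: cov_deriv_def Let_def tvec_at_def)
  next
    case d: True
    have dm: "d \<in> max_atlas A" "p \<in> cdom d" using d by (auto simp: charts_at_iff)
    have ev: "\<forall>\<^sub>F t in nhds 0. \<gamma> t \<in> S \<inter> cdom c" "\<forall>\<^sub>F t in nhds 0. \<gamma> t \<in> S \<inter> cdom d"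
      and der: "(cmap c \<circ> \<gamma> has_derivative (\<lambda>r. r *\<^sub>R v c)) (at 0)"
      using c d \<gamma> by (auto simp: curve_with_velocity_def has_vector_derivative_def)
    have "((cmap c \<circ> \<gamma>) \<longlongrightarrow> ?x) (nhds 0)"
      using has_derivative_continuous[OF der] \<gamma>0 tendsto_at_iff_tendsto_nhds[of "cmap c \<circ> \<gamma>" 0]
      by (simp add: continuous_within)
    then have evV: "\<forall>\<^sub>F t in nhds 0. (cmap c \<circ> \<gamma>) t \<in> V" using topological_tendstoD V by blast
    have lin: "linear (jac c d y)" if "y \<in> overlap c d" for y
      using smooth_on_has_derivative[OF smooth_transition[OF cm(1) dm(1)] that] has_derivative_linear by blast
    \<comment> \<open>The components of the field in \<open>d\<close> are
      \<open>jac c d y (\<eta> y)\<close>; the product rule separates the Hessian term from the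
      derivative of \<open>\<eta>\<close>.\<close>
    have "((\<lambda>y. jac c d y (\<eta> y)) has_derivative (\<lambda>w. hess c d ?x w (\<eta> ?x) + jac c d ?x (\<eta>' w))) (at ?x)"
      by (rule linear_family_has_derivative[where S = "overlap c d" and T = "jac c d", OF open_overlap[OF cm(1) dm(1)] _ lin _ \<eta>])
        (use jac_apply_has_derivative[OF c d] cm dm in \<open>auto simp: differentiable_def\<close>)
    then have "((\<lambda>t. jac c d ((cmap c \<circ> \<gamma>) t) (\<eta> ((cmap c \<circ> \<gamma>) t))) has_derivative
       (\<lambda>r. hess c d ?x (r *\<^sub>R v c) (\<eta> ?x) + jac c d ?x (\<eta>' (r *\<^sub>R v c)))) (at 0)"
      by (intro has_derivative_compose[OF der]) (simp add: \<gamma>0)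
    then have "((\<lambda>t. jac c d (cmap c (\<gamma> t)) (\<eta> (cmap c (\<gamma> t)))) has_vector_derivative
       (hess c d ?x (v c) (\<eta> ?x) + jac c d ?x (\<eta>' (v c)))) (at 0)"
      unfolding has_vector_derivative_def
      using linear_scale[OF has_derivative_linear[OF jac_apply_has_derivative[OF c d, of "\<eta> ?x"]]]
        linear_scale[OF jac_linear[OF c d]] linear_scale[OF has_derivative_linear[OF \<eta>]]
      by (simp add: scaleR_add_right)
    note dJ = this
    have evY: "\<forall>\<^sub>F t in nhds 0. snd (Y (\<gamma> t)) d = jac c d (cmap c (\<gamma> t)) (\<eta> (cmap c (\<gamma> t)))"
      using ev evV
    proof eventually_elim
      case (elim t)
      then have "snd (Y (\<gamma> t)) c = \<eta> (cmap c (\<gamma> t))" "snd (Y (\<gamma> t)) \<in> tspace A (\<gamma> t)" using Y by auto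
      moreover have "c \<in> charts_at A (\<gamma> t)" "d \<in> charts_at A (\<gamma> t)" using elim cm dm by (auto simp: charts_at_iff)
      ultimately show ?case using tspace_apply by metis
    qed
    from evY have "\<forall>\<^sub>F t in nhds 0. t \<in> UNIV \<longrightarrow> snd (Y (\<gamma> t)) d = jac c d (cmap c (\<gamma> t)) (\<eta> (cmap c (\<gamma> t)))"
      by simp
    from has_vector_derivative_cong_ev[OF this eventually_nhds_x_imp_x[OF evY]] dJ
    have "((\<lambda>t. snd (Y (\<gamma> t)) d) has_vector_derivative
       (hess c d ?x (v c) (\<eta> ?x) + jac c d ?x (\<eta>' (v c)))) (at 0)"
      by simp
    then have "vector_derivative (\<lambda>t. snd (Y (\<gamma> t)) d) (at 0) = hess c d ?x (v c) (\<eta> ?x) + jac c d ?x (\<eta>' (v c))"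
      by (rule vector_derivative_at)
    moreover have "v d = jac c d ?x (v c)" by (rule tspace_apply[OF vt c d])
    moreover have "snd (Y p) d = jac c d ?x (\<eta> ?x)" using tspace_apply[OF Yp(2) c d] Yp(1) by simp
    ultimately show ?thesis
      using christoffel_change[OF c d, of "v c" "\<eta> ?x"] d
      by (simp add: cov_deriv_def Let_def \<gamma>_def[symmetric] tvec_at_apply linear_add[OF jac_linear[OF c d]])
  qed
qed

text \<open>Orthogonal projection onto \<open>L\<close> provides the unique vector described by
  \<open>normal_part\<close>.\<close>

lemma normal_part_eq_0_iff:
  assumes sc: "slice_chart S c L" and W: "openin (mtopology A) W" and p: "p \<in> S \<inter> W" "p \<in> cdom c"
  shows "normal_part A g (S \<inter> W) p (tvec_at A c p w) = (\<lambda>c. 0) \<longleftrightarrow> w \<in> L"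
proof -
  have c: "c \<in> charts_at A p" using slice_chart_max[OF sc] p by (simp add: charts_at_iff)
  let ?x = "cmap c p"
  have G: "inner_form (coord_metric A g c ?x)" using c by (intro form) (auto simp: charts_at_iff)
  note L = slice_chart_subspace[OF sc]
  obtain l where l: "l \<in> L" "\<And>m. m \<in> L \<Longrightarrow> coord_metric A g c ?x (w - l) m = 0"
    using inner_form_projection[OF G L, of w] by blast
  have ortho: "(\<forall>u\<in>sub_tspace A (S \<inter> W) p. g p z u = 0) \<longleftrightarrow> (\<forall>m\<in>L. coord_metric A g c ?x (z c) m = 0)"
    if "z \<in> tspace A p" for z
    unfolding sub_tspace_slice[OF sc W p] using that c
    by (simp add: metric_tvec_at[OF c] tvec_at_tspace)
  have tang: "(\<lambda>d. tvec_at A c p w d - z d) \<in> sub_tspace A (S \<inter> W) p \<longleftrightarrow> w - z c \<in> L" if "z \<in> tspace A p" for z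
  proof -
    have "(\<lambda>d. tvec_at A c p w d - z d) = tvec_at A c p (w - z c)"
      using tvec_at_diff[OF c, of w "z c"] tvec_at_eq[OF that c] by simp
    then show ?thesis unfolding sub_tspace_slice[OF sc W p] using tvec_at_same[OF c] by (metis image_iff)
  qed
  have "normal_part A g (S \<inter> W) p (tvec_at A c p w) = tvec_at A c p (w - l)"
    unfolding normal_part_def
  proof (rule the_equality, goal_cases)
    case 1
    then show ?case using l ortho[OF tvec_at_tspace[OF c]] tang[OF tvec_at_tspace[OF c]] tvec_at_tspace[OF c] c by simp
  next
    case (2 z)
    then have z: "z \<in> tspace A p" "\<And>m. m \<in> L \<Longrightarrow> coord_metric A g c ?x (z c) m = 0" "w - z c \<in> L"
      using ortho tang by blast+
    \<comment> \<open>Two candidates for the normal part differ by a vector that lies in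
      \<open>L\<close> and is orthogonal to \<open>L\<close>.\<close>
    have m: "z c - (w - l) \<in> L" using subspace_diff[OF L l(1) z(3)] by (simp add: algebra_simps)
    have "coord_metric A g c ?x (z c - (w - l)) (z c - (w - l)) = 0"
      using z(2)[OF m] l(2)[OF m] by (subst inner_form_simps(3)[OF G]) simp
    then have "z c = w - l" using inner_form_eq_0[OF G] by simp
    then show ?case using tvec_at_eq[OF z(1) c] by simp
  qed
  moreover have "tvec_at A c p (w - l) = (\<lambda>c. 0) \<longleftrightarrow> w = l"
    using tvec_at_zero[OF c] tvec_at_same[OF c, of "w - l"] by auto
  moreover have "w = l \<longleftrightarrow> w \<in> L"
  proof
    assume "w \<in> L"
    then have "w - l \<in> L" using l L by (intro subspace_diff)
    then show "w = l" using l(2) inner_form_eq_0[OF G] by fastforce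
  qed (use l in simp)
  ultimately show ?thesis by simp
qed

definition slice_geodesic :: "('a, 'e) chart \<Rightarrow> 'e set \<Rightarrow> bool" where
  "slice_geodesic c L \<longleftrightarrow> (\<forall>x\<in>crange c \<inter> L. \<forall>u\<in>L. \<forall>v\<in>L. christoffel A g c x u v \<in> L)"

text \<open>The test field has constant components \<open>u\<close> on the chart domain, which
  serves as the open set \<open>W\<close>. It is tangent along the slice, and its covariant
  derivative along \<open>v\<close> is the Christoffel term alone.\<close>

lemma totally_geodesic_slice:
  assumes tg: "totally_geodesic A g S l" and sc: "slice_chart S c L"
  shows "slice_geodesic c L"
  unfolding slice_geodesic_def
proof (intro ballI)
  note c = slice_chart_max[OF sc]
  fix x v u assume x: "x \<in> crange c \<inter> L" and v: "v \<in> L" and u: "u \<in> L"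
  then obtain p where p: "p \<in> cdom c" "x = cmap c p" by blast
  have pS: "p \<in> S \<inter> cdom c" using slice_chart_mem[OF sc p(1)] x p by simp
  note W = openin_cdom[OF c]
  define Y where "Y q = (q, tvec_at A c q u)" for q
  have at: "c \<in> charts_at A q" if "q \<in> cdom c" for q using c that by (simp add: charts_at_iff)
  have "smooth_map_on A (tangent_atlas A) (S \<inter> cdom c) Y"
    unfolding smooth_map_on_def
  proof (intro ballI bexI exI[of _ Y] conjI)
    fix q assume q: "q \<in> S \<inter> cdom c"
    show "c \<in> charts_at A q" using at q by simp
    show "tangent_chart A c \<in> charts_at (tangent_atlas A) (Y q)"
      using q by (auto intro!: tangent_chart_charts_at simp: Y_def at tvec_at_tspace)
    show "Y ` cdom c \<subseteq> cdom (tangent_chart A c)" using tangent_point_mem[OF at] by (auto simp: Y_def)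
    show "smooth_on (crange c) (cmap (tangent_chart A c) \<circ> Y \<circ> cinv c)"
      by (rule smooth_on_cong[OF open_crange[OF c] _ smooth_on_Pair[OF open_crange[OF c] smooth_on_id smooth_on_const[of _ u]]])
        (auto simp: Y_def cmap_tangent_chart max_atlas_cinv[OF c] at)
  qed simp
  then have tf: "tangent_field_along A (S \<inter> cdom c) Y"
    using sub_tspace_slice[OF sc W] u by (auto simp: tangent_field_along_def vector_field_along_def Y_def)
  have vs: "tvec_at A c p v \<in> sub_tspace A (S \<inter> cdom c) p"
    using sub_tspace_slice[OF sc W pS p(1)] v by blast
  have "cov_deriv A g (S \<inter> cdom c) Y p (tvec_at A c p v) =
      tvec_at A c p (0 + christoffel A g c (cmap c p) (tvec_at A c p v c) u)"
    by (rule cov_deriv_eq[OF at[OF p(1)] pS vs open_UNIV UNIV_I has_derivative_const])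
      (auto simp: Y_def at tvec_at_tspace)
  then have "cov_deriv A g (S \<inter> cdom c) Y p (tvec_at A c p v) = tvec_at A c p (christoffel A g c x v u)"
    by (simp add: p at)
  moreover have "second_fundamental_form A g (S \<inter> cdom c) p (tvec_at A c p v) Y = (\<lambda>c. 0)"
    using tg W tf pS vs by (simp add: totally_geodesic_def)
  ultimately show "christoffel A g c x v u \<in> L"
    by (simp add: second_fundamental_form_def normal_part_eq_0_iff[OF sc W pS p(1)])
qed

text \<open>The components of a tangent field lie in \<open>L\<close> along the slice, and so do
  their derivatives in directions of \<open>L\<close>; the Christoffel term is in \<open>L\<close>
  by assumption. One good slice chart around each point is enough.\<close>

lemma totally_geodesicI:
  assumes S: "submanifold A S l"
    and sl: "\<And>p. p \<in> S \<Longrightarrow> \<exists>c L. slice_chart S c L \<and> p \<in> cdom c \<and> slice_geodesic c L"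
  shows "totally_geodesic A g S l"
  unfolding totally_geodesic_def
proof (intro conjI S allI impI ballI)
  fix W Y p v
  assume asm: "openin (mtopology A) W \<and> tangent_field_along A (S \<inter> W) Y" and p: "p \<in> S \<inter> W"
    and v: "v \<in> sub_tspace A (S \<inter> W) p"
  from asm have W: "openin (mtopology A) W" and Y: "vector_field_along A (S \<inter> W) Y"
    and Yt: "\<And>q. q \<in> S \<inter> W \<Longrightarrow> snd (Y q) \<in> sub_tspace A (S \<inter> W) q"
    by (auto simp: tangent_field_along_def)
  obtain c L where sc: "slice_chart S c L" "p \<in> cdom c" "slice_geodesic c L" using sl p by blast
  have c: "c \<in> charts_at A p" "c \<in> max_atlas A" using sc slice_chart_max by (auto simp: charts_at_iff)
  note L = slice_chart_subspace[OF sc(1)]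
  obtain \<eta> V where \<eta>: "open V" "cmap c p \<in> V" "V \<subseteq> crange c" "smooth_on V \<eta>"
    "\<And>q. q \<in> S \<inter> W \<Longrightarrow> q \<in> cdom c \<Longrightarrow> cmap c q \<in> V \<Longrightarrow> snd (Y q) c = \<eta> (cmap c q) \<and> snd (Y q) \<in> tspace A q"
    using vector_field_along_components[OF Y p c(1)] by metis
  let ?x = "cmap c p"
  have x: "?x \<in> L" using slice_chart_mem[OF sc(1,2)] p by simp
  have comp: "u c \<in> L" if "u \<in> sub_tspace A (S \<inter> W) q" "q \<in> S \<inter> W" "q \<in> cdom c" for u q
    using that sub_tspace_slice[OF sc(1) W that(2,3)] c by (auto simp: charts_at_iff)
  have \<eta>L: "\<eta> y \<in> L" if y: "y \<in> V \<inter> cmap c ` (cdom c \<inter> W) \<inter> L" for y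
  proof -
    obtain q where q: "q \<in> cdom c" "q \<in> W" "y = cmap c q" using y by blast
    then have qSW: "q \<in> S \<inter> W" using y slice_chart_mem[OF sc(1)] by blast
    then have "snd (Y q) c \<in> L" using comp[OF Yt] q(1) by blast
    moreover have "snd (Y q) c = \<eta> (cmap c q)" using \<eta>(5)[OF qSW q(1)] q y by simp
    ultimately show ?thesis using q by simp
  qed
  have der: "(\<eta> has_derivative frechet_derivative \<eta> (at ?x)) (at ?x)"
    using smooth_on_has_derivative[OF \<eta>(4,2)] .
  have vL: "v c \<in> L" using comp[OF v p sc(2)] .
  have "open (V \<inter> cmap c ` (cdom c \<inter> W))" using \<eta>(1) W c by (auto simp: openin_mtopology_iff)
  from derivative_along_subspace[OF L L this _ x der _ vL]
  have "frechet_derivative \<eta> (at ?x) (v c) \<in> L" using \<eta>L \<eta>(2) sc(2) p by blast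
  moreover have "christoffel A g c ?x (v c) (\<eta> ?x) \<in> L"
    using sc(3) x vL \<eta>L[of ?x] \<eta>(2) p sc(2) unfolding slice_geodesic_def by blast
  ultimately have "frechet_derivative \<eta> (at ?x) (v c) + christoffel A g c ?x (v c) (\<eta> ?x) \<in> L"
    by (rule subspace_add[OF L])
  then show "second_fundamental_form A g (S \<inter> W) p v Y = (\<lambda>c. 0)"
    using cov_deriv_eq[OF c(1) p v \<eta>(1,2) der \<eta>(5)] normal_part_eq_0_iff[OF sc(1) W p sc(2)]
    by (simp add: second_fundamental_form_def)
qed

end

subsection \<open>The Sasaki metric\<close>

context riemannian_atlas
begin

interpretation T: atlas "tangent_atlas A"
  by (rule atlas.intro[OF smooth_tangent_atlas])

abbreviation dchr :: "('a, 'e) chart \<Rightarrow> 'e \<Rightarrow> 'e \<Rightarrow> 'e \<Rightarrow> 'e \<Rightarrow> 'e" where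
  "dchr c x a u v \<equiv> frechet_derivative (\<lambda>y. christoffel A g c y u v) (at x) a"

text \<open>The vector component of the coordinate change is the Jacobian at the base point applied
  to \<open>e\<close>; its dependence on the base point gives the Hessian term.\<close>

lemma jac_tangent_chart:
  assumes c: "c \<in> charts_at A p" and d: "d \<in> charts_at A p"
  shows "T.jac (tangent_chart A c) (tangent_chart A d) (cmap c p, e) (u, w) =
    (jac c d (cmap c p) u, hess c d (cmap c p) u e + jac c d (cmap c p) w)"
proof -
  have cm: "c \<in> max_atlas A" "d \<in> max_atlas A" "p \<in> cdom c" "p \<in> cdom d"
    using c d by (auto simp: charts_at_iff)
  let ?x = "cmap c p" and ?S = "overlap c d \<times> (UNIV :: 'e set)"
  have S: "open ?S" "(?x, e) \<in> ?S" using open_overlap[OF cm(1,2)] cm by (auto intro: open_Times)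
  have lin: "linear (jac c d (fst y))" if "y \<in> ?S" for y
    using smooth_on_has_derivative[OF smooth_transition[OF cm(1,2)], of "fst y"] that has_derivative_linear by auto
  have f: "(fst has_derivative fst) (at (?x, e))" and s: "(snd has_derivative snd) (at (?x, e))"
    by (intro bounded_linear_imp_has_derivative bounded_linear_fst bounded_linear_snd)+
  have J: "((\<lambda>y. jac c d (fst y) v) has_derivative (\<lambda>h. hess c d ?x (fst h) v)) (at (?x, e))" for v
    using has_derivative_compose[OF f, of "\<lambda>y. jac c d y v"] jac_apply_has_derivative[OF c d, of v] by simp
  have "((\<lambda>y. jac c d (fst y) (snd y)) has_derivative
      (\<lambda>h. frechet_derivative (\<lambda>y. jac c d (fst y) (snd (?x, e))) (at (?x, e)) h + jac c d (fst (?x, e)) (snd h))) (at (?x, e))"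
    by (rule linear_family_has_derivative[OF S lin _ s]) (use J in \<open>auto intro: differentiableI\<close>)
  then have 2: "((\<lambda>y. jac c d (fst y) (snd y)) has_derivative (\<lambda>h. hess c d ?x (fst h) e + jac c d ?x (snd h))) (at (?x, e))"
    by (simp add: frechet_eqI[OF J])
  have 1: "((\<lambda>y. transition c d (fst y)) has_derivative (\<lambda>h. jac c d ?x (fst h))) (at (?x, e))"
    using has_derivative_compose[OF f, of "transition c d"] jac_has_derivative[OF c d] by simp
  have "(transition (tangent_chart A c) (tangent_chart A d) has_derivative
      (\<lambda>h. (jac c d ?x (fst h), hess c d ?x (fst h) e + jac c d ?x (snd h)))) (at (?x, e))"
    by (rule has_derivative_transform_within_open[OF has_derivative_Pair[OF 1 2] S])
      (use transition_tangent_chart[OF cm(1,2)] in auto)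
  then show ?thesis by (simp add: frechet_eqI)
qed

text \<open>\<open>differential\<close> is evaluated in an arbitrarily chosen chart \<open>b\<close>
  of the tangent bundle; the chain rule through the induced chart, in which the projection is
  \<open>fst\<close>, removes this choice.\<close>

lemma differential_fst:
  assumes X: "X \<in> tspace (tangent_atlas A) q" and c: "c \<in> charts_at A (fst q)" and q: "snd q \<in> tspace A (fst q)"
  shows "differential (tangent_atlas A) A fst q X = tvec_at A c (fst q) (fst (X (tangent_chart A c)))"
proof
  fix d
  let ?c = "tangent_chart A c"
  define b where "b = (SOME b. b \<in> charts_at (tangent_atlas A) q)"
  have c_at: "?c \<in> charts_at (tangent_atlas A) q" by (rule tangent_chart_charts_at[OF c q])
  then have b: "b \<in> charts_at (tangent_atlas A) q" unfolding b_def by (rule someI)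
  have m: "b \<in> max_atlas (tangent_atlas A)" "?c \<in> max_atlas (tangent_atlas A)" "q \<in> cdom b" "q \<in> cdom ?c"
    "c \<in> max_atlas A"
    using b c_at c by (auto simp: charts_at_iff)
  show "differential (tangent_atlas A) A fst q X d = tvec_at A c (fst q) (fst (X ?c)) d"
  proof (cases "d \<in> charts_at A (fst q)")
    case d: True
    let ?J = "T.jac b ?c (cmap b q)"
    have "(transition b ?c has_derivative ?J) (at (cmap b q))" by (rule T.jac_has_derivative[OF b c_at])
    then have 1: "((\<lambda>y. fst (transition b ?c y)) has_derivative (\<lambda>h. fst (?J h))) (at (cmap b q))"
      by (rule has_derivative_fst)
    have "((\<lambda>y. transition c d (fst (transition b ?c y))) has_derivative (\<lambda>h. jac c d (cmap c (fst q)) (fst (?J h)))) (at (cmap b q))"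
      by (rule has_derivative_compose[OF 1]) (simp add: transition_cmap[OF m(1,3)] cmap_tangent_chart jac_has_derivative[OF c d])
    then have "((cmap d \<circ> fst \<circ> cinv b) has_derivative (\<lambda>h. jac c d (cmap c (fst q)) (fst (?J h)))) (at (cmap b q))"
    proof (rule has_derivative_transform_within_open[OF _ T.open_overlap[OF m(1,2)]])
      fix y assume "y \<in> overlap b ?c"
      then obtain r where r: "r \<in> cdom b" "r \<in> cdom ?c" "y = cmap b r" by blast
      then have "fst r \<in> cdom c" by (simp add: mem_cdom_tangent_chart)
      then show "transition c d (fst (transition b ?c y)) = (cmap d \<circ> fst \<circ> cinv b) y"
        using r by (simp add: transition_cmap[OF m(1)] cmap_tangent_chart transition_cmap[OF m(5)] max_atlas_cinv[OF m(1)])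
    qed (use m in auto)
    then have "frechet_derivative (cmap d \<circ> fst \<circ> cinv b) (at (cmap b q)) (X b) = jac c d (cmap c (fst q)) (fst (?J (X b)))"
      by (rule frechet_eqI)
    also have "?J (X b) = X ?c" using T.tspace_apply[OF X b c_at] by simp
    finally show ?thesis unfolding differential_def Let_def b_def[symmetric] tvec_at_apply[OF d] using d by (simp only: if_True)
  qed (simp add: differential_def Let_def tvec_at_def)
qed

text \<open>The components prescribed by \<open>connection_map\<close> fit together to one tangent
  vector: the Hessian term of \<open>jac_tangent_chart\<close> is the one that
  \<open>christoffel_change\<close> requires.\<close>

lemma connection_map_eq:
  assumes X: "X \<in> tspace (tangent_atlas A) q" and c: "c \<in> charts_at A (fst q)" and q: "snd q \<in> tspace A (fst q)"
  shows "connection_map A g q X = tvec_at A c (fst q) (snd (X (tangent_chart A c)) +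
    christoffel A g c (cmap c (fst q)) (snd q c) (fst (X (tangent_chart A c))))"
proof
  fix d
  obtain u w where uw: "X (tangent_chart A c) = (u, w)" by fastforce
  show "connection_map A g q X d = tvec_at A c (fst q) (snd (X (tangent_chart A c)) +
    christoffel A g c (cmap c (fst q)) (snd q c) (fst (X (tangent_chart A c)))) d"
  proof (cases "d \<in> charts_at A (fst q)")
    case d: True
    let ?x = "cmap c (fst q)"
    have "X (tangent_chart A d) = T.jac (tangent_chart A c) (tangent_chart A d) (?x, snd q c) (u, w)"
      using T.tspace_apply[OF X tangent_chart_charts_at[OF c q] tangent_chart_charts_at[OF d q]] uw
      by (simp add: cmap_tangent_chart)
    then have Xd: "X (tangent_chart A d) = (jac c d ?x u, hess c d ?x u (snd q c) + jac c d ?x w)"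
      by (simp add: jac_tangent_chart[OF c d])
    show ?thesis
      using christoffel_change[OF c d, of "snd q c" u] hess_sym[OF c d, of u "snd q c"] tspace_apply[OF q c d] d
      by (simp add: connection_map_def Xd uw tvec_at_apply linear_add[OF jac_linear[OF c d]])
  qed (simp add: connection_map_def tvec_at_def)
qed

lemma sasaki_coord_metric:
  assumes c: "c \<in> max_atlas A" and x: "x \<in> crange c"
  shows "coord_metric (tangent_atlas A) (sasaki_metric A g) (tangent_chart A c) (x, e) U W =
    coord_metric A g c x (fst U) (fst W) +
    coord_metric A g c x (snd U + christoffel A g c x e (fst U)) (snd W + christoffel A g c x e (fst W))"
proof -
  obtain p where p: "p \<in> cdom c" "x = cmap c p" using x by blast
  have c_at: "c \<in> charts_at A p" using c p by (simp add: charts_at_iff)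
  define q where "q = (p, tvec_at A c p e)"
  have q: "fst q = p" "snd q c = e" "snd q \<in> tspace A (fst q)" "cmap (tangent_chart A c) q = (x, e)"
    using c_at p by (simp_all add: q_def tvec_at_tspace cmap_tangent_chart)
  have ch: "tangent_chart A c \<in> charts_at (tangent_atlas A) q"
    using tangent_chart_charts_at[of c q] c_at q by simp
  show ?thesis
    using differential_fst[OF T.tvec_at_tspace[OF ch] _ q(3), of c] connection_map_eq[OF T.tvec_at_tspace[OF ch] _ q(3), of c]
    unfolding q(4)[symmetric] T.coord_metric_cmap[OF ch]
    by (simp add: sasaki_metric_def q c_at ch p(2) coord_metric_cmap[OF c_at])
qed

lemma christoffel_simps:
  assumes "c \<in> max_atlas A" "x \<in> crange c"
  shows "christoffel A g c x (u + u') v = christoffel A g c x u v + christoffel A g c x u' v"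
    "christoffel A g c x u (v + v') = christoffel A g c x u v + christoffel A g c x u v'"
    "christoffel A g c x u (v - v') = christoffel A g c x u v - christoffel A g c x u v'"
    "christoffel A g c x u (r *\<^sub>R v) = r *\<^sub>R christoffel A g c x u v"
    "christoffel A g c x u 0 = 0" "christoffel A g c x 0 u = 0"
  using christoffel_bilinear[OF assms]
  by (auto simp: bilinear_ladd bilinear_radd bilinear_rsub bilinear_rmul bilinear_rzero bilinear_lzero)

lemma christoffel_apply_has_derivative:
  assumes c: "c \<in> max_atlas A" "x \<in> crange c"
    and f: "(f has_derivative f') (at x)" and h: "(h has_derivative h') (at x)"
  shows "((\<lambda>y. christoffel A g c y (f y) (h y)) has_derivative
    (\<lambda>a. dchr c x a (f x) (h x) + christoffel A g c x (f' a) (h x) + christoffel A g c x (f x) (h' a))) (at x)"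
  by (rule bilinear_family_has_derivative[OF open_crange[OF c(1)] c(2) christoffel_bilinear[OF c(1)]
        christoffel_differentiable[OF c] f h])

lemma dchr_sym:
  assumes c: "c \<in> max_atlas A" "x \<in> crange c"
  shows "dchr c x a u v = dchr c x a v u"
  using frechet_derivative_transform_within_open[OF christoffel_differentiable[OF c] open_crange[OF c(1)] c(2),
      of u v "\<lambda>y. christoffel A g c y v u"] christoffel_sym[OF c(1)] by metis

text \<open>The vertical part of the constant field \<open>U\<close> depends on the base point,
  which gives the \<open>dchr\<close> terms, and linearly on the fibre coordinate \<open>e\<close>,
  which gives the Christoffel terms in \<open>snd h\<close>.\<close>

lemma sasaki_has_derivative:
  assumes c: "c \<in> max_atlas A" "x \<in> crange c"
  shows "((\<lambda>y. coord_metric (tangent_atlas A) (sasaki_metric A g) (tangent_chart A c) y U W) has_derivative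
    (\<lambda>h. dmetric c x (fst h) (fst U) (fst W) +
      (dmetric c x (fst h) (snd U + christoffel A g c x e (fst U)) (snd W + christoffel A g c x e (fst W)) +
       coord_metric A g c x (dchr c x (fst h) e (fst U) + christoffel A g c x (snd h) (fst U)) (snd W + christoffel A g c x e (fst W)) +
       coord_metric A g c x (snd U + christoffel A g c x e (fst U)) (dchr c x (fst h) e (fst W) + christoffel A g c x (snd h) (fst W)))))
    (at (x, e))"
proof -
  let ?S = "crange c \<times> (UNIV :: 'e set)"
  have S: "open ?S" "(x, e) \<in> ?S" using open_crange[OF c(1)] c(2) by (auto intro: open_Times)
  have f: "(fst has_derivative fst) (at (x, e))" and s: "(snd has_derivative snd) (at (x, e))"
    by (intro bounded_linear_imp_has_derivative bounded_linear_fst bounded_linear_snd)+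
  have G: "((\<lambda>y. coord_metric A g c (fst y) u w) has_derivative (\<lambda>h. dmetric c x (fst h) u w)) (at (x, e))" for u w
    using has_derivative_compose[OF f, of "\<lambda>y. coord_metric A g c y u w"] metric_differentiable[OF c, of u w]
    by (simp add: frechet_derivative_works)
  have C: "((\<lambda>y. christoffel A g c (fst y) u w) has_derivative (\<lambda>h. dchr c x (fst h) u w)) (at (x, e))" for u w
    using has_derivative_compose[OF f, of "\<lambda>y. christoffel A g c y u w"] christoffel_differentiable[OF c, of u w]
    by (simp add: frechet_derivative_works)
  have bC: "bilinear (christoffel A g c (fst y))" and bG: "bilinear (coord_metric A g c (fst y))" if "y \<in> ?S" for y
    using christoffel_bilinear[OF c(1)] inner_form_bilinear[OF form[OF c(1)]] that by auto
  have K: "((\<lambda>y. snd U + christoffel A g c (fst y) (snd y) (fst U)) has_derivative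
      (\<lambda>h. dchr c x (fst h) e (fst U) + christoffel A g c x (snd h) (fst U))) (at (x, e))" for U
  proof -
    have "((\<lambda>y. christoffel A g c (fst y) (snd y) (fst U)) has_derivative
      (\<lambda>h. frechet_derivative (\<lambda>y. christoffel A g c (fst y) (snd (x, e)) (fst U)) (at (x, e)) h +
        christoffel A g c (fst (x, e)) (snd h) (fst U) + christoffel A g c (fst (x, e)) (snd (x, e)) 0)) (at (x, e))"
      by (rule bilinear_family_has_derivative[OF S bC _ s has_derivative_const]) (use C in \<open>auto intro: differentiableI\<close>)
    then have "((\<lambda>y. christoffel A g c (fst y) (snd y) (fst U)) has_derivative
      (\<lambda>h. dchr c x (fst h) e (fst U) + christoffel A g c x (snd h) (fst U))) (at (x, e))"
      by (simp add: frechet_eqI[OF C] christoffel_simps[OF c])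
    from has_derivative_add[OF has_derivative_const this, of "snd U"] show ?thesis by simp
  qed
  have 2: "((\<lambda>y. coord_metric A g c (fst y) (snd U + christoffel A g c (fst y) (snd y) (fst U))
        (snd W + christoffel A g c (fst y) (snd y) (fst W))) has_derivative
    (\<lambda>h. dmetric c x (fst h) (snd U + christoffel A g c x e (fst U)) (snd W + christoffel A g c x e (fst W)) +
       coord_metric A g c x (dchr c x (fst h) e (fst U) + christoffel A g c x (snd h) (fst U)) (snd W + christoffel A g c x e (fst W)) +
       coord_metric A g c x (snd U + christoffel A g c x e (fst U)) (dchr c x (fst h) e (fst W) + christoffel A g c x (snd h) (fst W))))
    (at (x, e))"
  proof -
    have "((\<lambda>y. coord_metric A g c (fst y) (snd U + christoffel A g c (fst y) (snd y) (fst U))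
        (snd W + christoffel A g c (fst y) (snd y) (fst W))) has_derivative
      (\<lambda>h. frechet_derivative (\<lambda>y. coord_metric A g c (fst y)
          (snd U + christoffel A g c (fst (x, e)) (snd (x, e)) (fst U))
          (snd W + christoffel A g c (fst (x, e)) (snd (x, e)) (fst W))) (at (x, e)) h +
       coord_metric A g c (fst (x, e)) (dchr c x (fst h) e (fst U) + christoffel A g c x (snd h) (fst U))
         (snd W + christoffel A g c (fst (x, e)) (snd (x, e)) (fst W)) +
       coord_metric A g c (fst (x, e)) (snd U + christoffel A g c (fst (x, e)) (snd (x, e)) (fst U))
         (dchr c x (fst h) e (fst W) + christoffel A g c x (snd h) (fst W)))) (at (x, e))"
      by (rule bilinear_family_has_derivative[OF S bG _ K K]) (use G in \<open>auto intro: differentiableI\<close>)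
    then show ?thesis by (simp add: frechet_eqI[OF G])
  qed
  show ?thesis
    by (rule has_derivative_transform_within_open[OF has_derivative_add[OF G[of "fst U" "fst W"] 2] S])
      (auto simp: sasaki_coord_metric[OF c(1)])
qed

text \<open>Definiteness holds because a vector is determined by its horizontal and vertical parts:
  if the horizontal part is 0, the Christoffel term drops out and the vertical part is
  \<open>snd U\<close>.\<close>

lemma metric_atlas_sasaki: "metric_atlas (tangent_atlas A) (sasaki_metric A g)"
proof (rule T.metric_atlasI[of "tangent_atlas A"])
  fix q assume "q \<in> carrier_of (tangent_atlas A)"
  then show "\<exists>c\<in>tangent_atlas A. q \<in> cdom c" by (auto simp: carrier_of_def)
next
  fix b y assume "b \<in> tangent_atlas A" and y: "y \<in> crange b"
  then obtain c where c: "c \<in> max_atlas A" "b = tangent_chart A c" by (auto simp: tangent_atlas_def)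
  obtain x e where xe: "y = (x, e)" "x \<in> crange c" using y c by (auto simp: crange_tangent_chart)
  show "(\<lambda>y. coord_metric (tangent_atlas A) (sasaki_metric A g) b y u w) differentiable (at y)" for u w
    unfolding c(2) xe(1) by (rule differentiableI[OF sasaki_has_derivative[OF c(1) xe(2)]])
  note F = form[OF c(1) xe(2)]
  show "inner_form (coord_metric (tangent_atlas A) (sasaki_metric A g) b y)"
    unfolding inner_form_def
  proof (intro conjI allI impI)
    define k where "k U = snd U + christoffel A g c x e (fst U)" for U
    have k: "k (U + W) = k U + k W" "k (r *\<^sub>R U) = r *\<^sub>R k U" for U W r
      by (simp_all add: k_def christoffel_simps[OF c(1) xe(2)] scaleR_add_right)
    show "bilinear (coord_metric (tangent_atlas A) (sasaki_metric A g) b y)"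
      unfolding bilinear_def c(2) xe(1) sasaki_coord_metric[OF c(1) xe(2)] k_def[symmetric]
      by (intro conjI allI linearI) (simp_all add: inner_form_simps[OF F] k distrib_left)
    show "coord_metric (tangent_atlas A) (sasaki_metric A g) b y u w = coord_metric (tangent_atlas A) (sasaki_metric A g) b y w u" for u w
      unfolding c(2) xe(1) sasaki_coord_metric[OF c(1) xe(2)]
      using inner_form_sym[OF F] by (intro arg_cong2[of _ _ _ _ "(+)"])
    fix U :: "'e \<times> 'e" assume "U \<noteq> 0"
    have nn: "coord_metric A g c x v v \<ge> 0" for v
      using inner_form_pos[OF F, of v] inner_form_eq_0[OF F, of v] by (cases "v = 0") auto
    show "coord_metric (tangent_atlas A) (sasaki_metric A g) b y U U > 0"
    proof (cases "fst U = 0")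
      case True
      then have "snd U \<noteq> 0" using \<open>U \<noteq> 0\<close> by (simp add: prod_eq_iff)
      then show ?thesis unfolding c(2) xe(1) sasaki_coord_metric[OF c(1) xe(2)]
        using inner_form_pos[OF F] True by (simp add: christoffel_simps[OF c(1) xe(2)] inner_form_simps[OF F])
    next
      case False
      then show ?thesis unfolding c(2) xe(1) sasaki_coord_metric[OF c(1) xe(2)]
        using inner_form_pos[OF F False] nn by (simp add: add_pos_nonneg)
    qed
  qed
qed (rule T.atlas_subset_max)

end

locale flat_atlas = riemannian_atlas A g
  for A :: "('a, 'e::euclidean_space) chart set" and g :: "('a, 'e) metric" +
  assumes flat: "flat_metric A g"
begin

interpretation T: metric_atlas "tangent_atlas A" "sasaki_metric A g"
  by (rule metric_atlas_sasaki)

text \<open>The vanishing of R(u, v) e, written as an expression that is symmetric in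
  \<open>u\<close> and \<open>v\<close>.\<close>

lemma flat_commute:
  assumes c: "c \<in> max_atlas A" "x \<in> crange c"
  shows "dchr c x u v e + christoffel A g c x u (christoffel A g c x v e) =
    dchr c x v u e + christoffel A g c x v (christoffel A g c x u e)"
proof -
  have "curvature A g c x u v e = 0" using flat c unfolding flat_metric_def by blast
  then have "(dchr c x u v e + christoffel A g c x u (christoffel A g c x v e)) -
      (dchr c x v u e + christoffel A g c x v (christoffel A g c x u e)) = 0"
    by (simp add: curvature_def Let_def algebra_simps)
  then show ?thesis by simp
qed

text \<open>In the horizontal-vertical splitting \<open>(u, k)\<close> with \<open>k = w + \<Gamma>(e, u)\<close>, the Sasaki connection of a flat
  metric differentiates both parts by the Levi-Civita connection of the base. The formula below
  translates this to induced coordinates; flatness is what makes it symmetric.\<close>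

lemma sasaki_christoffel:
  assumes c: "c \<in> max_atlas A" "x \<in> crange c"
  shows "christoffel (tangent_atlas A) (sasaki_metric A g) (tangent_chart A c) (x, e) (u, w) (v, z) =
    (christoffel A g c x u v,
     christoffel A g c x w v + dchr c x u e v + christoffel A g c x u z +
     christoffel A g c x u (christoffel A g c x e v) - christoffel A g c x e (christoffel A g c x u v))"
proof -
  let ?\<Gamma> = "christoffel A g c x"
  define B where "B U V = (?\<Gamma> (fst U) (fst V), ?\<Gamma> (snd U) (fst V) + dchr c x (fst U) e (fst V) + ?\<Gamma> (fst U) (snd V) +
     ?\<Gamma> (fst U) (?\<Gamma> e (fst V)) - ?\<Gamma> e (?\<Gamma> (fst U) (fst V)))" for U V
  have tc: "tangent_chart A c \<in> max_atlas (tangent_atlas A)" "(x, e) \<in> crange (tangent_chart A c)"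
    using c by (auto simp: tangent_chart_max crange_tangent_chart)
  note F = form[OF c]
  have "christoffel (tangent_atlas A) (sasaki_metric A g) (tangent_chart A c) (x, e) (u, w) (v, z) = B (u, w) (v, z)"
  proof (rule T.christoffel_eqI[OF tc])
    fix U V :: "'e \<times> 'e"
    \<comment> \<open>The only terms of \<open>B\<close> whose symmetry is not evident; the others
      are symmetric or are exchanged because the Christoffel symbols are symmetric.\<close>
    have "dchr c x (fst U) e (fst V) + ?\<Gamma> (fst U) (?\<Gamma> e (fst V)) = dchr c x (fst V) e (fst U) + ?\<Gamma> (fst V) (?\<Gamma> e (fst U))"
      using flat_commute[OF c, where u = "fst U" and v = "fst V" and e = e]
        dchr_sym[OF c, where a = "fst U" and u = "fst V" and v = e] dchr_sym[OF c, where a = "fst V" and u = "fst U" and v = e]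
        christoffel_sym[OF c, where u = "fst V" and v = e] christoffel_sym[OF c, where u = "fst U" and v = e] by metis
    then show "B U V = B V U"
      using christoffel_sym[OF c, where u = "snd U" and v = "fst V"]
        christoffel_sym[OF c, where u = "fst U" and v = "snd V"]
        christoffel_sym[OF c, where u = "fst U" and v = "fst V"]
      by (simp add: B_def algebra_simps)
  next
    fix H U W :: "'e \<times> 'e"
    \<comment> \<open>The vertical part of \<open>B H U\<close> is the derivative along
      \<open>H\<close> of the vertical part of the constant field \<open>U\<close>, corrected by the
      Christoffel term in \<open>fst H\<close>. Compatibility with the Sasaki metric thus splits
      into two instances of \<open>christoffel_compat\<close>.\<close>
    have *: "snd (B H U) + ?\<Gamma> e (fst (B H U)) =
      dchr c x (fst H) e (fst U) + ?\<Gamma> (snd H) (fst U) + ?\<Gamma> (fst H) (snd U + ?\<Gamma> e (fst U))" for U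
      by (simp add: B_def christoffel_simps[OF c] algebra_simps)
    show "T.dmetric (tangent_chart A c) (x, e) H U W =
      coord_metric (tangent_atlas A) (sasaki_metric A g) (tangent_chart A c) (x, e) (B H U) W +
      coord_metric (tangent_atlas A) (sasaki_metric A g) (tangent_chart A c) (x, e) U (B H W)"
      unfolding frechet_eqI[OF sasaki_has_derivative[OF c]] sasaki_coord_metric[OF c] *
        christoffel_compat[OF c] inner_form_simps(1,2)[OF F]
      by (simp add: B_def)
  qed
  then show ?thesis by (simp add: B_def)
qed

end

subsection \<open>The image of a vector field in the tangent bundle\<close>

context flat_atlas
begin

interpretation T: metric_atlas "tangent_atlas A" "sasaki_metric A g"
  by (rule metric_atlas_sasaki)

text \<open>\<open>\<eta>\<close> lives on all of \<open>crange c\<close> because derivatives are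
  taken on open sets; it represents the field only on the slice, and its values elsewhere are an
  arbitrary smooth extension.\<close>

definition adapted :: "'a set \<Rightarrow> ('a \<Rightarrow> 'a \<times> ('a, 'e) tvec) \<Rightarrow> ('a, 'e) chart \<Rightarrow> 'e set \<Rightarrow> ('e \<Rightarrow> 'e) \<Rightarrow> bool" where
  "adapted S \<xi> c L \<eta> \<longleftrightarrow> slice_chart S c L \<and> smooth_on (crange c) \<eta> \<and>
    (\<forall>q\<in>S. q \<in> cdom c \<longrightarrow> fst (\<xi> q) = q \<and> snd (\<xi> q) \<in> tspace A q \<and> snd (\<xi> q) c = \<eta> (cmap c q))"

lemma adapted_exists:
  assumes S: "submanifold A S l" and \<xi>: "vector_field_along A S \<xi>" and p: "p \<in> S"
  shows "\<exists>c L \<eta>. adapted S \<xi> c L \<eta> \<and> p \<in> cdom c \<and> dim L = l"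
proof -
  obtain b L where b: "slice_chart S b L" "p \<in> cdom b" "dim L = l" using S p submanifold_iff by blast
  note bm = slice_chart_max[OF b(1)]
  have b_at: "b \<in> charts_at A p" using bm b by (simp add: charts_at_iff)
  obtain \<eta> V where V: "open V" "cmap b p \<in> V" "V \<subseteq> crange b" "smooth_on V \<eta>"
    "\<And>q. q \<in> S \<Longrightarrow> q \<in> cdom b \<Longrightarrow> cmap b q \<in> V \<Longrightarrow> snd (\<xi> q) b = \<eta> (cmap b q) \<and> snd (\<xi> q) \<in> tspace A q"
    using vector_field_along_components[OF \<xi> p b_at] by metis
  define c where "c = ({q \<in> cdom b. cmap b q \<in> V}, cmap b)"
  have cdom: "q \<in> cdom c \<longleftrightarrow> q \<in> cdom b \<and> cmap b q \<in> V" and cmap: "cmap c = cmap b" for q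
    by (auto simp: c_def)
  have cm: "c \<in> max_atlas A" unfolding c_def by (rule chart_restrict[OF bm V(1)])
  have sc: "slice_chart S c L"
    unfolding slice_chart_iff[OF cm slice_chart_subspace[OF b(1)]] using slice_chart_mem[OF b(1)] by (simp add: cdom cmap)
  have "crange c \<subseteq> V" by (auto simp: cdom cmap)
  then have sm: "smooth_on (crange c) \<eta>" using V(4) smooth_on_subset by blast
  have "fst (\<xi> q) = q \<and> snd (\<xi> q) \<in> tspace A q \<and> snd (\<xi> q) c = \<eta> (cmap c q)" if q: "q \<in> S" "q \<in> cdom c" for q
  proof -
    have q': "q \<in> cdom b" "cmap b q \<in> V" using q by (auto simp: cdom)
    have at: "b \<in> charts_at A q" "c \<in> charts_at A q" using bm cm q q' by (auto simp: charts_at_iff)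
    have "snd (\<xi> q) c = jac b c (cmap b q) (snd (\<xi> q) b)"
      using tspace_apply[OF _ at] V(5)[OF q(1) q'] by blast
    also have "\<dots> = snd (\<xi> q) b" by (rule jac_eq_id[OF at]) (simp add: cmap)
    finally show ?thesis using \<xi> q V(5)[OF q(1) q'] by (simp add: vector_field_along_def cmap)
  qed
  then have "adapted S \<xi> c L \<eta>" using sc sm by (simp add: adapted_def)
  moreover have "p \<in> cdom c" using b V by (simp add: cdom)
  ultimately show ?thesis using b(3) by blast
qed

lemma adapted_slice: "adapted S \<xi> c L \<eta> \<Longrightarrow> slice_chart S c L"
  and adapted_max: "adapted S \<xi> c L \<eta> \<Longrightarrow> c \<in> max_atlas A"
  and adapted_subspace: "adapted S \<xi> c L \<eta> \<Longrightarrow> subspace L"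
  and adapted_smooth: "adapted S \<xi> c L \<eta> \<Longrightarrow> smooth_on (crange c) \<eta>"
  and adapted_field: "adapted S \<xi> c L \<eta> \<Longrightarrow> q \<in> S \<Longrightarrow> q \<in> cdom c \<Longrightarrow>
    fst (\<xi> q) = q \<and> snd (\<xi> q) \<in> tspace A q \<and> snd (\<xi> q) c = \<eta> (cmap c q)"
  by (auto simp: adapted_def slice_chart_max slice_chart_subspace)

text \<open>In this chart of the tangent bundle the graph of \<open>\<eta>\<close> becomes the zero section.\<close>

definition graph_chart :: "('a, 'e) chart \<Rightarrow> ('e \<Rightarrow> 'e) \<Rightarrow> ('a \<times> ('a, 'e) tvec, 'e \<times> 'e) chart" where
  "graph_chart c \<eta> = (cdom (tangent_chart A c), \<lambda>q. (cmap c (fst q), snd q c - \<eta> (cmap c (fst q))))"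

lemma cdom_graph_chart: "cdom (graph_chart c \<eta>) = cdom (tangent_chart A c)"
  and cmap_graph_chart: "cmap (graph_chart c \<eta>) q = (cmap c (fst q), snd q c - \<eta> (cmap c (fst q)))"
  by (simp_all add: graph_chart_def)

lemma crange_graph_chart:
  assumes c: "c \<in> max_atlas A"
  shows "crange (graph_chart c \<eta>) = crange c \<times> UNIV"
proof -
  have "crange (graph_chart c \<eta>) = (\<lambda>y. (fst y, snd y - \<eta> (fst y))) ` crange (tangent_chart A c)"
    by (simp add: cdom_graph_chart cmap_graph_chart cmap_tangent_chart image_image)
  also have "\<dots> = crange c \<times> UNIV"
  proof (intro equalityI subsetI)
    fix y :: "'e \<times> 'e" assume "y \<in> crange c \<times> UNIV"
    then have "y = (\<lambda>y. (fst y, snd y - \<eta> (fst y))) (fst y, snd y + \<eta> (fst y))"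
      and "(fst y, snd y + \<eta> (fst y)) \<in> crange (tangent_chart A c)"
      by (auto simp: crange_tangent_chart[OF c])
    then show "y \<in> (\<lambda>y. (fst y, snd y - \<eta> (fst y))) ` crange (tangent_chart A c)" by (rule image_eqI)
  qed (auto simp: crange_tangent_chart[OF c])
  finally show ?thesis .
qed

lemma graph_chart_max:
  assumes c: "c \<in> max_atlas A" and \<eta>: "smooth_on (crange c) \<eta>"
  shows "graph_chart c \<eta> \<in> max_atlas (tangent_atlas A)"
proof (rule T.chart_change[OF tangent_chart_max[OF c],
      where \<phi> = "\<lambda>y. (fst y, snd y - \<eta> (fst y))" and \<psi> = "\<lambda>y. (fst y, snd y + \<eta> (fst y))"])
  have o: "open (crange c \<times> (UNIV :: 'e set))" using open_crange[OF c] by (intro open_Times) auto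
  have 1: "cmap (tangent_chart A c) ` cdom (graph_chart c \<eta>) = crange c \<times> UNIV"
    by (simp add: cdom_graph_chart crange_tangent_chart[OF c])
  have \<eta>f: "smooth_on (crange c \<times> (UNIV :: 'e set)) (\<lambda>y. \<eta> (fst y))"
    by (rule smooth_on_compose[OF o open_crange[OF c] _ \<eta> smooth_on_fst]) auto
  show "open (cmap (tangent_chart A c) ` cdom (graph_chart c \<eta>))" "open (crange (graph_chart c \<eta>))"
    unfolding 1 crange_graph_chart[OF c] by (rule o)+
  show "smooth_on (cmap (tangent_chart A c) ` cdom (graph_chart c \<eta>)) (\<lambda>y. (fst y, snd y - \<eta> (fst y)))"
    unfolding 1 by (intro smooth_on_Pair o smooth_on_diff smooth_on_fst smooth_on_snd \<eta>f)
  show "smooth_on (crange (graph_chart c \<eta>)) (\<lambda>y. (fst y, snd y + \<eta> (fst y)))"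
    unfolding crange_graph_chart[OF c] by (intro smooth_on_Pair o smooth_on_add smooth_on_fst smooth_on_snd \<eta>f)
qed (auto simp: cdom_graph_chart cmap_graph_chart cmap_tangent_chart)

text \<open>Over a base point in \<open>S\<close>, the component in \<open>c\<close> alone decides
  whether a tangent vector is the value of \<xi>, by \<open>tspace_ext\<close>.\<close>

lemma graph_chart_slice:
  assumes ad: "adapted S \<xi> c L \<eta>" and \<xi>: "\<And>q. q \<in> S \<Longrightarrow> fst (\<xi> q) = q"
  shows "T.slice_chart (\<xi> ` S) (graph_chart c \<eta>) (L \<times> {0})"
proof -
  note c = adapted_max[OF ad]
  have "q \<in> \<xi> ` S \<longleftrightarrow> cmap (graph_chart c \<eta>) q \<in> L \<times> {0}" if q: "q \<in> cdom (graph_chart c \<eta>)" for q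
  proof -
    have q': "fst q \<in> cdom c" "snd q \<in> tspace A (fst q)" using q by (auto simp: cdom_graph_chart mem_cdom_tangent_chart)
    show ?thesis
    proof
      assume "q \<in> \<xi> ` S"
      then obtain r where r: "r \<in> S" "q = \<xi> r" by blast
      then have "fst q = r" using \<xi> by simp
      then show "cmap (graph_chart c \<eta>) q \<in> L \<times> {0}"
        using r q' adapted_field[OF ad r(1)] slice_chart_mem[OF adapted_slice[OF ad], of r] by (simp add: cmap_graph_chart)
    next
      assume "cmap (graph_chart c \<eta>) q \<in> L \<times> {0}"
      then have *: "cmap c (fst q) \<in> L" "snd q c = \<eta> (cmap c (fst q))" by (auto simp: cmap_graph_chart)
      then have S: "fst q \<in> S" using slice_chart_mem[OF adapted_slice[OF ad] q'(1)] by simp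
      note f = adapted_field[OF ad S q'(1)]
      have "snd q = snd (\<xi> (fst q))"
        by (rule tspace_ext[of _ "fst q" _ c]) (use f q' * c in \<open>auto simp: charts_at_iff\<close>)
      then have "q = \<xi> (fst q)" using f by (simp add: prod_eq_iff)
      then show "q \<in> \<xi> ` S" using S by blast
    qed
  qed
  then show ?thesis
    by (intro T.slice_chart_iff[THEN iffD2] graph_chart_max[OF c adapted_smooth[OF ad]]
        subspace_Times[OF adapted_subspace[OF ad] subspace_single_0] ballI)
qed

lemma submanifold_image:
  assumes S: "submanifold A S l" and \<xi>: "vector_field_along A S \<xi>"
  shows "submanifold (tangent_atlas A) (\<xi> ` S) l"
proof -
  have f: "\<And>q. q \<in> S \<Longrightarrow> fst (\<xi> q) = q" using \<xi> by (simp add: vector_field_along_def)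
  have "\<xi> p \<in> carrier_of (tangent_atlas A) \<and> (\<exists>b M. T.slice_chart (\<xi> ` S) b M \<and> \<xi> p \<in> cdom b \<and> dim M = l)" if p: "p \<in> S" for p
  proof -
    obtain c L \<eta> where ad: "adapted S \<xi> c L \<eta>" "p \<in> cdom c" "dim L = l" using adapted_exists[OF S \<xi> p] by blast
    note sc = graph_chart_slice[OF ad(1) f]
    have mem: "\<xi> p \<in> cdom (graph_chart c \<eta>)"
      using adapted_field[OF ad(1) p ad(2)] ad(2) by (simp add: cdom_graph_chart mem_cdom_tangent_chart)
    moreover have "dim (L \<times> {0 :: 'e}) = l"
      using dim_Times[OF adapted_subspace[OF ad(1)] subspace_single_0[where 'a = 'e]] ad(3) by simp
    moreover have "\<xi> p \<in> carrier_of (tangent_atlas A)"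
      using max_atlas_carrier[OF T.slice_chart_max[OF sc]] mem by blast
    ultimately show ?thesis using sc by blast
  qed
  then show ?thesis unfolding T.submanifold_iff by blast
qed

text \<open>On the slice and for \<open>v\<close> in \<open>L\<close> these are the components of
  \<nabla>\<xi> in direction \<open>v\<close>; elsewhere the value depends on the chosen extension
  \<open>\<eta>\<close>.\<close>

definition cov :: "('a, 'e) chart \<Rightarrow> ('e \<Rightarrow> 'e) \<Rightarrow> 'e \<Rightarrow> 'e \<Rightarrow> 'e" where
  "cov c \<eta> x v = frechet_derivative \<eta> (at x) v + christoffel A g c x v (\<eta> x)"

lemma cov_has_derivative:
  assumes c: "c \<in> max_atlas A" "x \<in> crange c" and \<eta>: "smooth_on (crange c) \<eta>"
  shows "((\<lambda>y. cov c \<eta> y v) has_derivative (\<lambda>u. frechet_derivative (\<lambda>y. frechet_derivative \<eta> (at y) v) (at x) u +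
    (dchr c x u v (\<eta> x) + christoffel A g c x v (frechet_derivative \<eta> (at x) u)))) (at x)"
  unfolding cov_def
  using has_derivative_add[OF smooth_on_has_derivative[OF smooth_on_frechet[OF \<eta>] c(2)]
      christoffel_apply_has_derivative[OF c has_derivative_const smooth_on_has_derivative[OF \<eta> c(2)]], of v v]
  by (simp add: christoffel_simps[OF c])

lemma cov_linear:
  assumes c: "c \<in> max_atlas A" "x \<in> crange c" and \<eta>: "smooth_on (crange c) \<eta>"
  shows "linear (cov c \<eta> x)"
  unfolding cov_def
  using linear_compose_add[OF has_derivative_linear[OF smooth_on_has_derivative[OF \<eta> c(2)]], of "\<lambda>v. christoffel A g c x v (\<eta> x)"]
    christoffel_bilinear[OF c] by (simp add: bilinear_def)

text \<open>The transformation law between the sheared and the induced chart. For fields with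
  constant components, the second component is the derivative along \<open>u\<close> of the
  derivative along \<open>v\<close>, minus the derivative along the covariant derivative of
  \<open>v\<close> by \<open>u\<close>: the second covariant derivative of \<xi>.\<close>

lemma graph_christoffel:
  assumes c: "c \<in> max_atlas A" "x \<in> crange c" and \<eta>: "smooth_on (crange c) \<eta>"
  shows "christoffel (tangent_atlas A) (sasaki_metric A g) (graph_chart c \<eta>) (x, 0) (u, 0) (v, 0) =
    (christoffel A g c x u v,
     frechet_derivative (\<lambda>y. cov c \<eta> y v) (at x) u + christoffel A g c x u (cov c \<eta> x v) - cov c \<eta> x (christoffel A g c x u v))"
proof -
  let ?b = "graph_chart c \<eta>" and ?t = "tangent_chart A c" and ?\<Gamma> = "christoffel A g c x" and ?D = "frechet_derivative \<eta> (at x)"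
  obtain p where p: "p \<in> cdom c" "x = cmap c p" using c(2) by blast
  have at: "c \<in> charts_at A p" using c p by (simp add: charts_at_iff)
  define q where "q = (p, tvec_at A c p (\<eta> x))"
  have qt: "q \<in> cdom ?t" unfolding q_def by (rule tangent_point_mem[OF at])
  have b: "?b \<in> charts_at (tangent_atlas A) q" and t: "?t \<in> charts_at (tangent_atlas A) q"
    using graph_chart_max[OF c(1) \<eta>] tangent_chart_max[OF c(1)] qt by (auto simp: charts_at_iff cdom_graph_chart)
  have bq: "cmap ?b q = (x, 0)" and tq: "cmap ?t q = (x, \<eta> x)"
    using p at by (auto simp: cmap_graph_chart cmap_tangent_chart q_def)
  have S: "open (crange c \<times> (UNIV :: 'e set))" "(y, e) \<in> crange c \<times> (UNIV :: 'e set)" if "y \<in> crange c" for y e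
    using open_crange[OF c(1)] that by (auto intro: open_Times)
  have tr: "transition ?b ?t y = (fst y, snd y + \<eta> (fst y))" if y: "y \<in> crange c \<times> UNIV" for y
  proof -
    obtain r where r: "r \<in> cdom ?b" "y = cmap ?b r" using y crange_graph_chart[OF c(1), of \<eta>] by blast
    then show ?thesis
      using transition_cmap[OF graph_chart_max[OF c(1) \<eta>] r(1), of ?t] by (simp add: cmap_graph_chart cmap_tangent_chart)
  qed
  have J: "(transition ?b ?t has_derivative (\<lambda>h. (fst h, snd h + frechet_derivative \<eta> (at y) (fst h)))) (at (y, e))"
    if y: "y \<in> crange c" for y e
  proof -
    have "((\<lambda>y. \<eta> (fst y)) has_derivative (\<lambda>h. frechet_derivative \<eta> (at y) (fst h))) (at (y, e))"
      by (rule has_derivative_compose[OF bounded_linear_imp_has_derivative[OF bounded_linear_fst]])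
        (simp add: smooth_on_has_derivative[OF \<eta> y])
    then have "((\<lambda>y. (fst y, snd y + \<eta> (fst y))) has_derivative (\<lambda>h. (fst h, snd h + frechet_derivative \<eta> (at y) (fst h)))) (at (y, e))"
      by (intro has_derivative_Pair has_derivative_add bounded_linear_imp_has_derivative bounded_linear_fst bounded_linear_snd)
    then show ?thesis
      by (rule has_derivative_transform_within_open[OF _ S[OF y]]) (simp add: tr)
  qed
  have jac: "T.jac ?b ?t (y, e) h = (fst h, snd h + frechet_derivative \<eta> (at y) (fst h))" if "y \<in> crange c" for y e h
    by (rule frechet_eqI[OF J[OF that]])
  have hess: "T.hess ?b ?t (x, 0) (u, 0) (v, 0) = (0, frechet_derivative (\<lambda>y. frechet_derivative \<eta> (at y) v) (at x) u)"
  proof -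
    have "((\<lambda>y. frechet_derivative \<eta> (at (fst y)) v) has_derivative
        (\<lambda>h. frechet_derivative (\<lambda>y. frechet_derivative \<eta> (at y) v) (at x) (fst h))) (at (x, 0 :: 'e))"
      by (rule has_derivative_compose[OF bounded_linear_imp_has_derivative[OF bounded_linear_fst]])
        (simp add: smooth_on_has_derivative[OF smooth_on_frechet[OF \<eta>] c(2)])
    from has_derivative_Pair[OF has_derivative_const this]
    have "((\<lambda>y. T.jac ?b ?t y (v, 0)) has_derivative
        (\<lambda>h. (0, frechet_derivative (\<lambda>y. frechet_derivative \<eta> (at y) v) (at x) (fst h)))) (at (x, 0))"
      by (rule has_derivative_transform_within_open[OF _ S[OF c(2)]]) (auto simp: jac)
    then show ?thesis by (simp add: frechet_eqI)
  qed
  obtain a k where ak: "christoffel (tangent_atlas A) (sasaki_metric A g) ?b (x, 0) (u, 0) (v, 0) = (a, k)" by fastforce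
  \<comment> \<open>In the induced chart \<open>(u, 0)\<close> becomes \<open>u\<close> together
    with the derivative of \<open>\<eta>\<close> along \<open>u\<close>, and the base point becomes
    \<open>(x, \<eta> x)\<close>; \<open>sasaki_christoffel\<close> is evaluated at these
    values.\<close>
  have "T.jac ?b ?t (x, 0) (a, k) =
    christoffel (tangent_atlas A) (sasaki_metric A g) ?t (x, \<eta> x) (T.jac ?b ?t (x, 0) (u, 0)) (T.jac ?b ?t (x, 0) (v, 0)) +
    T.hess ?b ?t (x, 0) (u, 0) (v, 0)"
    using T.christoffel_change[OF b t, of "(u, 0)" "(v, 0)"] by (simp add: bq tq ak)
  then have a: "a = ?\<Gamma> u v" and k: "k + ?D a = ?\<Gamma> (?D u) v + dchr c x u (\<eta> x) v + ?\<Gamma> u (?D v) +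
     ?\<Gamma> u (?\<Gamma> (\<eta> x) v) - ?\<Gamma> (\<eta> x) (?\<Gamma> u v) + frechet_derivative (\<lambda>y. frechet_derivative \<eta> (at y) v) (at x) u"
    by (auto simp: jac[OF c(2)] hess sasaki_christoffel[OF c])
  have "k = frechet_derivative (\<lambda>y. cov c \<eta> y v) (at x) u + ?\<Gamma> u (cov c \<eta> x v) - cov c \<eta> x (?\<Gamma> u v)"
    using k unfolding a frechet_eqI[OF cov_has_derivative[OF c \<eta>]] unfolding cov_def
    using christoffel_sym[OF c, where u = "?D u" and v = v] dchr_sym[OF c, where a = u and u = "\<eta> x" and v = v]
      christoffel_sym[OF c, where u = "\<eta> x" and v = v] christoffel_sym[OF c, where u = "\<eta> x" and v = "?\<Gamma> u v"]
    by (simp add: christoffel_simps[OF c] algebra_simps)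
  then show ?thesis using ak a by simp
qed

lemma graph_slice_geodesic_iff:
  assumes c: "c \<in> max_atlas A" and \<eta>: "smooth_on (crange c) \<eta>" and L: "subspace L"
  shows "T.slice_geodesic (graph_chart c \<eta>) (L \<times> {0}) \<longleftrightarrow>
    (\<forall>x\<in>crange c \<inter> L. \<forall>u\<in>L. \<forall>v\<in>L. christoffel A g c x u v \<in> L \<and>
      frechet_derivative (\<lambda>y. cov c \<eta> y v) (at x) u = cov c \<eta> x (christoffel A g c x u v) - christoffel A g c x u (cov c \<eta> x v))"
proof -
  have "christoffel (tangent_atlas A) (sasaki_metric A g) (graph_chart c \<eta>) (x, 0) (u, 0) (v, 0) \<in> L \<times> {0} \<longleftrightarrow>
    christoffel A g c x u v \<in> L \<and>
      frechet_derivative (\<lambda>y. cov c \<eta> y v) (at x) u = cov c \<eta> x (christoffel A g c x u v) - christoffel A g c x u (cov c \<eta> x v)"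
    if "x \<in> crange c" for x u v
    unfolding graph_christoffel[OF c that \<eta>] by (auto simp: algebra_simps)
  then show ?thesis
    unfolding T.slice_geodesic_def crange_graph_chart[OF c] by fastforce
qed

section \<open>Parallel fields along totally geodesic submanifolds\<close>

definition parallel_at :: "'a set \<Rightarrow> ('a \<Rightarrow> 'a \<times> ('a, 'e) tvec) \<Rightarrow> 'a \<Rightarrow> bool" where
  "parallel_at S \<xi> p \<longleftrightarrow> (\<forall>v\<in>sub_tspace A S p. cov_deriv A g S \<xi> p v = (\<lambda>c. 0))"

lemma parallel_at_iff:
  assumes S: "S \<subseteq> carrier_of A" and ad: "adapted S \<xi> c L \<eta>" and p: "p \<in> S" "p \<in> cdom c"
  shows "parallel_at S \<xi> p \<longleftrightarrow> (\<forall>u\<in>L. cov c \<eta> (cmap c p) u = 0)"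
proof -
  note c = adapted_max[OF ad]
  have at: "c \<in> charts_at A p" and x: "cmap c p \<in> crange c" using c p by (auto simp: charts_at_iff)
  \<comment> \<open>Slice lemmas are stated for \<open>S \<inter> W\<close>; here \<open>W\<close>
    is the whole space.\<close>
  have S': "S \<inter> topspace (mtopology A) = S" using S by (auto simp: topspace_mtopology)
  have sub: "sub_tspace A S p = tvec_at A c p ` L"
    using sub_tspace_slice[OF adapted_slice[OF ad] openin_topspace, of p] p unfolding S' by blast
  have "cov_deriv A g S \<xi> p v = tvec_at A c p (cov c \<eta> (cmap c p) (v c))" if v: "v \<in> sub_tspace A S p" for v
    unfolding cov_def
    by (rule cov_deriv_eq[OF at p(1) v open_crange[OF c] x smooth_on_has_derivative[OF adapted_smooth[OF ad] x]])
      (use adapted_field[OF ad] in auto)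
  moreover have "tvec_at A c p w = (\<lambda>c. 0) \<longleftrightarrow> w = 0" for w
    using tvec_at_zero[OF at] tvec_at_same[OF at, of w] by metis
  ultimately show ?thesis unfolding parallel_at_def sub using at by simp
qed

lemma totally_geodesic_image:
  assumes S: "totally_geodesic A g S l" and \<xi>: "vector_field_along A S \<xi>" and par: "parallel_along A g S \<xi>"
  shows "totally_geodesic (tangent_atlas A) (sasaki_metric A g) (\<xi> ` S) l"
proof (rule T.totally_geodesicI)
  have sub: "submanifold A S l" using S by (simp add: totally_geodesic_def)
  then show "submanifold (tangent_atlas A) (\<xi> ` S) l" by (rule submanifold_image[OF _ \<xi>])
  have f: "\<And>q. q \<in> S \<Longrightarrow> fst (\<xi> q) = q" using \<xi> by (simp add: vector_field_along_def)
  fix q assume "q \<in> \<xi> ` S"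
  then obtain p where p: "p \<in> S" "q = \<xi> p" by blast
  obtain c L \<eta> where ad: "adapted S \<xi> c L \<eta>" "p \<in> cdom c" using adapted_exists[OF sub \<xi> p(1)] by blast
  note c = adapted_max[OF ad(1)] and L = adapted_subspace[OF ad(1)] and sm = adapted_smooth[OF ad(1)]
  have sg: "slice_geodesic c L" by (rule totally_geodesic_slice[OF S adapted_slice[OF ad(1)]])
  have cov0: "cov c \<eta> x u = 0" if x: "x \<in> crange c \<inter> L" and u: "u \<in> L" for x u
  proof -
    obtain r where r: "r \<in> cdom c" "x = cmap c r" using x by blast
    then have "r \<in> S" using slice_chart_mem[OF adapted_slice[OF ad(1)] r(1)] x by simp
    then show ?thesis
      using parallel_at_iff[OF _ ad(1) _ r(1)] par sub u r
      by (simp add: submanifold_iff parallel_along_def parallel_at_def)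
  qed
  \<comment> \<open>\<open>cov c \<eta>\<close> is known to vanish on the slice only, but the
    derivative is taken in directions of \<open>L\<close>.\<close>
  have "frechet_derivative (\<lambda>y. cov c \<eta> y v) (at x) u \<in> {0}" if x: "x \<in> crange c \<inter> L" and "u \<in> L" "v \<in> L" for x u v
  proof (rule derivative_along_subspace[OF L subspace_single_0 open_crange[OF c],
        where f = "\<lambda>y. cov c \<eta> y v" and x = x and f' = "frechet_derivative (\<lambda>y. cov c \<eta> y v) (at x)"])
    show "((\<lambda>y. cov c \<eta> y v) has_derivative frechet_derivative (\<lambda>y. cov c \<eta> y v) (at x)) (at x)"
      using differentiableI[OF cov_has_derivative[OF c _ sm]] x by (simp add: frechet_derivative_works)
  qed (use that cov0 in auto)
  then have "T.slice_geodesic (graph_chart c \<eta>) (L \<times> {0})"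
    unfolding graph_slice_geodesic_iff[OF c sm L]
    using sg cov0 christoffel_simps(5)[OF c] by (fastforce simp: slice_geodesic_def)
  moreover have "q \<in> cdom (graph_chart c \<eta>)"
    using adapted_field[OF ad(1) p(1) ad(2)] ad(2) p by (simp add: cdom_graph_chart mem_cdom_tangent_chart)
  ultimately show "\<exists>b M. T.slice_chart (\<xi> ` S) b M \<and> q \<in> cdom b \<and> T.slice_geodesic b M"
    using graph_chart_slice[OF ad(1) f] by blast
qed

end

subsection \<open>Vanishing of the second covariant derivative on a compact submanifold\<close>

text \<open>Each of the finitely many functions \<open>B y i j\<close> with basis vectors
  \<open>i\<close> and \<open>j\<close> is bounded on the compact set, and the sum of these bounds
  serves for all arguments.\<close>

lemma bilinear_family_bounded:
  fixes B :: "'x::topological_space \<Rightarrow> 'a::euclidean_space \<Rightarrow> 'b::euclidean_space \<Rightarrow> 'c::real_normed_vector"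
  assumes K: "compact K" and bil: "\<And>y. y \<in> K \<Longrightarrow> bilinear (B y)" and cont: "\<And>u w. continuous_on K (\<lambda>y. B y u w)"
  shows "\<exists>C\<ge>0. \<forall>y\<in>K. \<forall>u w. norm (B y u w) \<le> C * norm u * norm w"
proof -
  have "\<exists>M. \<forall>y\<in>K. norm (B y i j) \<le> M" for i j
    using compact_imp_bounded[OF compact_continuous_image[OF cont K], of i j] by (auto simp: bounded_iff)
  then obtain M where M: "\<And>i j y. y \<in> K \<Longrightarrow> norm (B y i j) \<le> M i j" by metis
  define C where "C = (\<Sum>i\<in>(Basis :: 'a set). \<Sum>j\<in>(Basis :: 'b set). \<bar>M i j\<bar>)"
  have "norm (B y u w) \<le> C * norm u * norm w" if y: "y \<in> K" for y u w
  proof -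
    have "B y u w = (\<Sum>i\<in>Basis. \<Sum>j\<in>Basis. ((u \<bullet> i) * (w \<bullet> j)) *\<^sub>R B y i j)"
      by (rule bilinear_basis_sum[OF bil[OF y]])
    also have "norm \<dots> \<le> (\<Sum>i\<in>(Basis :: 'a set). \<Sum>j\<in>(Basis :: 'b set). norm u * norm w * \<bar>M i j\<bar>)"
    proof (intro sum_norm_le)
      fix i :: 'a and j :: 'b assume ij: "i \<in> Basis" "j \<in> Basis"
      have "norm (((u \<bullet> i) * (w \<bullet> j)) *\<^sub>R B y i j) = \<bar>u \<bullet> i\<bar> * \<bar>w \<bullet> j\<bar> * norm (B y i j)"
        by (simp add: abs_mult)
      also have "\<dots> \<le> norm u * norm w * \<bar>M i j\<bar>"
        using M[OF y, of i j] by (intro mult_mono Basis_le_norm ij) auto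
      finally show "norm (((u \<bullet> i) * (w \<bullet> j)) *\<^sub>R B y i j) \<le> norm u * norm w * \<bar>M i j\<bar>" .
    qed
    also have "\<dots> = C * norm u * norm w"
      by (simp add: C_def sum_distrib_left[symmetric] mult_ac)
    finally show ?thesis .
  qed
  moreover have "C \<ge> 0" unfolding C_def by (intro sum_nonneg) auto
  ultimately show ?thesis by blast
qed

text \<open>A linear differential equation along the segments through \<open>x\<close>, so a solution vanishing at \<open>x\<close>
  vanishes near \<open>x\<close>: on a ball of radius \<open>r\<close> the maximum \<open>M\<close> of the solution satisfies \<open>M \<le> const r M\<close>.\<close>

lemma linear_equation_unique:
  fixes \<Gamma> :: "'e::euclidean_space \<Rightarrow> 'e \<Rightarrow> 'e \<Rightarrow> 'e" and Q :: "'e \<Rightarrow> 'e \<Rightarrow> 'e"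
  assumes U: "open U" "x \<in> U" and L: "subspace L" and xL: "x \<in> L"
    and bil: "\<And>y. y \<in> U \<Longrightarrow> bilinear (\<Gamma> y)" and cont: "\<And>u w. continuous_on U (\<lambda>y. \<Gamma> y u w)"
    and lin: "\<And>y. y \<in> U \<Longrightarrow> linear (Q y)"
    and der: "\<And>y v. y \<in> U \<Longrightarrow> ((\<lambda>y. Q y v) has_derivative D y v) (at y)"
    and eq: "\<And>y u v. y \<in> U \<Longrightarrow> y \<in> L \<Longrightarrow> u \<in> L \<Longrightarrow> v \<in> L \<Longrightarrow>
      \<Gamma> y u v \<in> L \<and> D y v u = Q y (\<Gamma> y u v) - \<Gamma> y u (Q y v)"
    and zero: "\<And>v. v \<in> L \<Longrightarrow> Q x v = 0"
  shows "\<exists>r>0. ball x r \<subseteq> U \<and> (\<forall>y\<in>ball x r \<inter> L. \<forall>v\<in>L. Q y v = 0)"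
proof -
  obtain r0 where r0: "r0 > 0" "cball x r0 \<subseteq> U" using U open_contains_cball by blast
  obtain B where B: "B \<subseteq> L" "pairwise orthogonal B" "\<And>b. b \<in> B \<Longrightarrow> norm b = 1" "independent B" "span B = L"
    using orthonormal_basis_subspace[OF L] by metis
  have fin: "finite B" using B(4) independent_imp_finite by blast
  have rep: "v = (\<Sum>b\<in>B. (v \<bullet> b) *\<^sub>R b)" if "v \<in> L" for v
    using orthonormal_basis_expand[of B v] B that fin by (simp add: inner_commute)
  have "\<exists>C\<ge>0. \<forall>y\<in>cball x r0. \<forall>u w. norm (\<Gamma> y u w) \<le> C * norm u * norm w"
    by (rule bilinear_family_bounded) (use bil r0 continuous_on_subset[OF cont r0(2)] in auto)
  then obtain C where C: "C \<ge> 0" "\<And>y u w. y \<in> cball x r0 \<Longrightarrow> norm (\<Gamma> y u w) \<le> C * norm u * norm w" by blast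
  \<comment> \<open>For unit basis vectors \<open>b\<close> of \<open>L\<close>, this dominates the
    operator norm of \<open>Q y\<close> on \<open>L\<close> and is continuous in
    \<open>y\<close>.\<close>
  define m where "m y = (\<Sum>b\<in>B. norm (Q y b))" for y
  have Qm: "norm (Q y v) \<le> norm v * m y" if y: "y \<in> U" and v: "v \<in> L" for y v
  proof -
    have "Q y v = (\<Sum>b\<in>B. (v \<bullet> b) *\<^sub>R Q y b)"
      by (subst rep[OF v]) (simp add: linear_sum[OF lin[OF y]] linear_scale[OF lin[OF y]])
    also have "norm \<dots> \<le> (\<Sum>b\<in>B. norm v * norm (Q y b))"
    proof (rule sum_norm_le)
      fix b assume "b \<in> B"
      then show "norm ((v \<bullet> b) *\<^sub>R Q y b) \<le> norm v * norm (Q y b)"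
        using Cauchy_Schwarz_ineq2[of v b] B(3) by (auto intro!: mult_right_mono)
    qed
    finally show ?thesis by (simp add: m_def sum_distrib_left)
  qed
  \<comment> \<open>On a segment of length at most \<open>r\<close> the two terms of the equation
    each contribute at most \<open>C * r * m\<close>. Summed over \<open>B\<close>, the total factor
    \<open>card B * (2 * C * r)\<close> must not exceed 1/2; the summand 1 covers the case
    \<open>C * card B = 0\<close>.\<close>
  define r where "r = min r0 (1 / (4 * C * card B + 1))"
  have r: "r > 0" "r \<le> r0" using r0 C by (auto simp: r_def add_nonneg_pos)
  have rC: "card B * (2 * C * r) \<le> 1 / 2"
  proof -
    have pos: "4 * C * card B + 1 > 0" using C(1) by (simp add: add_nonneg_pos)
    have "r * (4 * C * card B + 1) \<le> 1 / (4 * C * card B + 1) * (4 * C * card B + 1)"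
      using pos by (intro mult_right_mono) (auto simp: r_def)
    then have "r * (4 * C * card B + 1) \<le> 1" using pos by simp
    then show ?thesis using r by (simp add: algebra_simps)
  qed
  have cb: "cball x r \<subseteq> cball x r0" "cball x r \<subseteq> U" using r r0 by auto
  have "continuous_on (cball x r \<inter> L) m"
    unfolding m_def using cb der
    by (intro continuous_on_sum continuous_on_norm continuous_at_imp_continuous_on ballI)
      (blast intro: has_derivative_continuous)
  moreover have "compact (cball x r \<inter> L)" using closed_subspace[OF L] by (intro compact_Int_closed) auto
  moreover have "x \<in> cball x r \<inter> L" using xL r by simp
  then have "cball x r \<inter> L \<noteq> {}" by blast
  ultimately obtain z where z: "z \<in> cball x r" "z \<in> L" "\<And>y. y \<in> cball x r \<Longrightarrow> y \<in> L \<Longrightarrow> m y \<le> m z"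
    using continuous_attains_sup[of "cball x r \<inter> L" m] by (metis IntD1 IntD2 IntI)
  have m0: "m y \<ge> 0" for y unfolding m_def by (intro sum_nonneg) auto
  have "norm (Q z b) \<le> 2 * C * r * m z" if b: "b \<in> B" for b
  proof -
    define w where "w = z - x"
    have w: "w \<in> L" "norm w \<le> r" using z xL L by (auto simp: w_def subspace_diff dist_norm norm_minus_commute)
    have bL: "b \<in> L" using b B by auto
    have seg: "x + t *\<^sub>R w \<in> cball x r \<and> x + t *\<^sub>R w \<in> L" if "0 \<le> t" "t \<le> 1" for t
    proof -
      have "norm (t *\<^sub>R w) \<le> 1 * r" unfolding norm_scaleR using that w by (intro mult_mono) auto
      then show ?thesis using xL w L by (simp add: dist_norm subspace_add subspace_scale)
    qed
    have dh: "((\<lambda>t. Q (x + t *\<^sub>R w) b) has_derivative (\<lambda>s. D (x + t *\<^sub>R w) b (s *\<^sub>R w))) (at t)" if "0 \<le> t" "t \<le> 1" for t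
    proof -
      have "((\<lambda>t. x + t *\<^sub>R w) has_derivative (\<lambda>s. s *\<^sub>R w)) (at t)" by (auto intro!: derivative_eq_intros)
      moreover have "((\<lambda>y. Q y b) has_derivative D (x + t *\<^sub>R w) b) (at (x + t *\<^sub>R w))" using seg[OF that] cb der by blast
      ultimately show ?thesis by (rule has_derivative_compose)
    qed
    \<comment> \<open>Since \<open>Q\<close> vanishes at the centre, the mean value inequality
      bounds \<open>Q z b\<close> by the derivative at a point of the segment; that point lies in
      \<open>L\<close>, so \<open>eq\<close> applies there.\<close>
    have "\<exists>t\<in>{0<..<1}. norm (Q (x + 1 *\<^sub>R w) b - Q (x + 0 *\<^sub>R w) b) \<le> norm (D (x + t *\<^sub>R w) b ((1 - 0) *\<^sub>R w))"
      by (rule mvt_general) (use dh in \<open>auto intro!: continuous_at_imp_continuous_on has_derivative_continuous\<close>)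
    then obtain t where t: "0 < t" "t < 1" "norm (Q z b) \<le> norm (D (x + t *\<^sub>R w) b w)"
      using zero[OF bL] by (auto simp: w_def)
    let ?y = "x + t *\<^sub>R w"
    have y: "?y \<in> cball x r" "?y \<in> L" "?y \<in> U" "?y \<in> cball x r0" using seg[of t] t cb by auto
    have "\<Gamma> ?y w b \<in> L" and Dy: "D ?y b w = Q ?y (\<Gamma> ?y w b) - \<Gamma> ?y w (Q ?y b)"
      using eq[OF y(3,2) w(1) bL] by auto
    then have "norm (Q ?y (\<Gamma> ?y w b)) \<le> norm (\<Gamma> ?y w b) * m ?y" using Qm y by blast
    also have "\<dots> \<le> (C * r) * m ?y"
    proof (rule mult_right_mono[OF _ m0])
      have "norm (\<Gamma> ?y w b) \<le> C * norm w * norm b" using C(2) y by blast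
      also have "\<dots> \<le> C * r" using B(3)[OF b] w C by (simp add: mult_left_mono)
      finally show "norm (\<Gamma> ?y w b) \<le> C * r" .
    qed
    finally have 1: "norm (Q ?y (\<Gamma> ?y w b)) \<le> C * r * m ?y" .
    have "norm (\<Gamma> ?y w (Q ?y b)) \<le> C * norm w * norm (Q ?y b)" using C(2) y by blast
    also have "\<dots> \<le> C * r * m ?y"
      using Qm[OF y(3) bL] B(3)[OF b] w C(1) r(1) by (intro mult_mono) auto
    finally have "norm (D ?y b w) \<le> C * r * m ?y + C * r * m ?y"
      unfolding Dy using 1 norm_triangle_ineq4[of "Q ?y (\<Gamma> ?y w b)" "\<Gamma> ?y w (Q ?y b)"] by linarith
    also have "\<dots> \<le> 2 * C * r * m z"
      using z(3)[OF y(1,2)] C r by (simp add: mult_left_mono)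
    finally show ?thesis using t by linarith
  qed
  \<comment> \<open>By the choice of \<open>r\<close>, the maximum is at most half of
    itself.\<close>
  then have "m z \<le> card B * (2 * C * r * m z)"
    unfolding m_def by (intro sum_bounded_above[THEN order_trans]) (auto simp: m_def)
  also have "\<dots> = card B * (2 * C * r) * m z" by (simp add: mult_ac)
  also have "\<dots> \<le> 1 / 2 * m z" by (rule mult_right_mono[OF rC m0])
  finally have "m z = 0" using m0[of z] by linarith
  have "Q y v = 0" if y: "y \<in> ball x r \<inter> L" and v: "v \<in> L" for y v
  proof -
    have yU: "y \<in> U" "y \<in> cball x r" using y cb(2) by auto
    then have "m y = 0" using z(3)[of y] m0[of y] y \<open>m z = 0\<close> by simp
    then show ?thesis using Qm[OF yU(1) v] by simp
  qed
  then show ?thesis using r cb by (intro exI[of _ r]) auto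
qed

text \<open>Restriction to the line through \<open>x\<close> in direction \<open>u\<close>, which
  stays in \<open>L\<close>. If the second derivative were positive, the first, being 0 at
  \<open>x\<close>, would be positive just after it, and \<open>E\<close> would increase beyond its
  maximum.\<close>

lemma second_derivative_test_subspace:
  fixes E :: "'e::euclidean_space \<Rightarrow> real"
  assumes U: "open U" "x \<in> U" and L: "subspace L" and xL: "x \<in> L"
    and der: "\<And>y. y \<in> U \<Longrightarrow> (E has_derivative E' y) (at y)"
    and der2: "((\<lambda>y. E' y u) has_derivative E2) (at x)"
    and max: "\<And>y. y \<in> U \<Longrightarrow> y \<in> L \<Longrightarrow> E y \<le> E x" and u: "u \<in> L"
  shows "E' x u = 0" "E2 u \<le> 0"
proof -
  have "((\<lambda>t. x + t *\<^sub>R u) \<longlongrightarrow> x + 0 *\<^sub>R u) (nhds 0)"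
    by (intro tendsto_intros filterlim_ident)
  from topological_tendstoD[OF this U(1)] have "\<forall>\<^sub>F t in nhds 0. x + t *\<^sub>R u \<in> U" using U(2) by simp
  then obtain d where d: "d > 0" "\<And>t. \<bar>t\<bar> < d \<Longrightarrow> x + t *\<^sub>R u \<in> U"
    unfolding eventually_nhds_metric by (auto simp: dist_real_def)
  have lin: "linear (E' y)" if "y \<in> U" for y using der[OF that] has_derivative_linear by blast
  have e: "((\<lambda>t. E (x + t *\<^sub>R u)) has_real_derivative E' (x + t *\<^sub>R u) u) (at t)" if "\<bar>t\<bar> < d" for t
  proof -
    have "((\<lambda>t. x + t *\<^sub>R u) has_derivative (\<lambda>s. s *\<^sub>R u)) (at t)" by (auto intro!: derivative_eq_intros)
    from has_derivative_compose[OF this der[OF d(2)[OF that]]] show ?thesis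
      unfolding has_field_derivative_def by (simp add: linear_scale[OF lin[OF d(2)[OF that]]] mult_commute_abs)
  qed
  have e2: "((\<lambda>t. E' (x + t *\<^sub>R u) u) has_real_derivative E2 u) (at 0)"
  proof -
    have "((\<lambda>t. x + t *\<^sub>R u) has_derivative (\<lambda>s. s *\<^sub>R u)) (at 0)" by (auto intro!: derivative_eq_intros)
    from has_derivative_compose[OF this, of "\<lambda>y. E' y u" E2] der2 show ?thesis
      unfolding has_field_derivative_def by (simp add: linear_scale[OF has_derivative_linear[OF der2]] mult_commute_abs)
  qed
  have mx: "E (x + t *\<^sub>R u) \<le> E x" if "\<bar>t\<bar> < d" for t
    using max d(2)[OF that] xL u L by (simp add: subspace_add subspace_scale)
  show E0: "E' x u = 0"
    using DERIV_local_max[OF e[of 0] d(1)] d(1) mx by simp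
  show "E2 u \<le> 0"
  proof (rule ccontr)
    assume "\<not> E2 u \<le> 0"
    then obtain d' where d': "d' > 0" "\<And>h. h > 0 \<Longrightarrow> h < d' \<Longrightarrow> E' (x + 0 *\<^sub>R u) u < E' (x + (0 + h) *\<^sub>R u) u"
      using DERIV_pos_inc_right[OF e2] by auto
    define h where "h = min d d' / 2"
    have h: "0 < h" "h < d" "h < d'" using d(1) d'(1) by (auto simp: h_def)
    have "\<exists>t>0. t < h \<and> E (x + h *\<^sub>R u) - E (x + 0 *\<^sub>R u) = (h - 0) * E' (x + t *\<^sub>R u) u"
      using h by (intro MVT2 e) auto
    then obtain t where t: "0 < t" "t < h" "E (x + h *\<^sub>R u) - E x = h * E' (x + t *\<^sub>R u) u" by auto
    have "E' (x + t *\<^sub>R u) u > 0" using d'(2)[of t] t h E0 by simp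
    then have "E (x + h *\<^sub>R u) > E x" using t h by (simp add: algebra_simps)
    then show False using mx[of h] h by simp
  qed
qed

context flat_atlas
begin

interpretation T: metric_atlas "tangent_atlas A" "sasaki_metric A g"
  by (rule metric_atlas_sasaki)

text \<open>The coordinate condition of \<open>graph_slice_geodesic_iff\<close>. Its first half
  keeps the Christoffel term in \<open>L\<close>, so that the second half involves \<nabla>\<xi> in
  tangential directions only and is a closed linear system along the slice.\<close>

definition second_cov_vanishes :: "('a, 'e) chart \<Rightarrow> 'e set \<Rightarrow> ('e \<Rightarrow> 'e) \<Rightarrow> bool" where
  "second_cov_vanishes c L \<eta> \<longleftrightarrow> (\<forall>x\<in>crange c \<inter> L. \<forall>u\<in>L. \<forall>v\<in>L. christoffel A g c x u v \<in> L \<and>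
      frechet_derivative (\<lambda>y. cov c \<eta> y v) (at x) u = cov c \<eta> x (christoffel A g c x u v) - christoffel A g c x u (cov c \<eta> x v))"

lemma cov_frechet:
  assumes c: "c \<in> max_atlas A" "x \<in> crange c" and \<eta>: "smooth_on (crange c) \<eta>"
  shows "((\<lambda>y. cov c \<eta> y v) has_derivative frechet_derivative (\<lambda>y. cov c \<eta> y v) (at x)) (at x)"
  using differentiableI[OF cov_has_derivative[OF assms]] by (simp add: frechet_derivative_works)

lemma cov_zero_locally:
  assumes c: "c \<in> max_atlas A" "x \<in> crange c" and \<eta>: "smooth_on (crange c) \<eta>" and L: "subspace L" "x \<in> L"
    and van: "second_cov_vanishes c L \<eta>" and zero: "\<And>v. v \<in> L \<Longrightarrow> cov c \<eta> x v = 0"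
  shows "\<exists>r>0. ball x r \<subseteq> crange c \<and> (\<forall>y\<in>ball x r \<inter> L. \<forall>v\<in>L. cov c \<eta> y v = 0)"
proof (rule linear_equation_unique[OF open_crange[OF c(1)] c(2) L, where \<Gamma> = "christoffel A g c"
      and D = "\<lambda>y v. frechet_derivative (\<lambda>y. cov c \<eta> y v) (at y)"])
  show "continuous_on (crange c) (\<lambda>y. christoffel A g c y u w)" for u w
    by (intro continuous_at_imp_continuous_on ballI differentiable_imp_continuous_within christoffel_differentiable c(1))
qed (use christoffel_bilinear[OF c(1)] cov_linear[OF c(1) _ \<eta>] cov_frechet[OF c(1) _ \<eta>] zero van in
    \<open>auto simp: second_cov_vanishes_def\<close>)

text \<open>The Hessian of \<open>|\<xi>|\<^sup>2\<close> is \<open>2 |\<nabla>\<xi>|\<^sup>2\<close> if the second covariant derivative of \<open>\<xi>\<close> vanishes.\<close>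

lemma cov_zero_at_maximum:
  assumes c: "c \<in> max_atlas A" and \<eta>: "smooth_on (crange c) \<eta>" and L: "subspace L" "x \<in> L"
    and U: "open U" "x \<in> U" "U \<subseteq> crange c"
    and van: "second_cov_vanishes c L \<eta>"
    and max: "\<And>y. y \<in> U \<Longrightarrow> y \<in> L \<Longrightarrow> coord_metric A g c y (\<eta> y) (\<eta> y) \<le> coord_metric A g c x (\<eta> x) (\<eta> x)"
    and u: "u \<in> L"
  shows "cov c \<eta> x u = 0"
proof -
  let ?G = "coord_metric A g c" and ?\<Gamma> = "christoffel A g c" and ?D = "\<lambda>y. frechet_derivative \<eta> (at y)"
  define E where "E y = ?G y (\<eta> y) (\<eta> y)" for y
  have x: "x \<in> crange c" using U by blast
  \<comment> \<open>Metric compatibility as a product rule: ordinary derivatives of the two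
    arguments are replaced by covariant ones, which absorb the derivative of the metric.\<close>
  have product: "dmetric c y a X Y + ?G y X' Y + ?G y X Y' = ?G y (X' + ?\<Gamma> y a X) Y + ?G y X (Y' + ?\<Gamma> y a Y)"
    if "y \<in> crange c" for y a X Y X' Y'
    using christoffel_compat[OF c that, where u = a and v = X and w = Y]
    by (simp add: inner_form_simps[OF form[OF c that]])
  have E1: "(E has_derivative (\<lambda>a. 2 * ?G y (cov c \<eta> y a) (\<eta> y))) (at y)" if y: "y \<in> crange c" for y
  proof -
    have "(E has_derivative (\<lambda>a. dmetric c y a (\<eta> y) (\<eta> y) + ?G y (?D y a) (\<eta> y) + ?G y (\<eta> y) (?D y a))) (at y)"
      unfolding E_def
      by (rule coord_metric_has_derivative[OF c y smooth_on_has_derivative[OF \<eta> y] smooth_on_has_derivative[OF \<eta> y]])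
    then show ?thesis
      unfolding product[OF y] cov_def[symmetric] using inner_form_sym[OF form[OF c y], of "\<eta> y"] by simp
  qed
  define E2 where "E2 a = 2 * (?G x (frechet_derivative (\<lambda>y. cov c \<eta> y u) (at x) a + ?\<Gamma> x a (cov c \<eta> x u)) (\<eta> x) +
    ?G x (cov c \<eta> x u) (cov c \<eta> x a))" for a
  have E2: "((\<lambda>y. 2 * ?G y (cov c \<eta> y u) (\<eta> y)) has_derivative E2) (at x)"
    unfolding E2_def
    using has_derivative_mult_right[OF coord_metric_has_derivative[OF c x cov_frechet[OF c x \<eta>, of u] smooth_on_has_derivative[OF \<eta> x]], of 2]
    unfolding product[OF x] cov_def[symmetric] .
  have E1U: "(E has_derivative (\<lambda>a. 2 * ?G y (cov c \<eta> y a) (\<eta> y))) (at y)" if "y \<in> U" for y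
    using E1 U(3) that by blast
  have maxE: "E y \<le> E x" if "y \<in> U" "y \<in> L" for y
    using max[OF that] by (simp add: E_def)
  note test = second_derivative_test_subspace[where E = E and U = U and L = L and x = x,
      where E' = "\<lambda>y a. 2 * ?G y (cov c \<eta> y a) (\<eta> y)"]
  have 1: "2 * ?G x (cov c \<eta> x v) (\<eta> x) = 0" if v: "v \<in> L" for v
  proof -
    have "((\<lambda>y. 2 * ?G y (cov c \<eta> y v) (\<eta> y)) has_derivative frechet_derivative (\<lambda>y. 2 * ?G y (cov c \<eta> y v) (\<eta> y)) (at x)) (at x)"
      using differentiableI[OF has_derivative_mult_right[OF coord_metric_has_derivative[OF c x cov_frechet[OF c x \<eta>] smooth_on_has_derivative[OF \<eta> x]], of 2]]
      by (simp add: frechet_derivative_works)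
    from test(1)[OF U(1,2) L(1,2) _ this _ v] show ?thesis using E1U maxE by blast
  qed
  \<comment> \<open>By the equation, the first summand of \<open>E2 u\<close> pairs \<nabla>\<xi> in
    the direction \<open>?\<Gamma> x u u\<close> with \<xi>. That direction lies in
    \<open>L\<close>, so the summand vanishes by the first-order condition; what remains is twice
    the squared norm of \<open>cov c \<eta> x u\<close>.\<close>
  have vu: "?\<Gamma> x u u \<in> L" "frechet_derivative (\<lambda>y. cov c \<eta> y u) (at x) u = cov c \<eta> x (?\<Gamma> x u u) - ?\<Gamma> x u (cov c \<eta> x u)"
    using van x L u by (auto simp: second_cov_vanishes_def)
  have "E2 u \<le> 0"
    using test(2)[OF U(1,2) L(1,2) _ E2 _ u] E1U maxE by blast
  then have "?G x (cov c \<eta> x u) (cov c \<eta> x u) \<le> 0"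
    using 1[OF vu(1)] by (simp add: E2_def vu(2))
  then show ?thesis using inner_form_pos[OF form[OF c x], of "cov c \<eta> x u"] by fastforce
qed

lemma parallel_if_second_cov_vanishes:
  assumes S: "submanifold A S l" and \<xi>: "vector_field_along A S \<xi>" and comp: "compactin (mtopology A) S"
    and van: "\<And>c L \<eta>. adapted S \<xi> c L \<eta> \<Longrightarrow> second_cov_vanishes c L \<eta>"
  shows "parallel_along A g S \<xi>"
proof (rule ccontr)
  let ?X = "mtopology A"
  assume np: "\<not> parallel_along A g S \<xi>"
  have SA: "S \<subseteq> carrier_of A" using S by (simp add: submanifold_iff)
  note par = parallel_at_iff[OF SA]
  \<comment> \<open>A union of open sets of the ambient space, so that its complement is closed
    there and \<open>Z\<close> inherits compactness from \<open>S\<close>. Local uniqueness puts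
    every point where the field is parallel into \<open>Op\<close>.\<close>
  define Op where "Op = \<Union>{W. openin ?X W \<and> (\<forall>q\<in>S \<inter> W. parallel_at S \<xi> q)}"
  define Z where "Z = S \<inter> (topspace ?X - Op)"
  have oO: "openin ?X Op" unfolding Op_def by (rule openin_Union) auto
  have O: "q \<in> Op" if q: "q \<in> S" "parallel_at S \<xi> q" for q
  proof -
    obtain c L \<eta> where ad: "adapted S \<xi> c L \<eta>" "q \<in> cdom c" using adapted_exists[OF S \<xi> q(1)] by blast
    note c = adapted_max[OF ad(1)] and sc = adapted_slice[OF ad(1)]
    have x: "cmap c q \<in> crange c" "cmap c q \<in> L" using ad(2) slice_chart_mem[OF sc ad(2)] q(1) by auto
    have "\<And>v. v \<in> L \<Longrightarrow> cov c \<eta> (cmap c q) v = 0" using par[OF ad(1) q(1) ad(2)] q(2) by blast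
    from cov_zero_locally[OF c x(1) adapted_smooth[OF ad(1)] adapted_subspace[OF ad(1)] x(2) van[OF ad(1)] this]
    obtain r where r: "r > 0" "\<And>y v. y \<in> ball (cmap c q) r \<Longrightarrow> y \<in> L \<Longrightarrow> v \<in> L \<Longrightarrow> cov c \<eta> y v = 0" by blast
    let ?W = "{p \<in> cdom c. cmap c p \<in> ball (cmap c q) r}"
    have "openin ?X ?W" by (rule openin_chart_preimage[OF c]) auto
    moreover have "parallel_at S \<xi> p" if "p \<in> S \<inter> ?W" for p
      using that par[OF ad(1), of p] r(2) slice_chart_mem[OF sc, of p] by auto
    moreover have "q \<in> ?W" using ad(2) r(1) by simp
    ultimately show ?thesis unfolding Op_def by blast
  qed
  have Zpar: "q \<in> Z \<longleftrightarrow> \<not> parallel_at S \<xi> q" if q: "q \<in> S" for q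
  proof -
    have "parallel_at S \<xi> q" if "q \<in> Op" using that q by (auto simp: Op_def)
    then show ?thesis using O[OF q] q SA by (auto simp: Z_def topspace_mtopology)
  qed
  have "compactin ?X Z" unfolding Z_def
    by (intro compact_Int_closedin comp openin_closedin_eq[THEN iffD1, THEN conjunct2] oO)
  have ZS: "Z \<subseteq> S" by (auto simp: Z_def)
  have "Z \<noteq> {}" using np Zpar by (auto simp: parallel_along_def parallel_at_def)
  \<comment> \<open>Defined without charts, hence comparable over all of \<open>Z\<close>;
    continuity is checked through the coordinate expression near each point.\<close>
  define f where "f p = g p (snd (\<xi> p)) (snd (\<xi> p))" for p
  have f: "f q = coord_metric A g c (cmap c q) (\<eta> (cmap c q)) (\<eta> (cmap c q))"
    if "adapted S \<xi> c L \<eta>" "q \<in> S" "q \<in> cdom c" for c L \<eta> q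
    using adapted_field[OF that] metric_tvec_at[of c q] adapted_max[OF that(1)] that(3)
    by (simp add: f_def charts_at_iff)
  have "continuous_map (subtopology ?X Z) euclideanreal f"
    unfolding continuous_map_def
  proof (intro conjI allI impI)
    fix V :: "real set" assume V: "openin euclideanreal V"
    have nbhd: "\<exists>W. openin ?X W \<and> p \<in> W \<and> Z \<inter> W \<subseteq> {q \<in> Z. f q \<in> V}" if p: "p \<in> Z" "f p \<in> V" for p
    proof -
      have pS: "p \<in> S" using p ZS by blast
      obtain c L \<eta> where ad: "adapted S \<xi> c L \<eta>" "p \<in> cdom c" using adapted_exists[OF S \<xi> pS] by blast
      note c = adapted_max[OF ad(1)]
      let ?E = "\<lambda>y. coord_metric A g c y (\<eta> y) (\<eta> y)"
      let ?V = "crange c \<inter> ?E -` V"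
      have "continuous_on (crange c) ?E"
        using coord_metric_has_derivative[OF c _ smooth_on_has_derivative[OF adapted_smooth[OF ad(1)]] smooth_on_has_derivative[OF adapted_smooth[OF ad(1)]]]
        by (intro continuous_at_imp_continuous_on ballI) (blast intro: has_derivative_continuous)
      then have "open ?V" using open_crange[OF c] V by (intro continuous_open_preimage) auto
      then have "openin ?X {q \<in> cdom c. cmap c q \<in> ?V}" by (rule openin_chart_preimage[OF c])
      moreover have "p \<in> {q \<in> cdom c. cmap c q \<in> ?V}" using ad(2) p(2) f[OF ad(1) pS ad(2)] by auto
      moreover have "Z \<inter> {q \<in> cdom c. cmap c q \<in> ?V} \<subseteq> {q \<in> Z. f q \<in> V}" using f[OF ad(1)] ZS by auto
      ultimately show ?thesis by blast
    qed
    have "openin (subtopology ?X Z) {q \<in> Z. f q \<in> V}"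
    proof (subst openin_subopen, intro ballI)
      fix p assume "p \<in> {q \<in> Z. f q \<in> V}"
      then obtain W where W: "openin ?X W" "p \<in> W" "Z \<inter> W \<subseteq> {q \<in> Z. f q \<in> V}" "p \<in> Z" using nbhd by blast
      have "openin (subtopology ?X Z) (Z \<inter> W)" using W(1) by (rule openin_subtopology_Int2)
      then show "\<exists>T. openin (subtopology ?X Z) T \<and> p \<in> T \<and> T \<subseteq> {q \<in> Z. f q \<in> V}" using W by blast
    qed
    moreover have "topspace (subtopology ?X Z) = Z" using ZS SA by (auto simp: topspace_mtopology)
    ultimately show "openin (subtopology ?X Z) {q \<in> topspace (subtopology ?X Z). f q \<in> V}" by simp
  qed auto
  then have "compact (f ` Z)"
    using image_compactin[of "subtopology ?X Z" Z euclideanreal f] \<open>compactin ?X Z\<close>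
    by (simp add: compactin_subtopology)
  then obtain p where p: "p \<in> Z" "\<And>q. q \<in> Z \<Longrightarrow> f q \<le> f p"
    using compact_attains_sup[of "f ` Z"] \<open>Z \<noteq> {}\<close> by auto
  have pS: "p \<in> S" using p ZS by blast
  obtain c L \<eta> where ad: "adapted S \<xi> c L \<eta>" "p \<in> cdom c" using adapted_exists[OF S \<xi> pS] by blast
  note c = adapted_max[OF ad(1)] and sc = adapted_slice[OF ad(1)] and sm = adapted_smooth[OF ad(1)]
  let ?x = "cmap c p"
  have x: "?x \<in> crange c" "?x \<in> L" using ad(2) slice_chart_mem[OF sc ad(2)] pS by auto
  obtain v where v: "v \<in> L" "cov c \<eta> ?x v \<noteq> 0" using par[OF ad(1) pS ad(2)] Zpar[OF pS] p(1) by blast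
  \<comment> \<open>Nonvanishing for this fixed \<open>v\<close> is an open condition, and it forces
    slice points to lie in \<open>Z\<close>; the maximum over \<open>Z\<close> is therefore a
    maximum over \<open>U \<inter> L\<close>.\<close>
  define U where "U = crange c \<inter> (\<lambda>y. cov c \<eta> y v) -` (- {0})"
  have "continuous_on (crange c) (\<lambda>y. cov c \<eta> y v)"
    using cov_has_derivative[OF c _ sm]
    by (intro continuous_at_imp_continuous_on ballI) (blast intro: has_derivative_continuous)
  then have oU: "open U" unfolding U_def by (intro continuous_open_preimage open_crange[OF c]) auto
  have xU: "?x \<in> U" using x v by (simp add: U_def)
  have "coord_metric A g c y (\<eta> y) (\<eta> y) \<le> coord_metric A g c ?x (\<eta> ?x) (\<eta> ?x)" if y: "y \<in> U" "y \<in> L" for y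
  proof -
    obtain q where q: "q \<in> cdom c" "y = cmap c q" using y by (auto simp: U_def)
    have qS: "q \<in> S" using slice_chart_mem[OF sc q(1)] q y by simp
    have "q \<in> Z" using Zpar[OF qS] par[OF ad(1) qS q(1)] y v q by (auto simp: U_def)
    then show ?thesis using p(2)[of q] f[OF ad(1) qS q(1)] f[OF ad(1) pS ad(2)] q(2) by metis
  qed
  then have "cov c \<eta> ?x v = 0"
    by (intro cov_zero_at_maximum[OF c sm adapted_subspace[OF ad(1)] x(2) oU xU _ van[OF ad(1)]] v) (auto simp: U_def)
  then show False using v by simp
qed

text \<open>Each adapted chart turns the hypothesis on the image into
  \<open>second_cov_vanishes\<close>: the first half of that condition is the total geodesy of
  \<open>S\<close>, and the second feeds the compactness argument.\<close>

lemma totally_geodesic_of_image: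
  assumes S: "submanifold A S l" and \<xi>: "vector_field_along A S \<xi>" and comp: "compactin (mtopology A) S"
    and tg: "totally_geodesic (tangent_atlas A) (sasaki_metric A g) (\<xi> ` S) l"
  shows "totally_geodesic A g S l" "parallel_along A g S \<xi>"
proof -
  have f: "\<And>q. q \<in> S \<Longrightarrow> fst (\<xi> q) = q" using \<xi> by (simp add: vector_field_along_def)
  have van: "second_cov_vanishes c L \<eta>" if ad: "adapted S \<xi> c L \<eta>" for c L \<eta>
    using T.totally_geodesic_slice[OF tg graph_chart_slice[OF ad f]]
    unfolding second_cov_vanishes_def graph_slice_geodesic_iff[OF adapted_max[OF ad] adapted_smooth[OF ad] adapted_subspace[OF ad]] .
  show "parallel_along A g S \<xi>" by (rule parallel_if_second_cov_vanishes[OF S \<xi> comp van])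
  show "totally_geodesic A g S l"
  proof (rule totally_geodesicI[OF S])
    fix p assume "p \<in> S"
    then obtain c L \<eta> where ad: "adapted S \<xi> c L \<eta>" "p \<in> cdom c" using adapted_exists[OF S \<xi>] by blast
    have "slice_geodesic c L" using van[OF ad(1)] by (simp add: slice_geodesic_def second_cov_vanishes_def)
    then show "\<exists>c L. slice_chart S c L \<and> p \<in> cdom c \<and> slice_geodesic c L" using ad adapted_slice by blast
  qed
qed

end

theorem theorem4p2:
  fixes A :: "('a, 'e::euclidean_space) chart set"
    and g :: "('a, 'e) metric"
    and F :: "'a set" and l :: nat
    and Or :: "'a \<Rightarrow> ('a, 'e) tvec list set"
    and \<xi> :: "'a \<Rightarrow> 'a \<times> ('a, 'e) tvec"
  assumes "smooth_manifold A" and "riemannian_metric A g" and "flat_metric A g"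
    and "submanifold A F l" and "compactin (mtopology A) F" and "orientation A F Or"
    and "vector_field_along A F \<xi>"
  shows "totally_geodesic (tangent_atlas A) (sasaki_metric A g) (\<xi> ` F) l \<longleftrightarrow>
         totally_geodesic A g F l \<and> parallel_along A g F \<xi>"
proof -
  interpret flat_atlas A g
    using assms(1-3) by unfold_locales (simp_all add: smooth_manifold_def)
  show ?thesis
    using totally_geodesic_of_image[OF assms(4,7,5)] totally_geodesic_image[OF _ assms(7)] by blast
qed

end
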